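(* Let $F:\mathbb{R}^n\to\mathbb{R}$ be a random ReLU neural network function with hidden layer widths $(n_1,\dots,n_\ell)$, whose parameters (all weights and biases) are drawn as in the context. Then the probability that $F$ is PL Morse equals $$\frac{\sum_{k=n+1}^{n_1}\binom{n_1}{k}}{2^{n_1}}\quad\text{if }\ell=1,$$ and is at most $\dfrac{\sum_{k=n+1}^{n_1}\binom{n_1}{k}}{2^{n_1}}$ if $\ell>1$. (An empty sum is $0$.)
   Context: A ReLU neural network function $F:\mathbb{R}^{n_0}\to\mathbb{R}$ with hidden layer widths $(n_1,\dots,n_\ell)$ is $F=A_{\ell+1}\circ\sigma\circ A_\ell\circ\cdots\circ\sigma\circ A_1$, where $A_i:\mathbb{R}^{n_{i-1}}\to\mathbb{R}^{n_i}$ ($n_{\ell+1}=1$) are affine maps and $\sigma$ applies $\mathrm{ReLU}(t)=\max\{0,t\}$ in each coordinate. Random model: all entries of the weight matrices and bias vectors are i.i.d. with a distribution that is absolutely continuous with respect to Lebesgue measure and symmetric about $0$. PL Morse (for a map $F:\mathbb{R}^n\to\mathbb{R}$, $\mathbb{R}^n$ with its standard PL structure): a point $p$ is PL regular if there is a PL homeomorphism from a neighborhood of $p$ onto a neighborhood of $0\in\mathbb{R}^n$ sending $p$ to $0$ in whose coordinates $F(x)=F(p)+x_n$; $p$ is PL nondegenerate-critical of index $k$ if there is such a chart in which $F(x)=F(p)-|x_1|-\dots-|x_k|+|x_{k+1}|+\dots+|x_n|$; otherwise $p$ is PL degenerate-critical. $F$ is PL Morse if every point is PL regular or PL nondegenerate-critical.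 *)

theory Defs
  imports "HOL-Probability.Probability"
begin

definition net_dims :: "nat \<Rightarrow> nat list \<Rightarrow> nat list" where
  "net_dims n ws = n # ws @ [1]"

text \<open>Parameters are a function theta :: nat*nat*nat => real.  For the affine map of layer
  i (0-based, i = 0..l, the map A_(i+1) : R^(d!i) -> R^(d!(i+1))), theta(i,j,k) with k < d!i
  is the weight entry in row j, column k, and theta(i,j,d!i) is the j-th bias entry.\<close>
definition net_params :: "nat \<Rightarrow> nat list \<Rightarrow> (nat \<times> nat \<times> nat) set" where
  "net_params n ws = {(i,j,k). i \<le> length ws \<and> j < net_dims n ws ! (i+1) \<and> k \<le> net_dims n ws ! i}"

definition affine_layer :: "nat list \<Rightarrow> (nat \<times> nat \<times> nat \<Rightarrow> real) \<Rightarrow> nat \<Rightarrow> (nat \<Rightarrow> real) \<Rightarrow> nat \<Rightarrow> real" where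
  "affine_layer d \<theta> i x j = (\<Sum>k<d ! i. \<theta> (i,j,k) * x k) + \<theta> (i, j, d ! i)"

definition relu :: "real \<Rightarrow> real" where
  "relu t = max 0 t"

fun hidden_out :: "nat list \<Rightarrow> (nat \<times> nat \<times> nat \<Rightarrow> real) \<Rightarrow> nat \<Rightarrow> (nat \<Rightarrow> real) \<Rightarrow> nat \<Rightarrow> real" where
  "hidden_out d \<theta> 0 x = x"
| "hidden_out d \<theta> (Suc i) x = (\<lambda>j. relu (affine_layer d \<theta> i (hidden_out d \<theta> i x) j))"

definition coord_enum :: "nat \<Rightarrow> 'n::finite" where
  "coord_enum = (SOME e. bij_betw e {..<CARD('n)} (UNIV :: 'n set))"

definition relu_net :: "nat list \<Rightarrow> (nat \<times> nat \<times> nat \<Rightarrow> real) \<Rightarrow> real^'n::finite \<Rightarrow> real" where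
  "relu_net ws \<theta> x =
     (let d = net_dims CARD('n) ws; l = length ws
      in affine_layer d \<theta> l (hidden_out d \<theta> l (\<lambda>k. x $ coord_enum k)) 0)"

definition affine_map :: "('a::real_vector \<Rightarrow> 'b::real_vector) \<Rightarrow> bool" where
  "affine_map A \<longleftrightarrow> (\<exists>L c. linear L \<and> A = (\<lambda>y. L y + c))"

definition pl_on :: "('a::euclidean_space) set \<Rightarrow> ('a \<Rightarrow> 'b::real_vector) \<Rightarrow> bool" where
  "pl_on U f \<longleftrightarrow> (\<forall>x\<in>U. \<exists>e>0. \<exists>\<P>. finite \<P> \<and>
      cball x e \<subseteq> \<Union>(fst ` \<P>) \<and>
      (\<forall>(P,A)\<in>\<P>. polytope P \<and> affine_map A \<and> (\<forall>y\<in>P \<inter> U \<inter> cball x e. f y = A y)))"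

definition pl_homeomorphism :: "('a::euclidean_space) set \<Rightarrow> 'a set \<Rightarrow> ('a \<Rightarrow> 'a) \<Rightarrow> ('a \<Rightarrow> 'a) \<Rightarrow> bool" where
  "pl_homeomorphism U V h g \<longleftrightarrow> homeomorphism U V h g \<and> pl_on U h \<and> pl_on V g"

definition pl_regular_point :: "(real^'n::finite \<Rightarrow> real) \<Rightarrow> real^'n \<Rightarrow> bool" where
  "pl_regular_point F p \<longleftrightarrow> (\<exists>U V h g. open U \<and> p \<in> U \<and> open V \<and> 0 \<in> V \<and>
      pl_homeomorphism U V h g \<and> h p = 0 \<and>
      (\<forall>x\<in>V. F (g x) = F p + x $ coord_enum (CARD('n) - 1)))"

definition pl_nondeg_critical_point :: "(real^'n::finite \<Rightarrow> real) \<Rightarrow> real^'n \<Rightarrow> nat \<Rightarrow> bool" where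
  "pl_nondeg_critical_point F p k \<longleftrightarrow> k \<le> CARD('n) \<and>
     (\<exists>U V h g. open U \<and> p \<in> U \<and> open V \<and> 0 \<in> V \<and>
      pl_homeomorphism U V h g \<and> h p = 0 \<and>
      (\<forall>x\<in>V. F (g x) = F p - (\<Sum>i<k. \<bar>x $ coord_enum i\<bar>)
                              + (\<Sum>i\<in>{k..<CARD('n)}. \<bar>x $ coord_enum i\<bar>)))"

definition pl_morse :: "(real^'n::finite \<Rightarrow> real) \<Rightarrow> bool" where
  "pl_morse F \<longleftrightarrow> (\<forall>p. pl_regular_point F p \<or> (\<exists>k. pl_nondeg_critical_point F p k))"

definition admissible_distribution :: "real measure \<Rightarrow> bool" where
  "admissible_distribution \<mu> \<longleftrightarrow> prob_space \<mu> \<and> sets \<mu> = sets borel \<and>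
     absolutely_continuous lborel \<mu> \<and> distr \<mu> borel uminus = \<mu>"

definition param_measure :: "nat \<Rightarrow> nat list \<Rightarrow> real measure \<Rightarrow> (nat \<times> nat \<times> nat \<Rightarrow> real) measure" where
  "param_measure n ws \<mu> = PiM (net_params n ws) (\<lambda>_. \<mu>)"

end

theory Submission
  imports Defs "HOL-Complex_Analysis.Great_Picard"
begin

text \<open>If some point makes all first-layer neurons strictly negative, the network is constant near
  it and hence not PL Morse. For weights in general position, \<open>n\<^sub>1\<close> hyperplanes in \<open>n\<close>-space have
  \<open>\<Sum>k\<le>n. (n\<^sub>1 choose k)\<close> regions, and flipping the sign of neurons preserves the distribution, so each
  of the \<open>2 ^ n\<^sub>1\<close> sign patterns is equally likely to be realised; this gives the probability of a
  dead region. With one hidden layer and no dead region, a generic network is, at every point, a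
  sum of functions of independent linear coordinates with nonzero slopes, for which charts can be
  written down.

  The product measure is not complete, so measurability of the PL Morse event needs the degenerate
  parameters as well. The germ at a point depends only on which neurons vanish or are on there, and
  for each of these finitely many patterns the existence of a chart is an \<open>F\<^sub>\<sigma>\<close> condition:
  a PL chart is a Lipschitz selection of finitely many affine maps, and for fixed bounds on
  their number, their size, and the radius, such charts are closed under limits.\<close>

section \<open>Continuous selections of affine maps are piecewise linear\<close>

text \<open>Region counting yields a probability because, for almost all parameters, the number of
  realised on/off patterns is one constant; its expectation is also the sum of 2^n1 equal
  probabilities. Only first-layer rows are flipped: what must be invariant is the law of the sign
  patterns, not the Morse event. The obstacle with one hidden layer is that the linear part of a
  germ is a weighted sum of the very rows that serve as local coordinates. General position of the
  hyperplanes therefore does not suffice: the slopes on both sides of a coordinate are nonzero only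
  if such sums over the on neurons, with or without one more neuron, avoid the spans of fewer than n
  other rows. Up to null sets, each such condition fails on finitely many sets that meet every line
  parallel to some parameter axis in at most one point, so Fubini applies. With several hidden
  layers no measurability of the Morse event is asserted; it is enclosed in the measurable event
  that there is no dead region.\<close>

lemma affine_mapE:
  assumes "affine_map A"
  obtains L c where "linear L" "\<And>y. A y = L y + c"
  using assms unfolding affine_map_def by auto

lemma affine_map_linear_add: "linear L \<Longrightarrow> affine_map (\<lambda>y. L y + c)"
  unfolding affine_map_def by blast

lemma affine_map_convex_comb:
  assumes "affine_map A"
  shows "A ((1 - t) *\<^sub>R x + t *\<^sub>R y) = (1 - t) *\<^sub>R A x + t *\<^sub>R A y"
proof -
  obtain L c where L: "linear L" "\<And>y. A y = L y + c"
    using assms by (rule affine_mapE) blast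
  show ?thesis
    unfolding L(2) linear_add[OF L(1)] linear_scale[OF L(1)] by (simp add: algebra_simps)
qed

lemma continuous_on_affine_map:
  fixes A :: "'a::euclidean_space \<Rightarrow> 'b::euclidean_space"
  assumes "affine_map A"
  shows "continuous_on S A"
proof -
  obtain L c where L: "linear L" "A = (\<lambda>y. L y + c)"
    using assms unfolding affine_map_def by blast
  show ?thesis unfolding L
    using L(1) by (intro continuous_intros linear_continuous_on) (simp add: linear_conv_bounded_linear)
qed

lemma affine_map_diff:
  fixes A :: "'a::real_vector \<Rightarrow> 'b::real_vector"
  assumes "affine_map A" "affine_map B"
  shows "affine_map (\<lambda>x. A x - B x)"
proof -
  obtain L c where L: "linear L" "\<And>y. A y = L y + c" using assms(1) by (rule affine_mapE) blast
  obtain M d where M: "linear M" "\<And>y. B y = M y + d" using assms(2) by (rule affine_mapE) blast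
  have "affine_map (\<lambda>y. (L y - M y) + (c - d))"
    by (intro affine_map_linear_add linear_compose_sub L M)
  then show ?thesis by (simp add: L M algebra_simps)
qed

lemma affine_map_add:
  fixes A :: "'a::real_vector \<Rightarrow> 'b::real_vector"
  assumes "affine_map A" "affine_map B"
  shows "affine_map (\<lambda>x. A x + B x)"
proof -
  obtain L c where L: "linear L" "\<And>y. A y = L y + c" using assms(1) by (rule affine_mapE) blast
  obtain M d where M: "linear M" "\<And>y. B y = M y + d" using assms(2) by (rule affine_mapE) blast
  have "affine_map (\<lambda>y. (L y + M y) + (c + d))"
    by (intro affine_map_linear_add linear_compose_add L M)
  then show ?thesis by (simp add: L M algebra_simps)
qed

lemma affine_map_compose:
  assumes "affine_map A" "affine_map B"
  shows "affine_map (\<lambda>x. A (B x))"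
proof -
  obtain L c where L: "linear L" "\<And>y. A y = L y + c" using assms(1) by (rule affine_mapE) blast
  obtain M d where M: "linear M" "\<And>y. B y = M y + d" using assms(2) by (rule affine_mapE) blast
  have "affine_map (\<lambda>y. (L \<circ> M) y + (L d + c))"
    by (intro affine_map_linear_add linear_compose L M)
  then show ?thesis using L(1) by (simp add: L M linear_add algebra_simps)
qed

lemma affine_map_linear: "linear L \<Longrightarrow> affine_map L"
  using affine_map_linear_add[of L 0] by simp

lemma affine_map_const: "affine_map (\<lambda>x. c)"
  using affine_map_linear_add[OF linear_zero, of c] by simp

lemma affine_map_real_inner:
  fixes A :: "'a::euclidean_space \<Rightarrow> real"
  assumes "affine_map A"
  obtains a b where "\<And>y. A y = a \<bullet> y + b"
proof -
  obtain L c where L: "linear L" "\<And>y. A y = L y + c" using assms(1) by (rule affine_mapE) blast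
  have "L y = adjoint L 1 \<bullet> y" for y
    using adjoint_works[OF L(1), of y 1] by (simp add: inner_commute)
  then show thesis using that[of "adjoint L 1" c] L(2) by simp
qed

text \<open>Allowing \<open>A y = 0\<close> closes the sign cell, so that it can be a polytope
  piece. A number \<open>s\<close> that is not a sign leaves just the hyperplane.\<close>

lemma polyhedron_sign_condition:
  fixes A :: "'a::euclidean_space \<Rightarrow> real"
  assumes "affine_map A"
  shows "polyhedron {y. A y = 0 \<or> sgn (A y) = s}"
proof -
  obtain a b where A: "\<And>y. A y = a \<bullet> y + b" using affine_map_real_inner[OF assms] by blast
  consider "s = 0" | "s = 1" | "s = -1" | "s \<notin> {-1,0,1}" by blast
  then show ?thesis
  proof cases
    case 1
    have "{y. A y = 0 \<or> sgn (A y) = s} = {y. a \<bullet> y = - b}"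
      using 1 by (auto simp: A sgn_zero_iff)
    then show ?thesis by (simp add: polyhedron_hyperplane)
  next
    case 2
    have "{y. A y = 0 \<or> sgn (A y) = s} = {y. a \<bullet> y \<ge> - b}"
      using 2 by (auto simp: A sgn_1_pos)
    then show ?thesis by (simp add: polyhedron_halfspace_ge)
  next
    case 3
    have "{y. A y = 0 \<or> sgn (A y) = s} = {y. a \<bullet> y \<le> - b}"
      using 3 by (auto simp: A sgn_1_neg)
    then show ?thesis by (simp add: polyhedron_halfspace_le)
  next
    case 4
    have "{y. A y = 0 \<or> sgn (A y) = s} = {y. a \<bullet> y = - b}"
      using 4 by (auto simp: A sgn_if split: if_splits)
    then show ?thesis by (simp add: polyhedron_hyperplane)
  qed
qed

lemma convex_sgn_eq:
  fixes A :: "'a::euclidean_space \<Rightarrow> real"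
  assumes "affine_map A"
  shows "convex {y. sgn (A y) = s}"
proof -
  obtain a b where A: "\<And>y. A y = a \<bullet> y + b" using affine_map_real_inner[OF assms] by blast
  consider "s = 0" | "s = 1" | "s = -1" | "s \<notin> {-1,0,1}" by blast
  then show ?thesis
  proof cases
    case 1
    have "{y. sgn (A y) = s} = {y. a \<bullet> y = - b}"
      using 1 by (auto simp: A sgn_zero_iff)
    then show ?thesis by (simp add: convex_hyperplane)
  next
    case 2
    have "{y. sgn (A y) = s} = {y. a \<bullet> y > - b}"
      using 2 by (auto simp: A sgn_1_pos)
    then show ?thesis by (simp add: convex_halfspace_gt)
  next
    case 3
    have "{y. sgn (A y) = s} = {y. a \<bullet> y < - b}"
      using 3 by (auto simp: A sgn_1_neg)
    then show ?thesis by (simp add: convex_halfspace_lt)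
  next
    case 4
    have "{y. sgn (A y) = s} = {}"
      using 4 by (auto simp: A sgn_if split: if_splits)
    then show ?thesis by simp
  qed
qed

text \<open>On a cell of the arrangement of all hyperplanes where a coordinate of two of the affine maps
  agree, any two of these maps agree everywhere or nowhere, so a continuous selection
  cannot switch between different maps inside the (connected) cell.\<close>

lemma selection_affine_on_cell:
  fixes f :: "'a::euclidean_space \<Rightarrow> 'b::euclidean_space"
  assumes K: "convex K" "c \<in> K" and contf: "continuous_on K f"
    and fin: "finite \<A>" and aff: "\<And>A. A \<in> \<A> \<Longrightarrow> affine_map A"
    and sel: "\<And>x. x \<in> K \<Longrightarrow> \<exists>A\<in>\<A>. f x = A x"
    and A: "A \<in> \<A>" "f c = A c"
    and y: "y \<in> K" "\<And>A B i. A \<in> \<A> \<Longrightarrow> B \<in> \<A> \<Longrightarrow> i \<in> Basis \<Longrightarrow>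
      (A y - B y) \<bullet> i = 0 \<or> sgn ((A y - B y) \<bullet> i) = sgn ((A c - B c) \<bullet> i)"
  shows "f y = A y"
proof -
  define C where "C = {z\<in>K. \<forall>A\<in>\<A>. \<forall>B\<in>\<A>. \<forall>i\<in>Basis. sgn ((A z - B z) \<bullet> i) = sgn ((A c - B c) \<bullet> i)}"
  have aff_coord: "affine_map (\<lambda>z. (A z - B z) \<bullet> i)" if "A \<in> \<A>" "B \<in> \<A>" for A B and i :: 'b
    using affine_map_compose[OF affine_map_linear affine_map_diff[OF aff[OF that(1)] aff[OF that(2)]], of "\<lambda>z. z \<bullet> i"]
    by (simp add: bounded_linear.linear bounded_linear_inner_left)
  have "C = K \<inter> (\<Inter>A\<in>\<A>. \<Inter>B\<in>\<A>. \<Inter>i\<in>Basis. {z. sgn ((A z - B z) \<bullet> i) = sgn ((A c - B c) \<bullet> i)})"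
    unfolding C_def by auto
  also have "convex \<dots>"
    by (intro convex_Int convex_INT K(1) convex_sgn_eq aff_coord)
  finally have "connected C" by (rule convex_connected)
  have agree: "A z = B z \<longleftrightarrow> A c = B c" if "z \<in> C" "A \<in> \<A>" "B \<in> \<A>" for A B z
  proof -
    have "((A z - B z) \<bullet> i = 0) = ((A c - B c) \<bullet> i = 0)" if "i \<in> Basis" for i
    proof -
      have "sgn ((A z - B z) \<bullet> i) = sgn ((A c - B c) \<bullet> i)"
        using \<open>z \<in> C\<close> \<open>A \<in> \<A>\<close> \<open>B \<in> \<A>\<close> that unfolding C_def by blast
      then show ?thesis by (metis sgn_eq_0_iff)
    qed
    then have "(\<forall>i\<in>Basis. (A z - B z) \<bullet> i = 0) = (\<forall>i\<in>Basis. (A c - B c) \<bullet> i = 0)" by blast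
    then show ?thesis
      by (simp add: euclidean_all_zero_iff)
  qed
  have contC: "continuous_on C f" using contf by (rule continuous_on_subset) (auto simp: C_def)
  have closed_eq: "closedin (top_of_set C) {z\<in>C. f z = B z}" if "B \<in> \<A>" for B
  proof -
    have "closedin (top_of_set C) {z\<in>C. f z - B z = 0}"
      by (intro continuous_closedin_preimage_constant continuous_intros contC continuous_on_affine_map aff that)
    then show ?thesis by simp
  qed
  define C2 where "C2 = (\<Union>B\<in>{B\<in>\<A>. B c \<noteq> A c}. {z\<in>C. f z = B z})"
  have "closedin (top_of_set C) C2"
    unfolding C2_def using fin closed_eq by (intro closedin_Union) auto
  moreover have "closedin (top_of_set C) {z\<in>C. f z = A z}" using closed_eq A by blast
  moreover have "{z\<in>C. f z = A z} \<inter> C2 = {}"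
    unfolding C2_def using agree A(1) by fastforce
  moreover have "C \<subseteq> {z\<in>C. f z = A z} \<union> C2"
  proof
    fix z assume z: "z \<in> C"
    then obtain B where B: "B \<in> \<A>" "f z = B z" using sel[of z] unfolding C_def by blast
    show "z \<in> {z\<in>C. f z = A z} \<union> C2"
      using z B agree[OF z B(1) A(1)] unfolding C2_def by fastforce
  qed
  moreover have "c \<in> {z\<in>C. f z = A z}" using K A unfolding C_def by auto
  ultimately have "C2 = {}"
    using \<open>connected C\<close> unfolding connected_closedin by blast
  then have fC: "f z = A z" if "z \<in> C" for z
    using \<open>C \<subseteq> {z\<in>C. f z = A z} \<union> C2\<close> that by blast
  \<comment> \<open>The point \<open>y\<close> may lie only in the closure of \<open>C\<close>.
    Points of the segment towards \<open>c\<close> keep a positive share of \<open>c\<close>, hence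
    its strict signs, and they converge to \<open>y\<close>.\<close>
  define s where "s k = (1 - inverse (real (Suc k))) *\<^sub>R y + inverse (real (Suc k)) *\<^sub>R c" for k
  have sC: "s k \<in> C" for k
    unfolding C_def
  proof (intro CollectI conjI ballI)
    have k: "0 < inverse (real (Suc k))" "inverse (real (Suc k)) \<le> 1" by (auto simp: field_simps)
    show "s k \<in> K"
      unfolding s_def using k K y(1) by (intro convexD) auto
    fix A B and i :: 'b assume AB: "A \<in> \<A>" "B \<in> \<A>" "i \<in> Basis"
    have "(A (s k) - B (s k)) \<bullet> i
        = (1 - inverse (real (Suc k))) * ((A y - B y) \<bullet> i) + inverse (real (Suc k)) * ((A c - B c) \<bullet> i)"
      unfolding s_def affine_map_convex_comb[OF aff[OF AB(1)]] affine_map_convex_comb[OF aff[OF AB(2)]]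
      by (simp add: inner_simps algebra_simps)
    moreover have "sgn ((1 - t) * u + t * v) = sgn v"
      if "0 < t" "t \<le> 1" "u = 0 \<or> sgn u = sgn v" for t u v :: real
    proof (cases "u = 0")
      case True
      then show ?thesis using that by (simp add: sgn_mult)
    next
      case False
      then have "sgn u = sgn v" using that by blast
      then consider "u > 0" "v > 0" | "u < 0" "v < 0"
        using False by (auto simp: sgn_if split: if_splits)
      then show ?thesis
      proof cases
        case 1
        have "(1 - t) * u + t * v > 0" using 1 that(1,2)
          by (intro add_nonneg_pos mult_nonneg_nonneg mult_pos_pos) auto
        then show ?thesis using 1 by simp
      next
        case 2
        have "(1 - t) * u + t * v < 0" using 2 that(1,2)
          by (intro add_nonpos_neg mult_nonneg_nonpos mult_pos_neg) auto
        then show ?thesis using 2 by simp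
      qed
    qed
    ultimately show "sgn ((A (s k) - B (s k)) \<bullet> i) = sgn ((A c - B c) \<bullet> i)"
      using k y(2)[OF AB] by simp
  qed
  have "s \<longlonglongrightarrow> (1 - 0) *\<^sub>R y + 0 *\<^sub>R c"
    unfolding s_def by (intro tendsto_intros LIMSEQ_inverse_real_of_nat)
  then have sy: "s \<longlonglongrightarrow> y" by simp
  have "(\<lambda>k. f (s k)) \<longlonglongrightarrow> f y"
    using contf sy y(1) sC unfolding C_def continuous_on_sequentially comp_def by blast
  moreover have "(\<lambda>k. A (s k)) \<longlonglongrightarrow> A y"
    using continuous_on_affine_map[OF aff[OF A(1)], of UNIV] sy
    unfolding continuous_on_sequentially comp_def by blast
  ultimately show ?thesis using fC[OF sC] by (simp add: LIMSEQ_unique)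
qed

text \<open>Cutting a box by all coincidence hyperplanes of pairs of maps, coordinate by coordinate,
  gives finitely many closed cells. On the cell of a point \<open>c\<close>, the function follows
  whichever map it agrees with at \<open>c\<close>. Polytopes thus never have to be exhibited for
  concrete charts.\<close>

lemma pl_on_selection:
  fixes f :: "'a::euclidean_space \<Rightarrow> 'b::euclidean_space"
  assumes U: "open U" and contf: "continuous_on U f"
    and fin: "finite \<A>" and aff: "\<And>A. A \<in> \<A> \<Longrightarrow> affine_map A"
    and sel: "\<And>x. x \<in> U \<Longrightarrow> \<exists>A\<in>\<A>. f x = A x"
  shows "pl_on U f"
  unfolding pl_on_def
proof
  fix x assume "x \<in> U"
  then obtain a b where ab: "x \<in> box a b" "cbox a b \<subseteq> U"
    using open_contains_cbox[OF U] by metis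
  then obtain e where e: "e > 0" "cball x e \<subseteq> box a b"
    using open_contains_cball[of "box a b"] by auto
  define H :: "(('a \<Rightarrow> 'b) \<times> ('a \<Rightarrow> 'b) \<times> 'b) set" where "H = \<A> \<times> \<A> \<times> Basis"
  define l where "l = (\<lambda>(A::'a \<Rightarrow> 'b,B::'a \<Rightarrow> 'b,i::'b) y. (A y - B y) \<bullet> i)"
  define Q where "Q s = cbox a b \<inter> (\<Inter>t\<in>H. {y. l t y = 0 \<or> sgn (l t y) = s t})" for s
  define Sg where "Sg = PiE H (\<lambda>_. {-1,0,1::real})"
  have finH: "finite H" unfolding H_def using fin by simp
  have "affine_map (l t)" if "t \<in> H" for t
  proof -
    obtain A B i where t: "t = (A,B,i)" "A \<in> \<A>" "B \<in> \<A>" using \<open>t \<in> H\<close> unfolding H_def by (metis mem_Times_iff prod.collapse)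
    show ?thesis
      using affine_map_compose[OF affine_map_linear affine_map_diff[OF aff[OF t(2)] aff[OF t(3)]], of "\<lambda>z. z \<bullet> i"]
      by (simp add: bounded_linear.linear bounded_linear_inner_left l_def t)
  qed
  then have polyQ: "polytope (Q s)" for s
    unfolding polytope_eq_bounded_polyhedron Q_def
    using finH by (intro conjI polyhedron_Int polyhedron_Inter bounded_Int)
      (auto simp: polyhedron_sign_condition bounded_cbox)
  \<comment> \<open>Agreement with \<open>f\<close> is built into the set by filtering, so what
    remains to be shown is that the surviving cells cover the ball.\<close>
  define \<P> where "\<P> = {p \<in> (Q ` Sg) \<times> \<A>. \<forall>y\<in>fst p. f y = snd p y}"
  have "finite \<P>"
  proof (rule finite_subset)
    show "\<P> \<subseteq> (Q ` Sg) \<times> \<A>" unfolding \<P>_def by blast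
    show "finite ((Q ` Sg) \<times> \<A>)"
      unfolding Sg_def using finH fin by (intro finite_cartesian_product finite_imageI finite_PiE) auto
  qed
  moreover have "cball x e \<subseteq> \<Union>(fst ` \<P>)"
  proof
    fix c assume "c \<in> cball x e"
    then have c: "c \<in> cbox a b" using e box_subset_cbox by blast
    then obtain A where A: "A \<in> \<A>" "f c = A c" using sel ab by blast
    define s where "s = restrict (\<lambda>t. sgn (l t c)) H"
    have s: "s \<in> Sg" unfolding s_def Sg_def by (auto simp: sgn_if)
    have cQ: "c \<in> Q s" using c unfolding Q_def s_def by auto
    have "f y = A y" if y: "y \<in> Q s" for y
    proof (rule selection_affine_on_cell[where K="cbox a b" and c=c and \<A>=\<A> and A=A])
      show "continuous_on (cbox a b) f" using contf ab(2) by (rule continuous_on_subset)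
      show "y \<in> cbox a b" using y unfolding Q_def by blast
      show "(A y - B y) \<bullet> i = 0 \<or> sgn ((A y - B y) \<bullet> i) = sgn ((A c - B c) \<bullet> i)"
        if "A \<in> \<A>" "B \<in> \<A>" "i \<in> Basis" for A B i
        using that y unfolding Q_def s_def H_def l_def by force
    qed (use sel ab fin aff A c in \<open>auto simp: convex_box\<close>)
    then have "(Q s, A) \<in> \<P>" unfolding \<P>_def using s A by auto
    then show "c \<in> \<Union>(fst ` \<P>)" using cQ by force
  qed
  moreover have "\<forall>(P,A)\<in>\<P>. polytope P \<and> affine_map A \<and> (\<forall>y\<in>P \<inter> U \<inter> cball x e. f y = A y)"
    unfolding \<P>_def using polyQ aff by auto
  ultimately show "\<exists>e>0. \<exists>\<P>. finite \<P> \<and> cball x e \<subseteq> \<Union>(fst ` \<P>) \<and>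
      (\<forall>(P,A)\<in>\<P>. polytope P \<and> affine_map A \<and> (\<forall>y\<in>P \<inter> U \<inter> cball x e. f y = A y))"
    using e(1) by blast
qed

section \<open>Charts of bounded complexity\<close>

text \<open>Regular and nondegenerate-critical points differ only in the model \<open>M\<close>, so
  both are treated as instances of this predicate.\<close>

definition has_chart :: "('a::euclidean_space \<Rightarrow> real) \<Rightarrow> 'a \<Rightarrow> ('a \<Rightarrow> real) \<Rightarrow> bool" where
  "has_chart F p M \<longleftrightarrow> (\<exists>U V h g. open U \<and> p \<in> U \<and> open V \<and> 0 \<in> V \<and>
      pl_homeomorphism U V h g \<and> h p = 0 \<and> (\<forall>x\<in>V. F (g x) = F p + M x))"

text \<open>Charts with bounded complexity: they are closed under limits by Arzela-Ascoli, which makes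
  the existence of a chart an \<open>F\<^sub>\<sigma>\<close> condition on the parameters of a function.\<close>

definition bounded_selection :: "nat \<Rightarrow> real \<Rightarrow> real \<Rightarrow> ('a::euclidean_space \<Rightarrow> 'a) \<Rightarrow> bool" where
  "bounded_selection N K r g \<longleftrightarrow> K-lipschitz_on (cball 0 r) g \<and> g 0 = 0 \<and>
     (\<exists>A :: nat \<Rightarrow> ('a \<Rightarrow>\<^sub>L 'a) \<times> 'a. (\<forall>i<N. norm (A i) \<le> K) \<and>
        (\<forall>x\<in>cball 0 r. \<exists>i<N. g x = blinfun_apply (fst (A i)) x + snd (A i)))"

text \<open>The maps are translated so that both fix 0, and \<open>G\<close> is the increment of the
  function. The inverse identities are demanded on the radius \<open>r / K\<close> because a
  \<open>K\<close>-Lipschitz map fixing 0 sends that ball into the ball of radius \<open>r\<close>,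
  where the other map is controlled.\<close>

definition bounded_chart :: "nat \<Rightarrow> real \<Rightarrow> real \<Rightarrow> ('a::euclidean_space \<Rightarrow> real) \<Rightarrow> ('a \<Rightarrow> real) \<Rightarrow> bool" where
  "bounded_chart N K r G M \<longleftrightarrow> (\<exists>g h. bounded_selection N K r g \<and> bounded_selection N K r h \<and>
     (\<forall>x\<in>cball 0 (r / K). h (g x) = x \<and> g (h x) = x) \<and> (\<forall>x\<in>cball 0 r. G (g x) = M x))"

lemma bounded_selection_mono:
  assumes "bounded_selection N K r g" "N \<le> N'" "0 \<le> K" "K \<le> K'" "r' \<le> r"
  shows "bounded_selection N' K' r' g"
proof -
  obtain A :: "nat \<Rightarrow> ('a \<Rightarrow>\<^sub>L 'a) \<times> 'a" where A: "\<And>i. i < N \<Longrightarrow> norm (A i) \<le> K"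
    "\<And>x. x \<in> cball 0 r \<Longrightarrow> \<exists>i<N. g x = blinfun_apply (fst (A i)) x + snd (A i)"
    using assms(1) unfolding bounded_selection_def by blast
  define A' where "A' i = (if i < N then A i else 0)" for i
  have "norm (A' i) \<le> K'" for i
    unfolding A'_def using A(1)[of i] assms(3,4) by auto
  moreover have "\<exists>i<N'. g x = blinfun_apply (fst (A' i)) x + snd (A' i)" if x: "x \<in> cball 0 r'" for x
  proof -
    have "x \<in> cball 0 r" using x assms(5) by auto
    then obtain i where i: "i < N" "g x = blinfun_apply (fst (A i)) x + snd (A i)" using A(2) by blast
    then show ?thesis using assms(2) by (intro exI[of _ i]) (auto simp: A'_def)
  qed
  moreover have "K'-lipschitz_on (cball 0 r') g"
  proof (rule lipschitz_on_subset[OF lipschitz_on_le])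
    show "K-lipschitz_on (cball 0 r) g" using assms(1) unfolding bounded_selection_def by blast
  qed (use assms in auto)
  ultimately show ?thesis
    using assms(1) unfolding bounded_selection_def by blast
qed

lemma bounded_chart_mono:
  assumes "bounded_chart N K r G M" "N \<le> N'" "0 < K" "K \<le> K'" "0 < r'" "r' \<le> r"
  shows "bounded_chart N' K' r' G M"
proof -
  obtain g h where gh: "bounded_selection N K r g" "bounded_selection N K r h"
     "\<forall>x\<in>cball 0 (r / K). h (g x) = x \<and> g (h x) = x" "\<forall>x\<in>cball 0 r. G (g x) = M x"
    using assms(1) unfolding bounded_chart_def by blast
  have "r' / K' \<le> r / K" using assms by (intro frac_le) auto
  then have "cball (0::'a) (r' / K') \<subseteq> cball 0 (r / K)" by auto
  moreover have "cball (0::'a) r' \<subseteq> cball 0 r" using assms by auto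
  moreover have "bounded_selection N' K' r' g" "bounded_selection N' K' r' h"
    using assms by (auto intro: bounded_selection_mono[OF gh(1)] bounded_selection_mono[OF gh(2)])
  ultimately show ?thesis
    unfolding bounded_chart_def using gh(3,4) by blast
qed

text \<open>A local converse of \<open>pl_on_selection\<close>: the polytopes are forgotten and only
  the finite list of affine maps is kept.\<close>

lemma pl_on_local_selection:
  assumes "pl_on U f" "open U" "x \<in> U"
  obtains e \<A> where "e > 0" "cball x e \<subseteq> U" "finite \<A>" "\<And>A. A \<in> \<A> \<Longrightarrow> affine_map A"
    "\<And>y. y \<in> cball x e \<Longrightarrow> \<exists>A\<in>\<A>. f y = A y"
proof -
  obtain e1 \<P> where P: "e1 > 0" "finite \<P>" "cball x e1 \<subseteq> \<Union>(fst ` \<P>)"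
      "\<forall>(P,A)\<in>\<P>. polytope P \<and> affine_map A \<and> (\<forall>y\<in>P \<inter> U \<inter> cball x e1. f y = A y)"
    using assms unfolding pl_on_def by meson
  obtain e2 where e2: "e2 > 0" "cball x e2 \<subseteq> U"
    using assms open_contains_cball by blast
  show thesis
  proof (rule that[of "min e1 e2" "snd ` \<P>"])
    show "\<exists>A\<in>snd ` \<P>. f y = A y" if y: "y \<in> cball x (min e1 e2)" for y
    proof -
      have y1: "y \<in> cball x e1" and yU: "y \<in> U" using y e2 by auto
      then obtain q where q: "q \<in> \<P>" "y \<in> fst q" using P(3) by blast
      then have "f y = snd q y" using P(4) y1 yU by (auto simp: case_prod_beta)
      then show ?thesis using q by blast
    qed
  qed (use P e2 in \<open>auto simp: case_prod_beta\<close>)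
qed

text \<open>On a segment, which convexity keeps inside \<open>S\<close>, the parameters where
  \<open>g\<close> agrees with a given map form a closed set. Finitely many of these cover the unit
  interval, and a Lipschitz bound valid on each piece of a closed cover of an interval holds on the
  whole interval.\<close>

lemma lipschitz_on_selection:
  fixes g :: "'a::euclidean_space \<Rightarrow> 'b::euclidean_space"
  assumes "convex S" "continuous_on S g" "0 \<le> K"
    and lip: "\<And>i. i < N \<Longrightarrow> K-lipschitz_on UNIV (A i)"
    and sel: "\<And>x. x \<in> S \<Longrightarrow> \<exists>i<(N::nat). g x = A i x"
  shows "K-lipschitz_on S g"
proof (rule lipschitz_onI)
  fix x y assume xy: "x \<in> S" "y \<in> S"
  define s where "s t = x + t *\<^sub>R (y - x)" for t
  have sS: "s t \<in> S" if "t \<in> {0..1}" for t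
  proof -
    have "s t = (1 - t) *\<^sub>R x + t *\<^sub>R y" unfolding s_def by (simp add: algebra_simps)
    then show ?thesis using convexD_alt[OF assms(1) xy, of t] that by auto
  qed
  have conts: "continuous_on T s" for T unfolding s_def by (intro continuous_intros)
  define U where "U i = {t\<in>{0..1}. g (s t) - A i (s t) = 0}" for i
  have contA: "continuous_on T (A i)" if "i < N" for T i
    using lipschitz_on_continuous_on[OF lip[OF that]] continuous_on_subset by blast
  have "(K * norm (y - x))-lipschitz_on {0..1} (g \<circ> s)"
  proof (rule lipschitz_on_closed_Union[where I="{..<N}" and U=U])
    fix i assume i: "i \<in> {..<N}"
    show "(K * norm (y - x))-lipschitz_on (U i) (g \<circ> s)"
    proof (rule lipschitz_onI)
      fix t u assume tu: "t \<in> U i" "u \<in> U i"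
      have "dist ((g \<circ> s) t) ((g \<circ> s) u) = dist (A i (s t)) (A i (s u))"
        using tu unfolding U_def by simp
      also have "\<dots> \<le> K * dist (s t) (s u)" using lip i lipschitz_onD by blast
      also have "dist (s t) (s u) = norm (y - x) * dist t u"
      proof -
        have "s t - s u = (t - u) *\<^sub>R (y - x)" unfolding s_def by (simp add: algebra_simps)
        then show ?thesis unfolding dist_norm by simp
      qed
      finally show "dist ((g \<circ> s) t) ((g \<circ> s) u) \<le> K * norm (y - x) * dist t u" by simp
    qed (use assms(3) in simp)
    have "continuous_on {0..1} (\<lambda>t. g (s t) - A i (s t))"
      using sS i by (intro continuous_intros continuous_on_compose2[OF assms(2) conts] continuous_on_compose2[OF contA conts])
         (auto)
    then show "closed (U i)" unfolding U_def
      by (rule continuous_closed_preimage_constant) simp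
  next
    show "{0..1} \<subseteq> (\<Union>i\<in>{..<N}. U i)"
      using sel sS unfolding U_def by fastforce
  qed (use assms(3) in auto)
  then have "dist ((g \<circ> s) 0) ((g \<circ> s) 1) \<le> K * norm (y - x) * dist 0 (1::real)"
    by (rule lipschitz_onD) auto
  then show "dist (g x) (g y) \<le> K * dist x y"
    unfolding s_def by (simp add: dist_norm norm_minus_commute)
qed fact

lemma bounded_selectionI:
  fixes g :: "'a::euclidean_space \<Rightarrow> 'a"
  assumes "continuous_on (cball 0 r) g" "g 0 = 0" "finite \<A>" "\<And>A. A \<in> \<A> \<Longrightarrow> affine_map A"
    "\<And>y. y \<in> cball 0 r \<Longrightarrow> \<exists>A\<in>\<A>. g y = A y"
  obtains N K where "K \<ge> 1" "bounded_selection N K r g"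
proof -
  define c where "c = (\<lambda>A :: 'a \<Rightarrow> 'a. (Blinfun (\<lambda>y. A y - A 0), A 0))"
  have c: "A y = blinfun_apply (fst (c A)) y + snd (c A)" if A: "A \<in> \<A>" for A y
  proof -
    obtain L d where L: "linear L" "\<And>y. A y = L y + d" using assms(4)[OF A] by (rule affine_mapE) blast
    have "(\<lambda>y. A y - A 0) = L" using L linear_0[OF L(1)] by auto
    then have "bounded_linear (\<lambda>y. A y - A 0)" using L(1) by (simp add: linear_conv_bounded_linear)
    then show ?thesis unfolding c_def by (simp add: bounded_linear_Blinfun_apply)
  qed
  obtain f where f: "bij_betw f {0..<card \<A>} \<A>" using ex_bij_betw_nat_finite[OF assms(3)] by blast
  define A where "A i = c (f i)" for i
  define N where "N = card \<A>"
  \<comment> \<open>The norm of a pair dominates that of its linear part, so one constant bounds the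
    coefficients and the Lipschitz constants. The summand 1 ensures
    \<open>K \<ge> 1\<close>.\<close>
  define K where "K = 1 + (\<Sum>i<N. norm (A i))"
  have K: "norm (A i) \<le> K" if "i < N" for i
    using member_le_sum[of i "{..<N}" "\<lambda>i. norm (A i)"] that unfolding K_def by auto
  have K1: "K \<ge> 1" unfolding K_def by (simp add: sum_nonneg)
  have sel: "\<exists>i<N. g x = blinfun_apply (fst (A i)) x + snd (A i)" if x: "x \<in> cball 0 r" for x
  proof -
    obtain B where B: "B \<in> \<A>" "g x = B x" using assms(5)[OF x] by blast
    then obtain i where "i < N" "f i = B" using f unfolding bij_betw_def N_def by (metis atLeastLessThan_iff imageE)
    then show ?thesis using c[of B x] B unfolding A_def by auto
  qed
  have "K-lipschitz_on (cball 0 r) g"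
  proof (rule lipschitz_on_selection[where N=N and A="\<lambda>i x. blinfun_apply (fst (A i)) x + snd (A i)"])
    fix i assume i: "i < N"
    show "K-lipschitz_on UNIV (\<lambda>x. blinfun_apply (fst (A i)) x + snd (A i))"
    proof (rule lipschitz_onI)
      fix x y
      have "dist (blinfun_apply (fst (A i)) x + snd (A i)) (blinfun_apply (fst (A i)) y + snd (A i))
         = norm (blinfun_apply (fst (A i)) (x - y))" by (simp add: dist_norm blinfun.diff_right)
      also have "\<dots> \<le> norm (fst (A i)) * norm (x - y)" by (rule norm_blinfun)
      also have "\<dots> \<le> K * norm (x - y)"
        using norm_fst_le[of "fst (A i)" "snd (A i)"] K[OF i] by (intro mult_right_mono) auto
      finally show "dist (blinfun_apply (fst (A i)) x + snd (A i)) (blinfun_apply (fst (A i)) y + snd (A i)) \<le> K * dist x y"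
        by (simp add: dist_norm)
    qed (use K1 in simp)
  qed (use assms sel K1 in auto)
  then have "bounded_selection N K r g"
    unfolding bounded_selection_def using K sel assms(2) by blast
  then show thesis using that K1 by blast
qed

lemma has_chart_imp_bounded_chart:
  assumes "has_chart F p M"
  obtains N K r where "K \<ge> 1" "r > 0" "bounded_chart N K r (\<lambda>y. F (p + y) - F p) M"
proof -
  obtain U V h g where c: "open U" "p \<in> U" "open V" "0 \<in> V" "homeomorphism U V h g" "pl_on U h" "pl_on V g" "h p = 0"
     "\<And>x. x \<in> V \<Longrightarrow> F (g x) = F p + M x"
    using assms unfolding has_chart_def pl_homeomorphism_def by blast
  have g0: "g 0 = p" using c(2,5,8) by (metis homeomorphism_apply1)
  obtain e1 \<A>1 where 1: "e1 > 0" "cball 0 e1 \<subseteq> V" "finite \<A>1" "\<And>A. A \<in> \<A>1 \<Longrightarrow> affine_map A"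
    "\<And>y. y \<in> cball 0 e1 \<Longrightarrow> \<exists>A\<in>\<A>1. g y = A y"
    using pl_on_local_selection[OF c(7,3,4)] by metis
  obtain e2 \<A>2 where 2: "e2 > 0" "cball p e2 \<subseteq> U" "finite \<A>2" "\<And>A. A \<in> \<A>2 \<Longrightarrow> affine_map A"
    "\<And>y. y \<in> cball p e2 \<Longrightarrow> \<exists>A\<in>\<A>2. h y = A y"
    using pl_on_local_selection[OF c(6,1,2)] by metis
  have contg: "continuous_on V g" and conth: "continuous_on U h" using c(5) unfolding homeomorphism_def by auto
  define e where "e = min e1 e2"
  have e: "e > 0" "cball 0 e \<subseteq> V" "cball p e \<subseteq> U" using 1 2 unfolding e_def by auto
  have pU: "p + y \<in> cball p e" if "y \<in> cball 0 e" for y using that by (simp add: dist_norm)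
  obtain N1 K1 where b1: "K1 \<ge> 1" "bounded_selection N1 K1 e (\<lambda>x. g x - p)"
  proof (rule bounded_selectionI)
    show "continuous_on (cball 0 e) (\<lambda>x. g x - p)"
      using contg e by (intro continuous_intros) (auto intro: continuous_on_subset)
    show "\<exists>A\<in>(\<lambda>A x. A x - p) ` \<A>1. g y - p = A y" if "y \<in> cball 0 e" for y
      using 1(5)[of y] that unfolding e_def by auto
    show "affine_map A" if "A \<in> (\<lambda>A x. A x - p) ` \<A>1" for A
      using that 1(4) affine_map_diff affine_map_const by fastforce
  qed (use 1 g0 in auto)
  obtain N2 K2 where b2: "K2 \<ge> 1" "bounded_selection N2 K2 e (\<lambda>x. h (p + x))"
  proof (rule bounded_selectionI)
    show "continuous_on (cball 0 e) (\<lambda>x. h (p + x))"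
      using e pU by (intro continuous_on_compose2[OF conth] continuous_intros) auto
    show "\<exists>A\<in>(\<lambda>A x. A (p + x)) ` \<A>2. h (p + y) = A y" if "y \<in> cball 0 e" for y
      using 2(5)[of "p + y"] pU[OF that] unfolding e_def by auto
    show "affine_map A" if A: "A \<in> (\<lambda>A x. A (p + x)) ` \<A>2" for A
    proof -
      obtain B where B: "B \<in> \<A>2" "A = (\<lambda>x. B (p + x))" using A by blast
      have "affine_map (\<lambda>x. p + x)" using affine_map_add[OF affine_map_const affine_map_linear[OF linear_id]] by simp
      then show ?thesis using affine_map_compose[OF 2(4)[OF B(1)]] B(2) by blast
    qed
  qed (use 2 c in auto)
  define N where "N = max N1 N2"
  define K where "K = max K1 K2"
  have sub: "cball 0 (e / K) \<subseteq> cball (0::'a) e"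
    using b1 e by (intro subset_cball) (auto simp: K_def divide_le_eq mult_le_cancel_left1)
  have "bounded_chart N K e (\<lambda>y. F (p + y) - F p) M"
    unfolding bounded_chart_def
  proof (intro exI conjI ballI)
    show "bounded_selection N K e (\<lambda>x. g x - p)"
      using b1 by (intro bounded_selection_mono[OF b1(2)]) (auto simp: N_def K_def)
    show "bounded_selection N K e (\<lambda>x. h (p + x))"
      using b2 by (intro bounded_selection_mono[OF b2(2)]) (auto simp: N_def K_def)
    fix x :: 'a assume "x \<in> cball 0 (e / K)"
    then have x: "x \<in> cball 0 e" using sub by blast
    show "h (p + (g x - p)) = x" using x e homeomorphism_apply2[OF c(5), of x] by auto
    show "g (h (p + x)) - p = x" using e pU[OF x] homeomorphism_apply1[OF c(5), of "p + x"] by auto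
  next
    fix x :: 'a assume "x \<in> cball 0 e"
    then show "F (p + (g x - p)) - F p = M x" using c(9)[of x] e by auto
  qed
  moreover have "K \<ge> 1" using b1(1) unfolding K_def by simp
  ultimately show thesis using that e(1) by blast
qed

lemma bounded_chart_imp_has_chart:
  assumes K: "K \<ge> 1" and r: "r > 0" and bc: "bounded_chart N K r (\<lambda>y. F (p + y) - F p) M"
  shows "has_chart F p M"
proof -
  obtain g h where gh: "bounded_selection N K r g" "bounded_selection N K r h"
     "\<And>x. x \<in> cball 0 (r / K) \<Longrightarrow> h (g x) = x \<and> g (h x) = x" "\<And>x. x \<in> cball 0 r \<Longrightarrow> F (p + g x) - F p = M x"
    using bc unfolding bounded_chart_def by blast
  define s where "s = r / K"
  have s: "s > 0" "s \<le> r" using K r unfolding s_def by (auto simp: divide_le_eq mult_le_cancel_left1)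
  have sub: "ball 0 s \<subseteq> cball (0::'a) r" "ball 0 s \<subseteq> cball (0::'a) (r / K)" using s unfolding s_def by auto
  have cont: "continuous_on (ball 0 s) f" if "bounded_selection N K r f" for f :: "'a \<Rightarrow> 'a"
  proof -
    have "K-lipschitz_on (cball 0 r) f" using that unfolding bounded_selection_def by blast
    then show ?thesis using lipschitz_on_continuous_on continuous_on_subset[OF _ sub(1)] by blast
  qed
  have inv: "h (g x) = x" "g (h x) = x" if "norm x < s" for x
    using gh(3)[of x] that unfolding s_def by auto
  \<comment> \<open>The two maps are mutually inverse on the ball of radius \<open>s\<close> but
    need not preserve it. Restricting each to the points whose image stays in the ball makes them
    bijections between \<open>V\<close> and \<open>U0\<close>.\<close>
  define V where "V = ball 0 s \<inter> g -` ball 0 s"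
  define U0 where "U0 = ball 0 s \<inter> h -` ball 0 s"
  define U where "U = (\<lambda>x. x - p) -` U0"
  have "open V" "open U0" unfolding V_def U0_def
    by (intro continuous_open_preimage cont gh open_ball)+
  then have "open U" unfolding U_def by (intro open_vimage continuous_intros)
  have z: "g 0 = 0" "h 0 = 0" using gh unfolding bounded_selection_def by auto
  have pl: "pl_on (D::'a set) (\<lambda>x. b + f (x - q))"
    if f: "bounded_selection N K r f" and D: "open D" "\<And>x. x \<in> D \<Longrightarrow> x - q \<in> ball 0 s" for D f b q
  proof -
    obtain A :: "nat \<Rightarrow> ('a \<Rightarrow>\<^sub>L 'a) \<times> 'a" where A: 
      "\<And>x. x \<in> cball 0 r \<Longrightarrow> \<exists>i<N. f x = blinfun_apply (fst (A i)) x + snd (A i)"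
      using f unfolding bounded_selection_def by blast
    show ?thesis
    proof (rule pl_on_selection[OF D(1)])
      show "continuous_on D (\<lambda>x. b + f (x - q))"
        using D by (intro continuous_intros continuous_on_compose2[OF cont[OF f]]) auto
      show "finite ((\<lambda>i x. b + (blinfun_apply (fst (A i)) (x - q) + snd (A i))) ` {..<N})" by simp
      show "affine_map B" if B: "B \<in> (\<lambda>i x. b + (blinfun_apply (fst (A i)) (x - q) + snd (A i))) ` {..<N}" for B
      proof -
        obtain i where "B = (\<lambda>x. b + (blinfun_apply (fst (A i)) (x - q) + snd (A i)))" using B by blast
        then have "B = (\<lambda>x. blinfun_apply (fst (A i)) x + (b - blinfun_apply (fst (A i)) q + snd (A i)))"
          by (simp add: blinfun.diff_right algebra_simps)
        then show ?thesis using affine_map_linear_add[OF bounded_linear.linear[OF blinfun.bounded_linear_right]] by blast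
      qed
      show "\<exists>B\<in>(\<lambda>i x. b + (blinfun_apply (fst (A i)) (x - q) + snd (A i))) ` {..<N}. b + f (x - q) = B x"
        if "x \<in> D" for x
      proof -
        have "x - q \<in> cball 0 r" using D(2)[OF that] sub(1) by blast
        then show ?thesis using A[of "x - q"] by auto
      qed
    qed
  qed
  have "homeomorphism U V (\<lambda>x. h (x - p)) (\<lambda>x. p + g x)"
  proof (rule homeomorphismI)
    show "continuous_on U (\<lambda>x. h (x - p))"
      by (intro continuous_on_compose2[OF cont[OF gh(2)]] continuous_intros) (auto simp: U_def U0_def)
    show "continuous_on V (\<lambda>x. p + g x)"
      by (intro continuous_on_compose2[OF cont[OF gh(1)]] continuous_intros) (auto simp: V_def)
  qed (auto simp: U_def V_def U0_def inv)
  moreover have "pl_on U (\<lambda>x. h (x - p))"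
    using pl[OF gh(2) \<open>open U\<close>, of p 0] unfolding U_def U0_def by auto
  moreover have "pl_on V (\<lambda>x. p + g x)"
    using pl[OF gh(1) \<open>open V\<close>, of 0 p] unfolding V_def by auto
  moreover have "p \<in> U" "0 \<in> V" using s z unfolding U_def V_def U0_def by auto
  moreover have "F (p + g x) = F p + M x" if "x \<in> V" for x
  proof -
    have "x \<in> cball 0 r" using that sub(1) unfolding V_def by blast
    then show ?thesis using gh(4)[of x] by linarith
  qed
  ultimately show ?thesis
    unfolding has_chart_def pl_homeomorphism_def using \<open>open U\<close> \<open>open V\<close> z
    by (intro exI[of _ U] exI[of _ V] exI[of _ "\<lambda>x. h (x - p)"] exI[of _ "\<lambda>x. p + g x"]) auto
qed

text \<open>Two functions with equal increments near their base points share their charts. The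
  bounded form of a chart supplies the Lipschitz constant that keeps the image of \<open>g\<close>
  inside the region of agreement.\<close>

lemma has_chart_cong_germ:
  assumes chart: "has_chart F p M" and e: "e > 0"
    and germ: "\<And>y. norm y < e \<Longrightarrow> F (p + y) - F p = G (q + y) - G q"
  shows "has_chart G q M"
proof -
  obtain N K r where b: "K \<ge> 1" "r > 0" "bounded_chart N K r (\<lambda>y. F (p + y) - F p) M"
    using has_chart_imp_bounded_chart[OF chart] by blast
  \<comment> \<open>Chosen so that \<open>K * r' < e\<close>: then \<open>g\<close> maps the ball of
    radius \<open>r'\<close> into the ball of radius \<open>e\<close>.\<close>
  define r' where "r' = min r (e / (2 * K))"
  have r': "0 < r'" "r' \<le> r" "K * r' < e" 
  proof -
    have "K * r' \<le> K * (e / (2 * K))" using b(1) unfolding r'_def by (intro mult_left_mono) auto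
    also have "\<dots> < e" using b(1) e by simp
    finally show "K * r' < e" .
  qed (use b e in \<open>auto simp: r'_def\<close>)
  have "bounded_chart N K r' (\<lambda>y. F (p + y) - F p) M"
    using bounded_chart_mono[OF b(3), of N K r'] b r' by auto
  then obtain g h where gh: "bounded_selection N K r' g" "bounded_selection N K r' h"
     "\<forall>x\<in>cball 0 (r' / K). h (g x) = x \<and> g (h x) = x" "\<forall>x\<in>cball 0 r'. F (p + g x) - F p = M x"
    unfolding bounded_chart_def by blast
  have "norm (g x) < e" if "x \<in> cball 0 r'" for x
  proof -
    have "dist (g x) (g 0) \<le> K * dist x 0"
      using gh(1) that r'(1) unfolding bounded_selection_def by (intro lipschitz_onD[of K "cball 0 r'" g]) auto
    also have "\<dots> \<le> K * r'" using that b(1) by (intro mult_left_mono) (auto simp: dist_commute)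
    finally show ?thesis using gh(1) r'(3) unfolding bounded_selection_def by simp
  qed
  then have "\<forall>x\<in>cball 0 r'. G (q + g x) - G q = M x" using germ gh(4) by fastforce
  then have "bounded_chart N K r' (\<lambda>y. G (q + y) - G q) M"
    unfolding bounded_chart_def using gh by blast
  then show ?thesis using bounded_chart_imp_has_chart b(1) r'(1) by blast
qed

text \<open>Monotonicity in the constants lets natural numbers replace them, so the existence of a
  chart becomes a countable union of conditions that are closed in the parameters.\<close>

lemma has_chart_iff_bounded_chart:
  "has_chart F p M \<longleftrightarrow> (\<exists>k N j. bounded_chart N (real (Suc k)) (inverse (real (Suc j))) (\<lambda>y. F (p + y) - F p) M)"
proof
  assume "has_chart F p M"
  then obtain N K r where b: "K \<ge> 1" "r > 0" "bounded_chart N K r (\<lambda>y. F (p + y) - F p) M"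
    using has_chart_imp_bounded_chart by blast
  obtain j where j: "inverse (real (Suc j)) < r" using reals_Archimedean b(2) by blast
  obtain k :: nat where "K \<le> real k" using real_arch_simple by blast
  then have "bounded_chart N (real (Suc k)) (inverse (real (Suc j))) (\<lambda>y. F (p + y) - F p) M"
    using b j by (intro bounded_chart_mono[OF b(3)]) auto
  then show "\<exists>k N j. bounded_chart N (real (Suc k)) (inverse (real (Suc j))) (\<lambda>y. F (p + y) - F p) M" by blast
next
  assume "\<exists>k N j. bounded_chart N (real (Suc k)) (inverse (real (Suc j))) (\<lambda>y. F (p + y) - F p) M"
  then obtain k N j where "bounded_chart N (real (Suc k)) (inverse (real (Suc j))) (\<lambda>y. F (p + y) - F p) M" by blast
  then show "has_chart F p M" by (intro bounded_chart_imp_has_chart[of "real (Suc k)" "inverse (real (Suc j))"]) auto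
qed

section \<open>Compactness of charts of bounded complexity\<close>

lemma bounded_family_convergent_subseq:
  fixes a :: "nat \<Rightarrow> nat \<Rightarrow> 'b::{heine_borel,real_normed_vector}"
  assumes "\<And>i k. i < N \<Longrightarrow> norm (a k i) \<le> K"
  shows "\<exists>\<rho> l. strict_mono (\<rho> :: nat \<Rightarrow> nat) \<and> (\<forall>i<N. (\<lambda>k. a (\<rho> k) i) \<longlonglongrightarrow> l i)"
  using assms
proof (induction N)
  case 0
  show ?case by (intro exI[of _ id]) (auto simp: strict_mono_def)
next
  case (Suc N)
  then obtain \<rho> :: "nat \<Rightarrow> nat" and l where \<rho>: "strict_mono \<rho>" "\<And>i. i < N \<Longrightarrow> (\<lambda>k. a (\<rho> k) i) \<longlonglongrightarrow> l i"
    by (metis less_Suc_eq)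
  have "bounded (range (\<lambda>k. a (\<rho> k) N))"
    using Suc.prems by (auto simp: bounded_iff)
  then obtain x \<sigma> where \<sigma>: "strict_mono (\<sigma> :: nat \<Rightarrow> nat)" "((\<lambda>k. a (\<rho> k) N) \<circ> \<sigma>) \<longlonglongrightarrow> x"
    using bounded_imp_convergent_subsequence by blast
  have "(\<lambda>k. a ((\<rho> \<circ> \<sigma>) k) i) \<longlonglongrightarrow> (l(N := x)) i" if "i < Suc N" for i
  proof (cases "i = N")
    case True
    then show ?thesis using \<sigma>(2) by (simp add: comp_def)
  next
    case False
    then show ?thesis using LIMSEQ_subseq_LIMSEQ[OF \<rho>(2)[of i] \<sigma>(1)] that by (simp add: comp_def)
  qed
  then show ?case using strict_mono_o[OF \<rho>(1) \<sigma>(1)] by blast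
qed

text \<open>Boundedness makes the coefficients converge along a subsequence. The common Lipschitz
  constant and the fixed point 0 give equicontinuity and uniform boundedness, so the maps converge
  along a further one.\<close>

lemma bounded_selection_convergent_subseq:
  fixes g :: "nat \<Rightarrow> 'a::euclidean_space \<Rightarrow> 'a"
  assumes K: "0 < K" and r: "0 < r" and sel: "\<And>k. bounded_selection N K r (g k)"
  obtains \<rho> g' where "strict_mono (\<rho> :: nat \<Rightarrow> nat)" "bounded_selection N K r g'"
    "\<And>x. x \<in> cball 0 r \<Longrightarrow> (\<lambda>k. g (\<rho> k) x) \<longlonglongrightarrow> g' x"
proof -
  have lip: "K-lipschitz_on (cball 0 r) (g k)" and g0: "g k 0 = 0" for k
    using sel unfolding bounded_selection_def by auto
  obtain A :: "nat \<Rightarrow> nat \<Rightarrow> ('a \<Rightarrow>\<^sub>L 'a) \<times> 'a" where A: "\<And>k i. i < N \<Longrightarrow> norm (A k i) \<le> K"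
     "\<And>k x. x \<in> cball 0 r \<Longrightarrow> \<exists>i<N. g k x = blinfun_apply (fst (A k i)) x + snd (A k i)"
    using sel unfolding bounded_selection_def by metis
  obtain \<rho> :: "nat \<Rightarrow> nat" and l where \<rho>: "strict_mono \<rho>" "\<And>i. i < N \<Longrightarrow> (\<lambda>k. A (\<rho> k) i) \<longlonglongrightarrow> l i"
    using bounded_family_convergent_subseq[of N A K] A(1) by metis
  obtain g' \<sigma> where g': "strict_mono (\<sigma> :: nat \<Rightarrow> nat)"
     "\<And>e. 0 < e \<Longrightarrow> \<exists>n0. \<forall>n x. n \<ge> n0 \<and> x \<in> cball 0 r \<longrightarrow> norm (g (\<rho> (\<sigma> n)) x - g' x) < e"
  proof (rule Arzela_Ascoli[of "cball (0::'a) r" "\<lambda>k. g (\<rho> k)" "K * r"])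
    show "norm (g (\<rho> n) x) \<le> K * r" if "x \<in> cball 0 r" for n x
    proof -
      have "dist (g (\<rho> n) x) (g (\<rho> n) 0) \<le> K * dist x 0"
        using that r by (intro lipschitz_onD[OF lip]) auto
      also have "\<dots> \<le> K * r" using that K by (intro mult_left_mono) (auto simp: dist_commute)
      finally show ?thesis using g0 by simp
    qed
    fix x :: 'a and e :: real assume xe: "x \<in> cball 0 r" "0 < e"
    show "\<exists>d>0. \<forall>n y. y \<in> cball 0 r \<and> norm (x - y) < d \<longrightarrow> norm (g (\<rho> n) x - g (\<rho> n) y) < e"
    proof (intro exI[of _ "e / K"] conjI allI impI)
      fix n y assume y: "y \<in> cball 0 r \<and> norm (x - y) < e / K"
      then have "dist (g (\<rho> n) x) (g (\<rho> n) y) \<le> K * dist x y" using xe by (intro lipschitz_onD[OF lip]) auto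
      also have "\<dots> < e" using y K by (simp add: dist_norm field_simps)
      finally show "norm (g (\<rho> n) x - g (\<rho> n) y) < e" by (simp add: dist_norm)
    qed (use xe K in auto)
  qed auto
  have lim: "(\<lambda>k. g ((\<rho> \<circ> \<sigma>) k) x) \<longlonglongrightarrow> g' x" if "x \<in> cball 0 r" for x
  proof (rule LIMSEQ_I)
    fix e :: real assume "0 < e"
    then show "\<exists>no. \<forall>n\<ge>no. norm (g ((\<rho> \<circ> \<sigma>) n) x - g' x) < e"
      using g'(2)[of e] that by fastforce
  qed
  have liml: "(\<lambda>k. A ((\<rho> \<circ> \<sigma>) k) i) \<longlonglongrightarrow> l i" if "i < N" for i
    using LIMSEQ_subseq_LIMSEQ[OF \<rho>(2)[OF that] g'(1)] by (simp add: comp_def)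
  have "bounded_selection N K r g'"
    unfolding bounded_selection_def
  proof (intro conjI exI[of _ l] allI impI ballI)
    show "K-lipschitz_on (cball 0 r) g'"
    proof (rule lipschitz_onI)
      fix x y :: 'a assume xy: "x \<in> cball 0 r" "y \<in> cball 0 r"
      have "(\<lambda>k. dist (g ((\<rho> \<circ> \<sigma>) k) x) (g ((\<rho> \<circ> \<sigma>) k) y)) \<longlonglongrightarrow> dist (g' x) (g' y)"
        by (intro tendsto_intros lim xy)
      then show "dist (g' x) (g' y) \<le> K * dist x y"
        by (rule LIMSEQ_le_const2) (auto intro!: exI[of _ 0] lipschitz_onD[OF lip] xy)
    qed (use K in simp)
    show "g' 0 = 0" using lim[of 0] r g0 by (simp add: LIMSEQ_const_iff)
    show "norm (l i) \<le> K" if "i < N" for i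
      by (rule LIMSEQ_le_const2[OF tendsto_norm[OF liml[OF that]]]) (auto intro!: exI[of _ 0] A(1) that)
    fix x :: 'a assume x: "x \<in> cball 0 r"
    \<comment> \<open>The index of the map selected at \<open>x\<close> may change with
      \<open>k\<close>. The vanishing product expresses that some index matches as a single
      continuous equation, which survives the limit.\<close>
    let ?d = "\<lambda>k. \<Prod>i<N. norm (g ((\<rho> \<circ> \<sigma>) k) x - (blinfun_apply (fst (A ((\<rho> \<circ> \<sigma>) k) i)) x + snd (A ((\<rho> \<circ> \<sigma>) k) i)))"
    have "?d \<longlonglongrightarrow> (\<Prod>i<N. norm (g' x - (blinfun_apply (fst (l i)) x + snd (l i))))"
      by (intro tendsto_intros lim x liml) auto
    moreover have "?d k = 0" for k
      using A(2)[OF x, of "(\<rho> \<circ> \<sigma>) k"] by (intro prod_zero) auto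
    ultimately have "(\<lambda>k. 0) \<longlonglongrightarrow> (\<Prod>i<N. norm (g' x - (blinfun_apply (fst (l i)) x + snd (l i))))"
      by (simp only:)
    then have "(\<Prod>i<N. norm (g' x - (blinfun_apply (fst (l i)) x + snd (l i)))) = 0"
      unfolding LIMSEQ_const_iff by (rule sym)
    then show "\<exists>i<N. g' x = blinfun_apply (fst (l i)) x + snd (l i)"
      by (auto simp: prod_zero_iff)
  qed
  then show thesis using that[OF strict_mono_o[OF \<rho>(1) g'(1)]] lim by blast
qed

text \<open>The functions are evaluated at the moving points \<open>g k x\<close>, so pointwise
  convergence would not be enough: \<open>lim\<close> asks for continuous convergence, and along
  subsequences because compactness provides only those.\<close>

lemma bounded_chart_limit:
  fixes \<Gamma> :: "nat \<Rightarrow> 'a::euclidean_space \<Rightarrow> real"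
  assumes K: "1 \<le> K" and r: "0 < r" and ch: "\<And>k. bounded_chart N K r (\<Gamma> k) M"
    and lim: "\<And>\<rho> ys y. strict_mono (\<rho> :: nat \<Rightarrow> nat) \<Longrightarrow> ys \<longlonglongrightarrow> y \<Longrightarrow> (\<lambda>k. \<Gamma> (\<rho> k) (ys k)) \<longlonglongrightarrow> G y"
  shows "bounded_chart N K r G M"
proof -
  obtain g h where gh: "\<And>k. bounded_selection N K r (g k)" "\<And>k. bounded_selection N K r (h k)"
     "\<And>k x. x \<in> cball 0 (r / K) \<Longrightarrow> h k (g k x) = x \<and> g k (h k x) = x" "\<And>k x. x \<in> cball 0 r \<Longrightarrow> \<Gamma> k (g k x) = M x"
    using ch unfolding bounded_chart_def by metis
  obtain \<rho> g' where \<rho>: "strict_mono (\<rho> :: nat \<Rightarrow> nat)" "bounded_selection N K r g'"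
    "\<And>x. x \<in> cball 0 r \<Longrightarrow> (\<lambda>k. g (\<rho> k) x) \<longlonglongrightarrow> g' x"
    using bounded_selection_convergent_subseq[of K r N g] gh(1) K r by auto
  obtain \<sigma> h' where \<sigma>: "strict_mono (\<sigma> :: nat \<Rightarrow> nat)" "bounded_selection N K r h'"
    "\<And>x. x \<in> cball 0 r \<Longrightarrow> (\<lambda>k. h (\<rho> (\<sigma> k)) x) \<longlonglongrightarrow> h' x"
    using bounded_selection_convergent_subseq[of K r N "\<lambda>k. h (\<rho> k)"] gh(2) K r by auto
  define \<tau> where "\<tau> = \<rho> \<circ> \<sigma>"
  have \<tau>: "strict_mono \<tau>" unfolding \<tau>_def by (rule strict_mono_o[OF \<rho>(1) \<sigma>(1)])
  have limg: "(\<lambda>k. g (\<tau> k) x) \<longlonglongrightarrow> g' x" if "x \<in> cball 0 r" for x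
    using LIMSEQ_subseq_LIMSEQ[OF \<rho>(3)[OF that] \<sigma>(1)] by (simp add: \<tau>_def comp_def)
  have limh: "(\<lambda>k. h (\<tau> k) x) \<longlonglongrightarrow> h' x" if "x \<in> cball 0 r" for x
    using \<sigma>(3)[OF that] by (simp add: \<tau>_def)
  have bound: "f x \<in> cball 0 r" if "bounded_selection N K r f" "x \<in> cball 0 (r / K)" for f :: "'a \<Rightarrow> 'a" and x
  proof -
    have "r / K \<le> r" using K r by (simp add: divide_le_eq mult_le_cancel_left1)
    then have "dist (f x) (f 0) \<le> K * dist x 0"
      using that r unfolding bounded_selection_def by (intro lipschitz_onD[of K "cball 0 r" f]) auto
    also have "\<dots> \<le> K * (r / K)" using that K by (intro mult_left_mono) (auto simp: dist_commute)
    finally show ?thesis using that(1) K unfolding bounded_selection_def by simp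
  qed
  have compose: "b' (a' x) = x" if ab: "\<And>k. bounded_selection N K r (a k)" "\<And>k. bounded_selection N K r (b k)"
      "bounded_selection N K r a'"
      and x: "x \<in> cball 0 (r / K)" and id: "\<And>k. b k (a k x) = x" 
      and la: "\<And>x. x \<in> cball 0 r \<Longrightarrow> (\<lambda>k. a k x) \<longlonglongrightarrow> a' x"
      and lb: "\<And>x. x \<in> cball 0 r \<Longrightarrow> (\<lambda>k. b k x) \<longlonglongrightarrow> b' x"
    for a b :: "nat \<Rightarrow> 'a \<Rightarrow> 'a" and a' b' x
  proof -
    have "r / K \<le> r" using K r by (simp add: divide_le_eq mult_le_cancel_left1)
    then have xr: "x \<in> cball 0 r" using x by auto
    \<comment> \<open>Outer map and argument both vary with \<open>k\<close>; the common Lipschitz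
      constant allows the argument to be replaced by its limit first.\<close>
    have "(\<lambda>k. b k (a k x) - b k (a' x)) \<longlonglongrightarrow> 0"
    proof (rule Lim_null_comparison)
      show "\<forall>\<^sub>F k in sequentially. norm (b k (a k x) - b k (a' x)) \<le> K * dist (a k x) (a' x)"
      proof (intro always_eventually allI)
        fix k
        have "dist (b k (a k x)) (b k (a' x)) \<le> K * dist (a k x) (a' x)"
          using ab(2) bound[OF ab(1) x] bound[OF ab(3) x] unfolding bounded_selection_def
          by (intro lipschitz_onD[of K "cball 0 r"]) auto
        then show "norm (b k (a k x) - b k (a' x)) \<le> K * dist (a k x) (a' x)" by (simp add: dist_norm)
      qed
      have "(\<lambda>k. K * dist (a k x) (a' x)) \<longlonglongrightarrow> K * dist (a' x) (a' x)"
        by (intro tendsto_intros la xr)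
      then show "(\<lambda>k. K * dist (a k x) (a' x)) \<longlonglongrightarrow> 0" by simp
    qed
    then have "(\<lambda>k. x - b k (a' x)) \<longlonglongrightarrow> 0" using id by simp
    moreover have "(\<lambda>k. x - b k (a' x)) \<longlonglongrightarrow> x - b' (a' x)"
      by (intro tendsto_intros lb bound[OF ab(3) x])
    ultimately show ?thesis using LIMSEQ_unique by fastforce
  qed
  show ?thesis
    unfolding bounded_chart_def
  proof (intro exI conjI ballI)
    show "bounded_selection N K r g'" "bounded_selection N K r h'" by fact+
    fix x :: 'a assume x: "x \<in> cball 0 (r / K)"
    show "h' (g' x) = x"
      by (rule compose[of "\<lambda>k. g (\<tau> k)" "\<lambda>k. h (\<tau> k)"]) (use gh x \<rho>(2) limg limh in auto)
    show "g' (h' x) = x"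
      by (rule compose[of "\<lambda>k. h (\<tau> k)" "\<lambda>k. g (\<tau> k)"]) (use gh x \<sigma>(2) limg limh in auto)
  next
    fix x :: 'a assume x: "x \<in> cball 0 r"
    have "(\<lambda>k. \<Gamma> (\<tau> k) (g (\<tau> k) x)) \<longlonglongrightarrow> G (g' x)" by (rule lim[OF \<tau> limg[OF x]])
    then show "G (g' x) = M x" using gh(4)[OF x] by (simp add: LIMSEQ_const_iff)
  qed
qed

section \<open>Explicit charts\<close>

text \<open>A global class closed under sums and compositions, so that explicit charts are
  recognised as piecewise linear from the shape of their formulas; \<open>pl_on_selection\<close>
  does the rest.\<close>

definition pwl :: "('a::euclidean_space \<Rightarrow> 'b::euclidean_space) \<Rightarrow> bool" where
  "pwl f \<longleftrightarrow> continuous_on UNIV f \<and>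
     (\<exists>\<A>. finite \<A> \<and> (\<forall>A\<in>\<A>. affine_map A) \<and> (\<forall>x. \<exists>A\<in>\<A>. f x = A x))"

lemma pwl_affine: "affine_map A \<Longrightarrow> pwl A"
  unfolding pwl_def using continuous_on_affine_map by (auto intro!: exI[of _ "{A}"])

lemma pwl_linear: "linear L \<Longrightarrow> pwl L"
  by (intro pwl_affine affine_map_linear)

lemma pwl_const: "pwl (\<lambda>x. c)"
  by (intro pwl_affine affine_map_const)

lemma pwl_compose:
  assumes "pwl f" "pwl g"
  shows "pwl (\<lambda>x. f (g x))"
proof -
  obtain \<A> where A: "finite \<A>" "\<forall>A\<in>\<A>. affine_map A" "\<And>x. \<exists>A\<in>\<A>. f x = A x"
    using assms(1) unfolding pwl_def by blast
  obtain \<B> where B: "finite \<B>" "\<forall>A\<in>\<B>. affine_map A" "\<And>x. \<exists>A\<in>\<B>. g x = A x"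
    using assms(2) unfolding pwl_def by blast
  have "continuous_on UNIV (\<lambda>x. f (g x))"
    using assms unfolding pwl_def by (auto intro: continuous_on_compose2)
  moreover have "\<exists>C\<in>(\<lambda>(A,B) x. A (B x)) ` (\<A> \<times> \<B>). f (g x) = C x" for x
  proof -
    obtain b where b: "b \<in> \<B>" "g x = b x" using B(3) by blast
    obtain a where a: "a \<in> \<A>" "f (b x) = a (b x)" using A(3) by blast
    show ?thesis using a b by force
  qed
  ultimately show ?thesis
    unfolding pwl_def
  proof (intro conjI exI[of _ "(\<lambda>(A,B) x. A (B x)) ` (\<A> \<times> \<B>)"])
    show "finite ((\<lambda>(A,B) x. A (B x)) ` (\<A> \<times> \<B>))" using A(1) B(1) by blast
    show "\<forall>C\<in>(\<lambda>(A,B) x. A (B x)) ` (\<A> \<times> \<B>). affine_map C"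
      using A(2) B(2) affine_map_compose by force
  qed blast+
qed

lemma pwl_add:
  assumes "pwl f" "pwl g"
  shows "pwl (\<lambda>x. f x + g x)"
proof -
  obtain \<A> where A: "finite \<A>" "\<forall>A\<in>\<A>. affine_map A" "\<And>x. \<exists>A\<in>\<A>. f x = A x"
    using assms(1) unfolding pwl_def by blast
  obtain \<B> where B: "finite \<B>" "\<forall>A\<in>\<B>. affine_map A" "\<And>x. \<exists>A\<in>\<B>. g x = A x"
    using assms(2) unfolding pwl_def by blast
  have "continuous_on UNIV (\<lambda>x. f x + g x)"
    using assms unfolding pwl_def by (auto intro: continuous_on_add)
  moreover have "\<exists>C\<in>(\<lambda>(A,B) x. A x + B x) ` (\<A> \<times> \<B>). f x + g x = C x" for x
  proof -
    obtain b where b: "b \<in> \<B>" "g x = b x" using B(3) by blast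
    obtain a where a: "a \<in> \<A>" "f x = a x" using A(3) by blast
    show ?thesis using a b by force
  qed
  ultimately show ?thesis
    unfolding pwl_def
  proof (intro conjI exI[of _ "(\<lambda>(A,B) x. A x + B x) ` (\<A> \<times> \<B>)"])
    show "finite ((\<lambda>(A,B) x. A x + B x) ` (\<A> \<times> \<B>))" using A(1) B(1) by blast
    show "\<forall>C\<in>(\<lambda>(A,B) x. A x + B x) ` (\<A> \<times> \<B>). affine_map C"
      using A(2) B(2) affine_map_add by force
  qed blast+
qed

lemma pwl_sum: "(\<And>i. i \<in> I \<Longrightarrow> pwl (f i)) \<Longrightarrow> pwl (\<lambda>x. \<Sum>i\<in>I. f i x)"
  by (induction I rule: infinite_finite_induct) (auto intro: pwl_add pwl_const)

lemma pwl_scaleR: 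
  fixes f :: "'a::euclidean_space \<Rightarrow> real"
  assumes "pwl f" shows "pwl (\<lambda>x. f x *\<^sub>R v)"
  by (rule pwl_compose[OF pwl_linear assms]) (simp add: bounded_linear.linear bounded_linear_scaleR_left)

lemma pwl_mult_left: 
  fixes f :: "'a::euclidean_space \<Rightarrow> real"
  assumes "pwl f" shows "pwl (\<lambda>x. c * f x)"
  by (rule pwl_compose[OF pwl_linear assms]) (simp add: bounded_linear.linear bounded_linear_mult_right)

lemma pwl_diff: 
  fixes f :: "'a::euclidean_space \<Rightarrow> real"
  assumes "pwl f" "pwl g" shows "pwl (\<lambda>x. f x - g x)"
  using pwl_add[OF assms(1) pwl_mult_left[OF assms(2), of "-1"]] by simp

lemma pwl_inner: "pwl (\<lambda>x. c \<bullet> x)"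
  by (rule pwl_linear) (simp add: bounded_linear.linear bounded_linear_inner_right)

lemma pwl_id: "pwl (\<lambda>x. x)"
  by (rule pwl_linear) (simp add: linear_id[unfolded id_def])

text \<open>The normal form of a germ along one coordinate: \<open>relu\<close> has slopes 0 and 1,
  and the linear contribution of the neurons that are on adds the same amount to both
  slopes.\<close>

definition two_slope :: "real \<Rightarrow> real \<Rightarrow> real \<Rightarrow> real" where
  "two_slope a b t = (if t \<ge> 0 then b * t else a * t)"

lemma two_slope_max_min: "two_slope a b t = b * max 0 t + a * min 0 t"
  unfolding two_slope_def by auto

lemma pwl_two_slope: "pwl (two_slope a b)"
  unfolding pwl_def
proof (intro conjI exI[of _ "{(\<lambda>t. b * t), (\<lambda>t. a * t)}"])
  show "continuous_on UNIV (two_slope a b)"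
    unfolding two_slope_max_min by (intro continuous_intros)
  show "\<forall>A\<in>{(\<lambda>t. b * t), (\<lambda>t. a * t)}. affine_map A"
    by (auto intro!: affine_map_linear simp: bounded_linear.linear bounded_linear_mult_right)
qed (auto simp: two_slope_def)

lemma pwl_two_slope_compose: "pwl f \<Longrightarrow> pwl (\<lambda>x. two_slope a b (f x))"
  by (rule pwl_compose[OF pwl_two_slope])

lemma has_chartI:
  fixes g h :: "'a::euclidean_space \<Rightarrow> 'a"
  assumes "pwl h" "pwl g" "\<And>x. h (g x) = x" "\<And>x. g (h x) = x" "h 0 = 0" "\<And>x. F (g x) = F 0 + M x"
  shows "has_chart F 0 M"
proof -
  have pl: "pl_on UNIV f" if "pwl f" for f :: "'a \<Rightarrow> 'a"
    using that unfolding pwl_def by (metis UNIV_I open_UNIV pl_on_selection)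
  have "homeomorphism UNIV UNIV h g"
    using assms by (intro homeomorphismI) (auto simp: pwl_def)
  then show ?thesis
    unfolding has_chart_def pl_homeomorphism_def using assms pl
    by (intro exI[of _ UNIV] exI[of _ h] exI[of _ g]) auto
qed

lemma norm_axis_real: "norm (axis i t :: real^'n) = \<bar>t\<bar>"
proof -
  have "axis i t = t *\<^sub>R (axis i 1 :: real^'n)" by (simp add: vec_eq_iff axis_def)
  then show ?thesis by simp
qed

text \<open>The regular model singles out one fixed coordinate. An orthogonal map that carries the
  axis vector of length \<open>norm c\<close> to \<open>c\<close>, divided by \<open>norm c\<close>,
  turns the functional of \<open>c\<close> into that coordinate.\<close>

lemma linear_coordinate_change:
  fixes c :: "real^'n"
  assumes "c \<noteq> 0"
  obtains R R' :: "real^'n \<Rightarrow> real^'n" where "linear R" "linear R'" "\<And>x. R (R' x) = x" "\<And>x. R' (R x) = x" "\<And>x. c \<bullet> R x = x $ i"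
proof -
  obtain f where f: "orthogonal_transformation f" "f (axis i (norm c)) = c"
    using orthogonal_transformation_exists[of "axis i (norm c)" c] by (auto simp: norm_axis_real)
  have lin: "linear f" "linear (inv f)" and bij: "bij f"
    using f(1) orthogonal_transformation_linear orthogonal_transformation_inv orthogonal_transformation_bij by blast+
  define R where "R x = (1 / norm c) *\<^sub>R f x" for x
  define R' where "R' x = norm c *\<^sub>R inv f x" for x
  show thesis
  proof
    show "linear R" "linear R'" unfolding R_def R'_def using lin by (auto intro: linear_compose_scale_right)
    show "R (R' x) = x" for x
      unfolding R_def R'_def using assms lin bij by (simp add: linear_scale surj_f_inv_f bij_is_surj)
    show "R' (R x) = x" for x
      unfolding R_def R'_def using assms lin bij by (simp add: linear_scale inv_f_f bij_is_inj)
    show "c \<bullet> R x = x $ i" for x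
    proof -
      have "c \<bullet> R x = (1 / norm c) * (f (axis i (norm c)) \<bullet> f x)" unfolding R_def f(2) by simp
      also have "f (axis i (norm c)) \<bullet> f x = axis i (norm c) \<bullet> x"
        using f(1) unfolding orthogonal_transformation_def by blast
      finally show ?thesis using assms by (simp add: inner_axis')
    qed
  qed
qed

text \<open>Along \<open>v\<close> the term \<open>\<rho>\<close> is constant and the other one is
  strictly monotone, since its slopes have the same sign. Sliding \<open>y\<close> along
  \<open>v\<close> until its \<open>c\<close>-coordinate equals \<open>G y\<close> is therefore an
  invertible piecewise linear shear, and it makes \<open>G\<close> linear.\<close>

lemma regular_chart:
  fixes G :: "real^'n \<Rightarrow> real"
  assumes \<rho>: "pwl \<rho>" "\<And>y t. \<rho> (y + t *\<^sub>R v) = \<rho> y" "\<rho> 0 = 0" and cv: "c \<bullet> v = 1" and ab: "a * b > 0"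
    and G: "\<And>y. G y = \<rho> y + two_slope a b (c \<bullet> y)"
  shows "has_chart G 0 (\<lambda>x. x $ i)"
proof -
  have "c \<noteq> 0" using cv by auto
  then obtain R R' where R: "linear R" "linear R'" "\<And>x. R (R' x) = x" "\<And>x. R' (R x) = x" "\<And>x. c \<bullet> R x = x $ i"
    using linear_coordinate_change by metis
  \<comment> \<open>Inverse of the two-slope function. Negative slopes exchange the two half-lines,
    hence the swapped arguments in the second case.\<close>
  define \<phi> where "\<phi> = (if a > 0 then two_slope (1/a) (1/b) else two_slope (1/b) (1/a))"
  have \<phi>: "\<phi> (two_slope a b t) = t" "two_slope a b (\<phi> t) = t" for t
    using ab unfolding \<phi>_def two_slope_def
    by (auto simp: zero_less_mult_iff zero_le_mult_iff mult_le_0_iff divide_le_0_iff zero_le_divide_iff)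
  have pwl\<phi>: "pwl \<phi>" unfolding \<phi>_def using pwl_two_slope by auto
  define H where "H y = y + (G y - c \<bullet> y) *\<^sub>R v" for y
  define J where "J z = z + (\<phi> (c \<bullet> z - \<rho> z) - c \<bullet> z) *\<^sub>R v" for z
  have cH: "c \<bullet> H y = G y" "\<rho> (H y) = \<rho> y" for y
    unfolding H_def using cv \<rho>(2) by (auto simp: inner_add_right)
  have cJ: "c \<bullet> J z = \<phi> (c \<bullet> z - \<rho> z)" "\<rho> (J z) = \<rho> z" for z
    unfolding J_def using cv \<rho>(2) by (auto simp: inner_add_right)
  have GJ: "G (J z) = c \<bullet> z" for z unfolding G cJ \<phi> by simp
  have HJ: "H (J z) = z" for z
    unfolding H_def GJ cJ(1) by (simp add: J_def algebra_simps)
  have JH: "J (H y) = y" for y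
    unfolding J_def cH by (simp add: H_def G \<phi> algebra_simps)
  have pwlG: "pwl G" unfolding G[abs_def] by (intro pwl_add \<rho> pwl_two_slope_compose pwl_inner)
  have "pwl H" unfolding H_def by (intro pwl_add pwl_id pwl_scaleR pwl_diff pwlG pwl_inner)
  moreover have "pwl J" unfolding J_def
    by (intro pwl_add pwl_id pwl_scaleR pwl_diff pwl_compose[OF pwl\<phi>] \<rho> pwl_inner)
  ultimately show ?thesis
  proof (intro has_chartI[where h="\<lambda>y. R' (H y)" and g="\<lambda>x. J (R x)"])
    show "R' (H 0) = 0" unfolding H_def using linear_0[OF R(2)] by (simp add: G \<rho>(3) two_slope_def)
    show "G (J (R x)) = G 0 + x $ i" for x
      by (simp add: GJ R(5)) (simp add: G \<rho>(3) two_slope_def)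
  qed (auto simp: R(3,4) HJ JH intro: pwl_compose pwl_linear R)
qed

text \<open>Duality makes the map taking \<open>y\<close> to its coordinates
  \<open>w i \<bullet> y\<close> surjective, hence injective by equality of dimensions; both sides
  of the equation have the same coordinates.\<close>

lemma dual_basis_expansion:
  fixes w \<nu> :: "'n \<Rightarrow> real^'n" and y :: "real^'n"
  assumes dual: "\<And>i j. w i \<bullet> \<nu> j = (if i = j then 1 else 0)"
  shows "(\<Sum>i\<in>UNIV. (w i \<bullet> y) *\<^sub>R \<nu> i) = y"
proof -
  define W where "W y = (\<chi> i. w i \<bullet> y)" for y
  have linW: "linear W" unfolding W_def
    by (intro linearI) (auto simp: vec_eq_iff inner_add_right)
  have Wsum: "W (\<Sum>i\<in>UNIV. t i *\<^sub>R \<nu> i) = (\<chi> i. t i)" for t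
    unfolding W_def by (simp add: vec_eq_iff inner_sum_right dual if_distrib cong: if_cong)
  have "surj W"
  proof (rule surjI)
    show "W (\<Sum>i\<in>UNIV. x $ i *\<^sub>R \<nu> i) = x" for x unfolding Wsum by (simp add: vec_eq_iff)
  qed
  then have injW: "inj W" using linear_surjective_imp_injective[OF linW] by blast
  show ?thesis
    by (rule injD[OF injW]) (simp only: Wsum, simp add: W_def)
qed

text \<open>In the dual coordinates \<open>G\<close> is a sum of one-variable peaks (indices in
  \<open>N\<close>) and valleys. Stretching each half-axis by the absolute value of its slope turns
  every summand into minus or plus an absolute value.\<close>

lemma critical_chart:
  fixes G :: "real^'n \<Rightarrow> real" and w \<nu> :: "'n \<Rightarrow> real^'n"
  assumes dual: "\<And>i j. w i \<bullet> \<nu> j = (if i = j then 1 else 0)"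
    and neg: "\<And>i. i \<in> N \<Longrightarrow> a i > 0 \<and> b i < 0" and pos: "\<And>i. i \<notin> N \<Longrightarrow> a i < 0 \<and> b i > 0"
    and G: "\<And>y. G y = (\<Sum>i\<in>UNIV. two_slope (a i) (b i) (w i \<bullet> y))"
  shows "has_chart G 0 (\<lambda>x. \<Sum>i\<in>UNIV. (if i \<in> N then - \<bar>x $ i\<bar> else \<bar>x $ i\<bar>))"
proof -
  have ab: "a i \<noteq> 0" "b i \<noteq> 0" for i using neg[of i] pos[of i] by (cases "i \<in> N"; auto)+
  define h where "h y = (\<Sum>i\<in>UNIV. two_slope \<bar>a i\<bar> \<bar>b i\<bar> (w i \<bullet> y) *\<^sub>R axis i (1::real))" for y
  define g where "g x = (\<Sum>i\<in>UNIV. two_slope (1 / \<bar>a i\<bar>) (1 / \<bar>b i\<bar>) (axis i 1 \<bullet> x) *\<^sub>R \<nu> i)" for x :: "real^'n"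
  have h: "h y $ i = two_slope \<bar>a i\<bar> \<bar>b i\<bar> (w i \<bullet> y)" for y i
    unfolding h_def by (simp add: axis_def if_distrib cong: if_cong)
  have wg: "w i \<bullet> g x = two_slope (1 / \<bar>a i\<bar>) (1 / \<bar>b i\<bar>) (x $ i)" for x i
    unfolding g_def by (simp add: inner_sum_right dual inner_axis' if_distrib cong: if_cong)
  have inv: "two_slope \<bar>a i\<bar> \<bar>b i\<bar> (two_slope (1 / \<bar>a i\<bar>) (1 / \<bar>b i\<bar>) t) = t"
    "two_slope (1 / \<bar>a i\<bar>) (1 / \<bar>b i\<bar>) (two_slope \<bar>a i\<bar> \<bar>b i\<bar> t) = t" for i t
    using ab[of i] by (auto simp: two_slope_def zero_le_mult_iff zero_le_divide_iff)
  show ?thesis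
  proof (rule has_chartI[where h=h and g=g])
    show "pwl h" unfolding h_def
      by (intro pwl_sum pwl_scaleR pwl_two_slope_compose pwl_inner)
    show "pwl g" unfolding g_def
      by (intro pwl_sum pwl_scaleR pwl_two_slope_compose pwl_inner)
    show "h (g x) = x" for x by (simp add: vec_eq_iff h wg inv)
    show "g (h y) = y" for y
      unfolding g_def by (simp add: inner_axis' h inv dual_basis_expansion[OF dual])
    show "h 0 = 0" by (simp add: vec_eq_iff h two_slope_def)
    have "two_slope (a i) (b i) (two_slope (1 / \<bar>a i\<bar>) (1 / \<bar>b i\<bar>) t) = (if i \<in> N then - \<bar>t\<bar> else \<bar>t\<bar>)" for i t
      using neg[of i] pos[of i] by (cases "i \<in> N") (auto simp: two_slope_def zero_le_divide_iff divide_le_0_iff)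
    then show "G (g x) = G 0 + (\<Sum>i\<in>UNIV. if i \<in> N then - \<bar>x $ i\<bar> else \<bar>x $ i\<bar>)" for x
      unfolding G wg by (simp add: two_slope_def[of _ _ 0] cong: if_cong)
  qed
qed

section \<open>Regular and critical points expressed by charts\<close>

lemma pl_regular_point_iff:
  "pl_regular_point F p \<longleftrightarrow> has_chart F p (\<lambda>x :: real^'n. x $ coord_enum (CARD('n) - 1))"
  unfolding pl_regular_point_def has_chart_def ..

definition morse_model :: "nat \<Rightarrow> real^'n::finite \<Rightarrow> real" where
  "morse_model k x = - (\<Sum>i<k. \<bar>x $ coord_enum i\<bar>) + (\<Sum>i\<in>{k..<CARD('n)}. \<bar>x $ coord_enum i\<bar>)"

lemma pl_nondeg_critical_point_iff:
  "pl_nondeg_critical_point (F :: real^'n::finite \<Rightarrow> real) p k \<longleftrightarrow> k \<le> CARD('n) \<and> has_chart F p (morse_model k)"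
  unfolding pl_nondeg_critical_point_def has_chart_def morse_model_def
  by (simp add: algebra_simps)

definition pl_good :: "(real^'n::finite \<Rightarrow> real) \<Rightarrow> real^'n \<Rightarrow> bool" where
  "pl_good F p \<longleftrightarrow> pl_regular_point F p \<or> (\<exists>k. pl_nondeg_critical_point F p k)"

text \<open>Bounding the index by the dimension leaves finitely many models, so measurability can be
  shown for one model at a time.\<close>

lemma pl_good_iff:
  "pl_good (F :: real^'n::finite \<Rightarrow> real) p \<longleftrightarrow> (\<exists>M \<in> insert (\<lambda>x. x $ coord_enum (CARD('n) - 1)) (morse_model ` {..CARD('n)}). has_chart F p M)"
  unfolding pl_good_def pl_regular_point_iff pl_nondeg_critical_point_iff by blast

lemma pl_good_cong_germ:
  assumes e: "e > 0" and germ: "\<And>y. norm y < e \<Longrightarrow> F (p + y) - F p = G (q + y) - G q"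
  shows "pl_good F p \<longleftrightarrow> pl_good G q"
proof -
  have "has_chart F p M \<longleftrightarrow> has_chart G q M" for M
    using has_chart_cong_germ[OF _ e, of F p M G q] has_chart_cong_germ[OF _ e, of G q M F p] germ by auto
  then show ?thesis unfolding pl_good_iff by simp
qed

lemma bij_coord_enum: "bij_betw (coord_enum :: nat \<Rightarrow> 'n::finite) {..<CARD('n)} UNIV"
proof -
  have "\<exists>e. bij_betw e {..<CARD('n)} (UNIV :: 'n set)"
    using ex_bij_betw_nat_finite[of "UNIV :: 'n set"] by (simp add: atLeast0LessThan)
  then show ?thesis unfolding coord_enum_def by (rule someI_ex)
qed

lemma morse_model_eq:
  assumes "k \<le> CARD('n::finite)"
  shows "morse_model k x = (\<Sum>i\<in>UNIV. (if i \<in> coord_enum ` {..<k} then - \<bar>x $ i\<bar> else \<bar>x $ (i::'n)\<bar>))"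
proof -
  have inj: "inj_on (coord_enum :: nat \<Rightarrow> 'n) {..<CARD('n)}" using bij_coord_enum bij_betw_def by blast
  have "(\<Sum>i\<in>UNIV. (if i \<in> coord_enum ` {..<k} then - \<bar>x $ i\<bar> else \<bar>x $ (i::'n)\<bar>))
     = (\<Sum>j<CARD('n). if (coord_enum j :: 'n) \<in> coord_enum ` {..<k} then - \<bar>x $ coord_enum j\<bar> else \<bar>x $ coord_enum j\<bar>)"
    by (rule sum.reindex_bij_betw[OF bij_coord_enum, symmetric])
  also have "\<dots> = (\<Sum>j<CARD('n). if j < k then - \<bar>x $ coord_enum j\<bar> else \<bar>x $ coord_enum j\<bar>)"
    using inj assms by (intro sum.cong refl) (auto simp: inj_on_image_mem_iff[OF inj] inj_on_def)
  also have "{..<CARD('n)} = {..<k} \<union> {k..<CARD('n)}" using assms by auto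
  also have "(\<Sum>j\<in>{..<k} \<union> {k..<CARD('n)}. if j < k then - \<bar>x $ coord_enum j\<bar> else \<bar>x $ coord_enum j\<bar>)
     = (\<Sum>j<k. - \<bar>x $ coord_enum j\<bar>) + (\<Sum>j=k..<CARD('n). \<bar>x $ coord_enum j\<bar>)"
    by (subst sum.union_disjoint) auto
  finally show ?thesis unfolding morse_model_def by (simp add: sum_negf)
qed

text \<open>Near 0 a chart would carry the constant germ to its model, forcing the model to vanish
  there. Every model, however, is nonzero at some arbitrarily small multiple of a coordinate
  vector.\<close>

lemma not_pl_good_locally_constant:
  fixes F :: "real^'n::finite \<Rightarrow> real"
  assumes "e > 0" "\<And>y. norm y < e \<Longrightarrow> F (p + y) = F p"
  shows "\<not> pl_good F p"
proof
  assume "pl_good F p"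
  then obtain M where M: "M \<in> insert (\<lambda>x. x $ coord_enum (CARD('n) - 1)) (morse_model ` {..CARD('n)})" "has_chart F p M"
    unfolding pl_good_iff by blast
  obtain U V h g where c: "p \<in> U" "open V" "0 \<in> V" "homeomorphism U V h g" "h p = 0"
     "\<And>x. x \<in> V \<Longrightarrow> F (g x) = F p + M x"
    using M(2) unfolding has_chart_def pl_homeomorphism_def by blast
  have g0: "g 0 = p" using c(1,4,5) by (metis homeomorphism_apply1)
  have "continuous_on V g" using c(4) unfolding homeomorphism_def by blast
  then have "isCont g 0" using c(2,3) by (simp add: continuous_on_eq_continuous_at)
  then obtain d where d: "d > 0" "\<And>x. dist x 0 < d \<Longrightarrow> dist (g x) p < e"
    unfolding continuous_at_eps_delta g0 using assms(1) by blast
  obtain d' where d': "d' > 0" "ball 0 d' \<subseteq> V" using c(2,3) open_contains_ball by blast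
  have M0: "M x = 0" if "norm x < min d d'" for x
  proof -
    have "x \<in> V" using that d'(2) by auto
    moreover have "norm (g x - p) < e" using d(2)[of x] that by (simp add: dist_norm)
    then have "F (g x) = F p" using assms(2)[of "g x - p"] by simp
    ultimately show ?thesis using c(6) by simp
  qed
  define t where "t = min d d' / 2"
  have t: "t > 0" "t < min d d'" using d d' unfolding t_def by auto
  show False
  proof (cases "M = (\<lambda>x. x $ coord_enum (CARD('n) - 1))")
    case True
    show ?thesis using M0[of "axis (coord_enum (CARD('n) - 1)) t"] t True by (simp add: norm_axis_real)
  next
    case False
    then obtain k where k: "k \<le> CARD('n)" "M = morse_model k" using M(1) by blast
    have "M (axis i t) = (if i \<in> coord_enum ` {..<k} then - t else t)" for i :: 'n
    proof -
      have "M (axis i t) = (\<Sum>j\<in>UNIV. if j = i then (if i \<in> coord_enum ` {..<k} then - t else t) else 0)"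
        unfolding k(2) morse_model_eq[OF k(1)] using t by (intro sum.cong refl) (auto simp: axis_def)
      then show ?thesis by simp
    qed
    then show ?thesis using M0[of "axis undefined t"] t by (simp add: norm_axis_real split: if_splits)
  qed
qed

section \<open>Counting the regions of an arrangement\<close>

text \<open>The dual form of \<open>u \<notin> span (w ` S)\<close>, which is a closed condition on the witness and hence
  makes measurability in the weights easy.\<close>

definition separated :: "('i \<Rightarrow> 'a::euclidean_space) \<Rightarrow> 'i set \<Rightarrow> 'a \<Rightarrow> bool" where
  "separated w S u \<longleftrightarrow> (\<exists>\<nu>. (\<forall>s\<in>S. w s \<bullet> \<nu> = 0) \<and> u \<bullet> \<nu> = 1)"

definition sign_region :: "('i \<Rightarrow> 'a::euclidean_space) \<Rightarrow> ('i \<Rightarrow> real) \<Rightarrow> 'i set \<Rightarrow> 'i set \<Rightarrow> 'i set \<Rightarrow> 'a set" where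
  "sign_region w b Q T N = {x. (\<forall>q\<in>Q. w q \<bullet> x + b q = 0) \<and> (\<forall>j\<in>T. w j \<bullet> x + b j > 0) \<and> (\<forall>j\<in>N. w j \<bullet> x + b j < 0)}"

text \<open>A region is represented by its set of positive indices, which determines it because sign
  regions are convex. The set \<open>Q\<close> restricts the arrangement to a flat, as
  deletion-restriction requires.\<close>

definition regions :: "('i \<Rightarrow> 'a::euclidean_space) \<Rightarrow> ('i \<Rightarrow> real) \<Rightarrow> 'i set \<Rightarrow> 'i set \<Rightarrow> 'i set set" where
  "regions w b Q J = {T. T \<subseteq> J \<and> sign_region w b Q T (J - T) \<noteq> {}}"

text \<open>For finite \<open>I\<close>, the first clause says in dual form that any at most
  \<open>n\<close> normals are linearly independent; the second says that no \<open>n + 1\<close>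
  hyperplanes have a common point.\<close>

definition general_position :: "('i \<Rightarrow> 'a::euclidean_space) \<Rightarrow> ('i \<Rightarrow> real) \<Rightarrow> 'i set \<Rightarrow> nat \<Rightarrow> bool" where
  "general_position w b I n \<longleftrightarrow>
     (\<forall>S t. S \<subseteq> I \<longrightarrow> t \<in> I - S \<longrightarrow> card S < n \<longrightarrow> separated w S (w t)) \<and>
     (\<forall>S. S \<subseteq> I \<longrightarrow> card S = Suc n \<longrightarrow> sign_region w b S {} {} = {})"

lemma open_sign_region:
  assumes "finite T" "finite N"
  shows "open (sign_region w b {} T N)"
proof -
  have "sign_region w b {} T N = (\<Inter>j\<in>T. {x. w j \<bullet> x + b j > 0}) \<inter> (\<Inter>j\<in>N. {x. w j \<bullet> x + b j < 0})"
    unfolding sign_region_def by auto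
  moreover have "open {x. w j \<bullet> x + b j > 0}" "open {x. w j \<bullet> x + b j < 0}" for j
    by (auto intro!: open_Collect_less continuous_intros)
  ultimately show ?thesis using assms by (auto intro!: open_Int open_INT)
qed

lemma sign_region_perturb:
  assumes "finite T" "finite N" "x \<in> sign_region w b {} T N"
  obtains e where "e > 0" "\<And>s. \<bar>s\<bar> \<le> e \<Longrightarrow> x + s *\<^sub>R v \<in> sign_region w b {} T N"
proof -
  obtain d where d: "d > 0" "ball x d \<subseteq> sign_region w b {} T N"
    using open_sign_region[OF assms(1,2)] assms(3) open_contains_ball by blast
  define e where "e = d / (2 * (norm v + 1))"
  have nv: "norm v + 1 > 0" using norm_ge_zero[of v] by linarith
  show thesis
  proof
    show "e > 0" unfolding e_def using d nv by simp
    fix s :: real assume "\<bar>s\<bar> \<le> e"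
    then have "\<bar>s\<bar> * norm v \<le> e * (norm v + 1)" by (intro mult_mono) auto
    also have "\<dots> = d / 2" unfolding e_def using nv by (simp add: field_simps)
    also have "\<dots> < d" using d by simp
    finally show "x + s *\<^sub>R v \<in> sign_region w b {} T N"
      using d(2) by (auto simp: dist_norm subset_iff)
  qed
qed

text \<open>Hyperplanes are added one by one: a direction orthogonal to the earlier normals but not
  to the new one leads onto the new hyperplane without leaving the old ones.\<close>

lemma sign_region_nonempty_if_card_le:
  assumes gp: "general_position w b I n" and "finite S" "S \<subseteq> I" "card S \<le> n"
  shows "sign_region w b S {} {} \<noteq> {}"
  using assms(2-4)
proof (induction S)
  case empty
  show ?case by (auto simp: sign_region_def)
next
  case (insert t S)
  then have "sign_region w b S {} {} \<noteq> {}" by auto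
  then obtain x where x: "\<And>q. q \<in> S \<Longrightarrow> w q \<bullet> x + b q = 0" by (auto simp: sign_region_def)
  have "separated w S (w t)"
    using gp insert unfolding general_position_def by auto
  then obtain \<nu> where \<nu>: "\<And>s. s \<in> S \<Longrightarrow> w s \<bullet> \<nu> = 0" "w t \<bullet> \<nu> = 1" unfolding separated_def by blast
  have "x - (w t \<bullet> x + b t) *\<^sub>R \<nu> \<in> sign_region w b (insert t S) {} {}"
    unfolding sign_region_def using x \<nu> by (auto simp: inner_diff_right)
  then show ?case by blast
qed

lemma sign_region_empty_if_card_gt:
  assumes gp: "general_position w b I n" and "S \<subseteq> I" "finite S" "card S > n"
  shows "sign_region w b S T N = {}"
proof -
  obtain S' where S': "S' \<subseteq> S" "card S' = Suc n"
    using obtain_subset_with_card_n[of "Suc n" S] assms by (metis Suc_leI)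
  then have "sign_region w b S' {} {} = {}" using gp assms(2) unfolding general_position_def by auto
  moreover have "sign_region w b S T N \<subseteq> sign_region w b S' {} {}" using S' unfolding sign_region_def by auto
  ultimately show ?thesis by blast
qed

lemma sum_choose_Suc:
  "(\<Sum>k\<le>Suc d. (Suc m choose k)) = (\<Sum>k\<le>Suc d. (m choose k)) + (\<Sum>k\<le>d. (m choose k))"
proof -
  have "(\<Sum>k\<le>Suc d. (Suc m choose k)) = 1 + (\<Sum>k\<le>d. (m choose k) + (m choose Suc k))"
    by (simp add: sum.atMost_Suc_shift del: sum.atMost_Suc)
  also have "\<dots> = (1 + (\<Sum>k\<le>d. (m choose Suc k))) + (\<Sum>k\<le>d. (m choose k))" by (simp add: sum.distrib)
  also have "1 + (\<Sum>k\<le>d. (m choose Suc k)) = (\<Sum>k\<le>Suc d. (m choose k))" by (simp add: sum.atMost_Suc_shift del: sum.atMost_Suc)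
  finally show ?thesis .
qed

lemma sum_choose_complement: "(\<Sum>k\<le>n. m choose k) + (\<Sum>k\<in>{n+1..m}. m choose k) = 2 ^ m"
proof -
  have "(\<Sum>k\<le>n. m choose k) = (\<Sum>k\<le>min n m. m choose k)"
    by (rule sum.mono_neutral_right) auto
  moreover have "{..min n m} \<union> {n+1..m} = {..m}" "{..min n m} \<inter> {n+1..m} = {}" by auto
  ultimately show ?thesis
    using sum.union_disjoint[of "{..min n m}" "{n+1..m}" "\<lambda>k. m choose k"] choose_row_sum[of m] by simp
qed

text \<open>Deletion-restriction: adding the hyperplane \<open>t\<close> cuts in two exactly those regions that
  it meets, and these correspond to the regions induced on the hyperplane itself.\<close>

lemma card_regions:
  assumes "finite J" "finite Q" "Q \<inter> J = {}" "general_position w b (Q \<union> J) n"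
  shows "card (regions w b Q J) = (if card Q \<le> n then \<Sum>k\<le>n - card Q. (card J choose k) else 0)"
  using assms
\<comment> \<open>The set \<open>Q\<close> must vary, since restriction moves \<open>t\<close> from
  \<open>J\<close> into it.\<close>
proof (induction J arbitrary: Q)
  case empty
  have "regions w b Q {} = (if sign_region w b Q {} {} = {} then {} else {{}})"
    unfolding regions_def by auto
  moreover have "(\<Sum>k\<le>d. (0 choose k)) = 1" for d :: nat
    by (induction d) auto
  ultimately show ?case
    using sign_region_nonempty_if_card_le[of w b Q n Q] sign_region_empty_if_card_gt[of w b Q n Q "{}" "{}"] empty
    by (auto simp: not_le)
next
  case (insert t J)
  define \<R> where "\<R> = regions w b Q (insert t J)"
  define A where "A = {T. T \<subseteq> J \<and> T \<in> \<R>}"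
  define B where "B = {T. T \<subseteq> J \<and> insert t T \<in> \<R>}"
  have gp: "general_position w b (insert t (Q \<union> J)) n" using insert.prems by simp
  have tQ: "t \<notin> Q" using insert.prems by auto
  have finT: "finite T" "finite (J - T)" if "T \<subseteq> J" for T
    using that insert.hyps finite_subset by auto
  have perturb: "T \<in> A \<and> T \<in> B"
    if T: "T \<subseteq> J" and x: "x \<in> sign_region w b (insert t Q) T (J - T)" for T x
  proof -
    \<comment> \<open>The hyperplanes of \<open>Q\<close> and \<open>t\<close> meet in
      \<open>x\<close>, so general position bounds their number. This leaves
      \<open>card Q < n\<close>, as needed to separate \<open>w t\<close> from the normals in
      \<open>Q\<close>.\<close>
    have "card (insert t Q) \<le> n"
      using sign_region_empty_if_card_gt[OF gp, of "insert t Q" T "J - T"] x insert.prems by fastforce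
    then have "card Q < n" using tQ insert.prems by simp
    then have "separated w Q (w t)" using gp tQ unfolding general_position_def by auto
    then obtain \<nu> where \<nu>: "\<And>q. q \<in> Q \<Longrightarrow> w q \<bullet> \<nu> = 0" "w t \<bullet> \<nu> = 1" unfolding separated_def by blast
    have xT: "x \<in> sign_region w b {} T (J - T)" and xQ: "\<And>q. q \<in> insert t Q \<Longrightarrow> w q \<bullet> x + b q = 0"
      using x unfolding sign_region_def by auto
    obtain e where e: "e > 0" "\<And>s. \<bar>s\<bar> \<le> e \<Longrightarrow> x + s *\<^sub>R \<nu> \<in> sign_region w b {} T (J - T)"
      using sign_region_perturb[OF finT[OF T] xT] by metis
    have wt: "w t \<bullet> (x + s *\<^sub>R \<nu>) + b t = s" and wQ: "\<And>q. q \<in> Q \<Longrightarrow> w q \<bullet> (x + s *\<^sub>R \<nu>) + b q = 0" for s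
      using \<nu> xQ by (auto simp: inner_add_right)
    have sp: "x + e *\<^sub>R \<nu> \<in> sign_region w b {} T (J - T)" and sm: "x + (- e) *\<^sub>R \<nu> \<in> sign_region w b {} T (J - T)"
      using e(1) e(2)[of e] e(2)[of "- e"] by simp_all
    have "x + (- e) *\<^sub>R \<nu> \<in> sign_region w b Q T (insert t J - T)"
      using sm wt[of "- e"] wQ[of _ "- e"] e(1) unfolding sign_region_def by auto
    moreover have "x + e *\<^sub>R \<nu> \<in> sign_region w b Q (insert t T) (insert t J - insert t T)"
      using sp wt[of e] wQ[of _ e] e(1) unfolding sign_region_def by auto
    ultimately show ?thesis unfolding A_def B_def \<R>_def regions_def using T by blast
  qed
  have "A \<union> B = regions w b Q J"
  proof (intro equalityI subsetI)
    fix T assume "T \<in> A \<union> B"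
    then have T: "T \<subseteq> J" and "T \<in> \<R> \<or> insert t T \<in> \<R>" unfolding A_def B_def by auto
    then obtain x where "x \<in> sign_region w b Q T (insert t J - T) \<union> sign_region w b Q (insert t T) (insert t J - insert t T)"
      unfolding \<R>_def regions_def by blast
    then have "x \<in> sign_region w b Q T (J - T)" using insert.hyps unfolding sign_region_def by auto
    then show "T \<in> regions w b Q J" unfolding regions_def using T by blast
  next
    fix T assume "T \<in> regions w b Q J"
    then obtain x where T: "T \<subseteq> J" and x: "x \<in> sign_region w b Q T (J - T)" unfolding regions_def by blast
    consider "w t \<bullet> x + b t = 0" | "w t \<bullet> x + b t > 0" | "w t \<bullet> x + b t < 0" by linarith
    then show "T \<in> A \<union> B"
    proof cases
      case 1
      then have "x \<in> sign_region w b (insert t Q) T (J - T)" using x unfolding sign_region_def by auto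
      then show ?thesis using perturb[OF T] by blast
    next
      case 2
      then have "x \<in> sign_region w b Q (insert t T) (insert t J - insert t T)" using x unfolding sign_region_def by auto
      then show ?thesis using T unfolding B_def \<R>_def regions_def by blast
    next
      case 3
      then have "x \<in> sign_region w b Q T (insert t J - T)" using x unfolding sign_region_def by auto
      then show ?thesis using T unfolding A_def \<R>_def regions_def by blast
    qed
  qed
  moreover have "A \<inter> B = regions w b (insert t Q) J"
  proof (intro equalityI subsetI)
    fix T assume "T \<in> A \<inter> B"
    then have T: "T \<subseteq> J" "T \<in> \<R>" "insert t T \<in> \<R>" unfolding A_def B_def by auto
    obtain x y where x: "x \<in> sign_region w b Q T (insert t J - T)"
      and y: "y \<in> sign_region w b Q (insert t T) (insert t J - insert t T)"
      using T unfolding \<R>_def regions_def by blast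
    have tT: "t \<notin> T" using T insert.hyps by auto
    define p q where "p = w t \<bullet> y + b t" and "q = - (w t \<bullet> x + b t)"
    have "w t \<bullet> x + b t < 0" using x tT unfolding sign_region_def by blast
    moreover have "w t \<bullet> y + b t > 0" using y unfolding sign_region_def by blast
    ultimately have pq: "p > 0" "q > 0" unfolding p_def q_def by auto
    \<comment> \<open>The point of the segment from \<open>x\<close> to \<open>y\<close> on the
      hyperplane of \<open>t\<close>, where the values at the ends are \<open>- q\<close> and
      \<open>p\<close>. All other signs are common to both ends and hence kept.\<close>
    define z where "z = (p / (p + q)) *\<^sub>R x + (q / (p + q)) *\<^sub>R y"
    have z: "w j \<bullet> z + b j = (p / (p + q)) * (w j \<bullet> x + b j) + (q / (p + q)) * (w j \<bullet> y + b j)" for j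
    proof -
      have "p / (p + q) + q / (p + q) = 1" using pq by (simp flip: add_divide_distrib)
      then have "b j = (p / (p + q)) * b j + (q / (p + q)) * b j" by (metis distrib_right mult_1)
      then show ?thesis unfolding z_def by (simp add: inner_add_right algebra_simps)
    qed
    have "w t \<bullet> z + b t = 0" 
    proof -
      have "w t \<bullet> x + b t = - q" "w t \<bullet> y + b t = p" unfolding p_def q_def by simp_all
      then show ?thesis unfolding z by simp
    qed
    moreover have "w j \<bullet> z + b j = 0" if "j \<in> Q" for j
      unfolding z using x y that by (simp add: sign_region_def)
    moreover have c: "p / (p + q) > 0" "q / (p + q) > 0" using pq by auto
    have "w j \<bullet> z + b j > 0" if "j \<in> T" for j
    proof -
      have X: "w j \<bullet> x + b j > 0" and Y: "w j \<bullet> y + b j > 0" using x y that unfolding sign_region_def by auto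
      show ?thesis unfolding z by (rule add_pos_pos[OF mult_pos_pos[OF c(1) X] mult_pos_pos[OF c(2) Y]])
    qed
    moreover have "w j \<bullet> z + b j < 0" if "j \<in> J - T" for j
    proof -
      have X: "w j \<bullet> x + b j < 0" and Y: "w j \<bullet> y + b j < 0"
        using x y that insert.hyps(2) unfolding sign_region_def by auto
      show ?thesis unfolding z by (rule add_neg_neg[OF mult_pos_neg[OF c(1) X] mult_pos_neg[OF c(2) Y]])
    qed
    ultimately have "z \<in> sign_region w b (insert t Q) T (J - T)" unfolding sign_region_def by auto
    then show "T \<in> regions w b (insert t Q) J" unfolding regions_def using T by blast
  next
    fix T assume "T \<in> regions w b (insert t Q) J"
    then show "T \<in> A \<inter> B" unfolding regions_def using perturb by blast
  qed
  moreover have "card \<R> = card A + card B"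
  proof -
    have R: "\<R> = A \<union> insert t ` B"
    proof (intro equalityI subsetI)
      fix T assume T: "T \<in> \<R>"
      then have sub: "T \<subseteq> insert t J" unfolding \<R>_def regions_def by blast
      show "T \<in> A \<union> insert t ` B"
      proof (cases "t \<in> T")
        case True
        then have "insert t (T - {t}) = T" by auto
        then have "T - {t} \<in> B" using T sub unfolding B_def by auto
        then show ?thesis using \<open>insert t (T - {t}) = T\<close> by (metis UnCI imageI)
      next
        case False
        then show ?thesis using T sub unfolding A_def by auto
      qed
    qed (auto simp: A_def B_def)
    have fin: "finite A" "finite B" unfolding A_def B_def using insert.hyps(1) by auto
    have "inj_on (insert t) B"
    proof (rule inj_onI)
      fix T T' assume "T \<in> B" "T' \<in> B" "insert t T = insert t T'"
      moreover from this have "t \<notin> T" "t \<notin> T'" unfolding B_def using insert.hyps(2) by auto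
      ultimately show "T = T'" by (metis insert_ident)
    qed
    moreover have "A \<inter> insert t ` B = {}" unfolding A_def using insert.hyps(2) by auto
    ultimately show ?thesis unfolding R using fin by (subst card_Un_disjoint) (auto simp: card_image)
  qed
  moreover have "card A + card B = card (A \<union> B) + card (A \<inter> B)"
  proof -
    have "finite A" "finite B" unfolding A_def B_def using insert.hyps(1) by auto
    then show ?thesis by (rule card_Un_Int)
  qed
  ultimately have total: "card \<R> = card (regions w b Q J) + card (regions w b (insert t Q) J)" by simp
  have c1: "card (regions w b (insert t Q) J)
      = (if Suc (card Q) \<le> n then \<Sum>k\<le>n - Suc (card Q). (card J choose k) else 0)"
    using insert.IH[of "insert t Q"] insert.prems insert.hyps tQ by auto
  have c2: "card (regions w b Q J) = (if card Q \<le> n then \<Sum>k\<le>n - card Q. (card J choose k) else 0)"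
  proof -
    have "general_position w b (Q \<union> J) n"
      using gp unfolding general_position_def by blast
    then show ?thesis using insert.IH[of Q] insert.prems by auto
  qed
  show ?case
  proof (cases "card Q < n")
    case True
    then obtain d where d: "n - card Q = Suc d" "n - Suc (card Q) = d" by (metis Suc_diff_Suc)
    show ?thesis
      using total c1 c2 True d insert.hyps sum_choose_Suc[of "card J" d] unfolding \<R>_def by (simp del: sum.atMost_Suc)
  next
    case False
    then show ?thesis using total c1 c2 insert.hyps unfolding \<R>_def by (cases "card Q = n") auto
  qed
qed

section \<open>Normal forms of generic germs\<close>

text \<open>The model of index k has its minus signs on the first k enumerated coordinates, so the
  peaks, collected in \<open>N\<close>, have to be enumerated before the valleys.\<close>

lemma bij_coord_prefix:
  assumes S: "finite S" "card S = CARD('n::finite)" "N \<subseteq> S"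
  obtains \<tau> :: "'n::finite \<Rightarrow> 'i" where "bij_betw \<tau> UNIV S" "\<And>i. \<tau> i \<in> N \<longleftrightarrow> i \<in> coord_enum ` {..<card N}"
proof -
  define k where "k = card N"
  have finN: "finite N" using S finite_subset by blast
  have k: "k \<le> CARD('n)" unfolding k_def using S card_mono by metis
  obtain f where f: "bij_betw f {..<k} N"
    using ex_bij_betw_nat_finite[OF finN] unfolding k_def by (auto simp: atLeast0LessThan)
  have "card (S - N) = card {k..<CARD('n)}"
    using S finN unfolding k_def by (simp add: card_Diff_subset)
  then obtain g where g: "bij_betw g {k..<CARD('n)} (S - N)"
    using S(1) finite_same_card_bij[of "{k..<CARD('n)}" "S - N"] by auto
  define \<beta> where "\<beta> j = (if j < k then f j else g j)" for j
  have b1: "bij_betw \<beta> {..<k} N" using f by (rule bij_betw_cong[THEN iffD1, rotated]) (auto simp: \<beta>_def)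
  have b2: "bij_betw \<beta> {k..<CARD('n)} (S - N)" using g by (rule bij_betw_cong[THEN iffD1, rotated]) (auto simp: \<beta>_def)
  have "bij_betw \<beta> ({..<k} \<union> {k..<CARD('n)}) (N \<union> (S - N))"
    by (rule bij_betw_combine[OF b1 b2]) auto
  moreover have "{..<k} \<union> {k..<CARD('n)} = {..<CARD('n)}" "N \<union> (S - N) = S" using k S(3) by auto
  ultimately have b: "bij_betw \<beta> {..<CARD('n)} S" by simp
  define c where "c = inv_into {..<CARD('n)} (coord_enum :: nat \<Rightarrow> 'n)"
  have c: "bij_betw c UNIV {..<CARD('n)}" unfolding c_def by (rule bij_betw_inv_into[OF bij_coord_enum])
  have ce: "coord_enum (c i) = i" for i
    unfolding c_def using bij_betw_inv_into_right[OF bij_coord_enum, of i] by simp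
  have ec: "c (coord_enum j) = j" if "j < CARD('n)" for j
    unfolding c_def using bij_betw_inv_into_left[OF bij_coord_enum, of j] that by simp
  have cl: "c i < CARD('n)" for i using c unfolding bij_betw_def by auto
  show thesis
  proof
    show "bij_betw (\<beta> \<circ> c) UNIV S" by (rule bij_betw_trans[OF c b])
    have "\<beta> (c i) \<in> N \<longleftrightarrow> c i < k" for i
    proof (cases "c i < k")
      case True
      then show ?thesis using b1 unfolding bij_betw_def by auto
    next
      case False
      then have "c i \<in> {k..<CARD('n)}" using cl[of i] by simp
      then have "\<beta> (c i) \<in> S - N" using b2 unfolding bij_betw_def by blast
      then show ?thesis using False by auto
    qed
    moreover have "c i < k \<longleftrightarrow> i \<in> coord_enum ` {..<k}" for i
    proof
      assume "c i < k"
      then show "i \<in> coord_enum ` {..<k}" by (intro image_eqI[of _ _ "c i"]) (auto simp: ce)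
    next
      assume "i \<in> coord_enum ` {..<k}"
      then show "c i < k" using ec k by auto
    qed
    ultimately show "(\<beta> \<circ> c) i \<in> N \<longleftrightarrow> i \<in> coord_enum ` {..<card N}" for i unfolding k_def by simp
  qed
qed

text \<open>The witness separating each row from the others is its dual vector. A bijection with the
  coordinate type makes \<open>dual_basis_expansion\<close> applicable.\<close>

lemma dual_family:
  fixes w :: "'i \<Rightarrow> real^'n::finite"
  assumes fin: "finite S" and card: "card S = CARD('n)" and sep: "\<And>s. s \<in> S \<Longrightarrow> separated w (S - {s}) (w s)"
  obtains \<nu> where "\<And>s s'. s \<in> S \<Longrightarrow> s' \<in> S \<Longrightarrow> w s \<bullet> \<nu> s' = (if s = s' then 1 else 0)"
    "\<And>y. (\<Sum>s\<in>S. (w s \<bullet> y) *\<^sub>R \<nu> s) = y"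
proof -
  obtain \<nu> where \<nu>: "\<And>s s'. s \<in> S \<Longrightarrow> s' \<in> S - {s} \<Longrightarrow> w s' \<bullet> \<nu> s = 0" "\<And>s. s \<in> S \<Longrightarrow> w s \<bullet> \<nu> s = 1"
    using sep unfolding separated_def by metis
  have dual: "w s \<bullet> \<nu> s' = (if s = s' then 1 else 0)" if "s \<in> S" "s' \<in> S" for s s'
    using \<nu> that by auto
  obtain \<tau> :: "'n \<Rightarrow> 'i" where \<tau>: "bij_betw \<tau> UNIV S"
    using bij_coord_prefix[OF fin card, of "{}"] by blast
  have \<tau>S: "\<tau> i \<in> S" for i using \<tau> unfolding bij_betw_def by auto
  have "w (\<tau> i) \<bullet> \<nu> (\<tau> j) = (if i = j then 1 else 0)" for i j
    using dual[OF \<tau>S \<tau>S] \<tau> unfolding bij_betw_def inj_on_def by auto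
  then have "(\<Sum>s\<in>S. (w s \<bullet> y) *\<^sub>R \<nu> s) = y" for y
    using dual_basis_expansion[of "\<lambda>i. w (\<tau> i)" "\<lambda>i. \<nu> (\<tau> i)" y]
      sum.reindex_bij_betw[OF \<tau>, of "\<lambda>s. (w s \<bullet> y) *\<^sub>R \<nu> s"] by simp
  then show thesis using that dual by blast
qed

text \<open>The germ of a one-hidden-layer network, up to a constant, at a point where exactly the
  neurons in \<open>S\<close> are at their threshold and exactly those in \<open>T\<close> are on.\<close>

definition local_net :: "(nat \<Rightarrow> real^'n::finite) \<Rightarrow> (nat \<Rightarrow> real) \<Rightarrow> nat set \<Rightarrow> nat set \<Rightarrow> real^'n \<Rightarrow> real" where
  "local_net w v S T y = (\<Sum>j\<in>S. v j * relu (w j \<bullet> y)) + (\<Sum>j\<in>T. v j *\<^sub>R w j) \<bullet> y"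

lemma local_net_0: "local_net w v S T 0 = 0"
  by (simp add: local_net_def relu_def)

lemma relu_two_slope: "relu = two_slope 0 1"
  by (auto simp: relu_def two_slope_def fun_eq_iff)

text \<open>With fewer than \<open>CARD('n)\<close> neurons at threshold, the linear part grows
  along a direction that these neurons do not see, so the point is regular. With exactly
  \<open>CARD('n)\<close>, their rows are coordinates in which the germ splits into two-slope
  functions of nonzero slopes: one monotone summand makes the point regular; otherwise all summands
  are peaks or valleys and the point is critical.\<close>

lemma pl_good_local_net:
  fixes w :: "nat \<Rightarrow> real^'n::finite"
  assumes fin: "finite S" and disj: "S \<inter> T = {}" and T: "finite T" "T \<noteq> {}" and cardS: "card S \<le> CARD('n)"
    and gen: "\<And>S' T'. S' \<subseteq> S \<Longrightarrow> T' \<subseteq> S \<union> T \<Longrightarrow> S' \<inter> T' = {} \<Longrightarrow> T' \<noteq> {} \<Longrightarrow> card S' < CARD('n) \<Longrightarrow>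
      separated w S' (\<Sum>j\<in>T'. v j *\<^sub>R w j)"
  shows "pl_good (local_net w v S T) 0"
proof (cases "card S = CARD('n)")
  case False
  define u where "u = (\<Sum>j\<in>T. v j *\<^sub>R w j)"
  have "separated w S u" unfolding u_def using False cardS disj T by (intro gen) auto
  then obtain \<nu> where \<nu>: "\<And>s. s \<in> S \<Longrightarrow> w s \<bullet> \<nu> = 0" "u \<bullet> \<nu> = 1" unfolding separated_def by blast
  have "has_chart (local_net w v S T) 0 (\<lambda>x. x $ coord_enum (CARD('n) - 1))"
  proof (rule regular_chart)
    show "pwl (\<lambda>y. \<Sum>j\<in>S. v j * relu (w j \<bullet> y))"
      unfolding relu_two_slope by (intro pwl_sum pwl_mult_left pwl_two_slope_compose pwl_inner)
    show "u \<bullet> \<nu> = 1" by fact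
    show "(1::real) * 1 > 0" by simp
    show "local_net w v S T y = (\<Sum>j\<in>S. v j * relu (w j \<bullet> y)) + two_slope 1 1 (u \<bullet> y)" for y
      by (simp add: local_net_def u_def two_slope_def)
  qed (use \<nu> in \<open>auto simp: inner_add_right relu_def intro!: sum.cong\<close>)
  then show ?thesis unfolding pl_good_iff by blast
next
  case True
  define u where "u = (\<Sum>j\<in>T. v j *\<^sub>R w j)"
  have "separated w (S - {s}) (w s)" if s: "s \<in> S" for s
  proof -
    have "card (S - {s}) < CARD('n)" using True fin s by (metis card_Diff1_less)
    then have "separated w (S - {s}) (\<Sum>j\<in>{s}. v j *\<^sub>R w j)" using s by (intro gen) auto
    then obtain \<nu> where "\<forall>s'\<in>S - {s}. w s' \<bullet> \<nu> = 0" "(v s *\<^sub>R w s) \<bullet> \<nu> = 1" unfolding separated_def by auto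
    \<comment> \<open>The scalar \<open>v s\<close> moves from the row to the witness.\<close>
    then show ?thesis unfolding separated_def by (intro exI[of _ "v s *\<^sub>R \<nu>"]) auto
  qed
  then obtain \<nu> where dual: "\<And>s s'. s \<in> S \<Longrightarrow> s' \<in> S \<Longrightarrow> w s \<bullet> \<nu> s' = (if s = s' then 1 else 0)"
    and expand: "\<And>y. (\<Sum>s\<in>S. (w s \<bullet> y) *\<^sub>R \<nu> s) = y"
    using dual_family[OF fin True] by blast
  define a where "a s = u \<bullet> \<nu> s" for s
  \<comment> \<open>The slope on the negative side is \<open>a s\<close>; once monotone summands are
    excluded, its positivity means a peak.\<close>
  define N where "N = {s\<in>S. a s > 0}"
  obtain \<tau> :: "'n \<Rightarrow> nat" where \<tau>: "bij_betw \<tau> UNIV S" "\<And>i. \<tau> i \<in> N \<longleftrightarrow> i \<in> coord_enum ` {..<card N}"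
    using bij_coord_prefix[OF fin True, of N] unfolding N_def by blast
  have \<tau>S: "\<tau> i \<in> S" for i using \<tau>(1) unfolding bij_betw_def by auto
  have dual\<tau>: "w (\<tau> i) \<bullet> \<nu> (\<tau> j) = (if i = j then 1 else 0)" for i j
    using dual[OF \<tau>S \<tau>S] \<tau>(1) unfolding bij_betw_def inj_on_def by auto
  have u: "u \<bullet> y = (\<Sum>s\<in>S. (w s \<bullet> y) * a s)" for y
    using arg_cong[OF expand[of y], of "\<lambda>z. u \<bullet> z"] by (simp add: inner_sum_right a_def)
  have L: "local_net w v S T y = (\<Sum>s\<in>S. two_slope (a s) (a s + v s) (w s \<bullet> y))" for y
  proof -
    have "local_net w v S T y = (\<Sum>s\<in>S. v s * relu (w s \<bullet> y) + (w s \<bullet> y) * a s)"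
      unfolding local_net_def sum.distrib u[symmetric] u_def ..
    also have "\<dots> = (\<Sum>s\<in>S. two_slope (a s) (a s + v s) (w s \<bullet> y))"
      by (intro sum.cong refl) (auto simp: relu_def two_slope_def algebra_simps)
    finally show ?thesis .
  qed
  \<comment> \<open>A witness \<open>\<mu>\<close> orthogonal to the other rows leaves a single term
    of the dual expansion, so \<open>u \<bullet> \<mu>\<close> is a multiple of \<open>a s\<close>.
    Adding neuron \<open>s\<close> to the sum replaces \<open>a s\<close> by
    \<open>a s + v s\<close>; genericity makes both pairings equal to 1.\<close>
  have nz: "a s \<noteq> 0 \<and> a s + v s \<noteq> 0" if s: "s \<in> S" for s
  proof
    have cardlt: "card (S - {s}) < CARD('n)" using True fin s by (metis card_Diff1_less)
    have single: "(\<Sum>s'\<in>S. (w s' \<bullet> \<mu>) * a s') = (w s \<bullet> \<mu>) * a s" if "\<forall>s'\<in>S - {s}. w s' \<bullet> \<mu> = 0" for \<mu>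
      using sum.remove[OF fin s, of "\<lambda>s'. (w s' \<bullet> \<mu>) * a s'"] that by simp
    have "separated w (S - {s}) (\<Sum>j\<in>T. v j *\<^sub>R w j)" using cardlt T disj by (intro gen) auto
    then obtain \<mu> where "\<forall>s'\<in>S - {s}. w s' \<bullet> \<mu> = 0" "u \<bullet> \<mu> = 1" unfolding separated_def u_def by blast
    then show "a s \<noteq> 0" using u[of \<mu>] single[of \<mu>] by auto
    have "separated w (S - {s}) (\<Sum>j\<in>insert s T. v j *\<^sub>R w j)" using cardlt T disj s by (intro gen) auto
    moreover have "(\<Sum>j\<in>insert s T. v j *\<^sub>R w j) = v s *\<^sub>R w s + u"
      unfolding u_def using T disj s by (subst sum.insert) auto
    ultimately obtain \<mu> where "\<forall>s'\<in>S - {s}. w s' \<bullet> \<mu> = 0" "(v s *\<^sub>R w s + u) \<bullet> \<mu> = 1" unfolding separated_def by auto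
    then have "(w s \<bullet> \<mu>) * (a s + v s) = 1" using u[of \<mu>] single[of \<mu>] by (simp add: inner_add_left algebra_simps)
    then show "a s + v s \<noteq> 0" by auto
  qed
  show ?thesis
  proof (cases "\<exists>s\<in>S. a s * (a s + v s) > 0")
    case True
    then obtain s where s: "s \<in> S" "a s * (a s + v s) > 0" by blast
    have "has_chart (local_net w v S T) 0 (\<lambda>x. x $ coord_enum (CARD('n) - 1))"
    proof (rule regular_chart[OF _ _ _ _ s(2)])
      show "pwl (\<lambda>y. \<Sum>j\<in>S - {s}. two_slope (a j) (a j + v j) (w j \<bullet> y))"
        by (intro pwl_sum pwl_two_slope_compose pwl_inner)
      show "w s \<bullet> \<nu> s = 1" using dual s by simp
      show "local_net w v S T y = (\<Sum>j\<in>S - {s}. two_slope (a j) (a j + v j) (w j \<bullet> y)) + two_slope (a s) (a s + v s) (w s \<bullet> y)" for y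
        unfolding L using sum.remove[OF fin s(1)] by (simp add: add.commute)
    qed (use dual[OF _ s(1)] in \<open>auto simp: inner_add_right two_slope_def intro!: sum.cong\<close>)
    then show ?thesis unfolding pl_good_iff by blast
  next
    case False
    have N: "a s > 0 \<and> a s + v s < 0" if "s \<in> N" for s
      using that False nz[of s] unfolding N_def by (auto simp: not_less mult_le_0_iff)
    have P: "a s < 0 \<and> a s + v s > 0" if "s \<in> S" "s \<notin> N" for s
      using that False nz[of s] unfolding N_def by (auto simp: not_less mult_le_0_iff)
    have "has_chart (local_net w v S T) 0
       (\<lambda>x. \<Sum>i\<in>UNIV. (if i \<in> coord_enum ` {..<card N} then - \<bar>x $ i\<bar> else \<bar>x $ (i::'n)\<bar>))"
    proof (rule critical_chart[OF dual\<tau>])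
      show "local_net w v S T y = (\<Sum>i\<in>UNIV. two_slope (a (\<tau> i)) (a (\<tau> i) + v (\<tau> i)) (w (\<tau> i) \<bullet> y))" for y
        unfolding L by (rule sum.reindex_bij_betw[OF \<tau>(1), symmetric])
      show "a (\<tau> i) > 0 \<and> a (\<tau> i) + v (\<tau> i) < 0" if "i \<in> coord_enum ` {..<card N}" for i
        using that N \<tau>(2) by blast
      show "a (\<tau> i) < 0 \<and> a (\<tau> i) + v (\<tau> i) > 0" if "i \<notin> coord_enum ` {..<card N}" for i
        using that P[OF \<tau>S] \<tau>(2) by blast
    qed
    moreover have "card N \<le> CARD('n)" using True fin unfolding N_def by (metis (no_types, lifting) card_mono mem_Collect_eq subsetI)
    moreover from this have "(\<lambda>x. \<Sum>i\<in>UNIV. (if i \<in> coord_enum ` {..<card N} then - \<bar>x $ i\<bar> else \<bar>x $ (i::'n)\<bar>))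
        = morse_model (card N)"
      by (intro ext morse_model_eq[symmetric])
    ultimately have "has_chart (local_net w v S T) 0 (morse_model (card N))" by simp
    then show ?thesis unfolding pl_good_iff using \<open>card N \<le> CARD('n)\<close> by blast
  qed
qed

section \<open>Germs of shallow networks\<close>

definition row_weight :: "(nat \<times> nat \<times> nat \<Rightarrow> real) \<Rightarrow> nat \<Rightarrow> real^'n::finite" where
  "row_weight \<theta> j = (\<chi> i. \<theta> (0, j, inv_into {..<CARD('n)} coord_enum i))"

definition row_bias :: "nat \<Rightarrow> (nat \<times> nat \<times> nat \<Rightarrow> real) \<Rightarrow> nat \<Rightarrow> real" where
  "row_bias n \<theta> j = \<theta> (0, j, n)"

lemma row_weight_nth: "k < CARD('n) \<Longrightarrow> (row_weight \<theta> j :: real^'n::finite) $ coord_enum k = \<theta> (0, j, k)"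
  unfolding row_weight_def using bij_betw_inv_into_left[OF bij_coord_enum[where 'n='n], of k] by simp

lemma affine_layer_0:
  fixes x :: "real^'n::finite"
  shows "affine_layer (net_dims CARD('n) ws) \<theta> 0 (\<lambda>k. x $ coord_enum k) j = row_weight \<theta> j \<bullet> x + row_bias CARD('n) \<theta> j"
proof -
  have "row_weight \<theta> j \<bullet> x = (\<Sum>k<CARD('n). (row_weight \<theta> j :: real^'n) $ coord_enum k * x $ coord_enum k)"
    unfolding inner_vec_def inner_real_def
    by (rule sum.reindex_bij_betw[OF bij_coord_enum, symmetric])
  also have "\<dots> = (\<Sum>k<CARD('n). \<theta> (0,j,k) * x $ coord_enum k)"
    by (intro sum.cong refl) (simp add: row_weight_nth)
  finally show ?thesis by (simp add: affine_layer_def net_dims_def row_bias_def)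
qed

lemma relu_net_single:
  fixes x :: "real^'n::finite"
  shows "relu_net [m] \<theta> x = (\<Sum>j<m. \<theta> (1,0,j) * relu (row_weight \<theta> j \<bullet> x + row_bias CARD('n) \<theta> j)) + \<theta> (1,0,m)"
proof -
  have "net_dims CARD('n) [m] ! Suc 0 = m" by (simp add: net_dims_def)
  then show ?thesis
    by (simp add: relu_net_def Let_def affine_layer_0 affine_layer_def[of _ _ "Suc 0"])
qed

text \<open>Later layers see the input only through the first-layer outputs below its width. Indices
  beyond a width are left out because there \<open>hidden_out\<close> reads values that are no
  parameters of the network.\<close>

lemma hidden_out_cong:
  assumes "\<And>j. j < d ! 1 \<Longrightarrow> hidden_out d \<theta> 1 x j = hidden_out d \<theta> 1 y j" "i \<ge> 1" "j < d ! i"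
  shows "hidden_out d \<theta> i x j = hidden_out d \<theta> i y j"
  using assms(2,3)
proof (induction i arbitrary: j)
  case 0
  then show ?case by simp
next
  case (Suc i)
  show ?case
  proof (cases "i = 0")
    case True
    then show ?thesis using assms(1)[of j] Suc.prems by simp
  next
    case False
    then have "affine_layer d \<theta> i (hidden_out d \<theta> i x) j = affine_layer d \<theta> i (hidden_out d \<theta> i y) j" for j
      unfolding affine_layer_def using Suc.IH by simp
    then show ?thesis by simp
  qed
qed

lemma relu_net_eq_if_all_off:
  fixes x y :: "real^'n::finite"
  assumes "ws \<noteq> []"
    and "\<And>j. j < hd ws \<Longrightarrow> row_weight \<theta> j \<bullet> x + row_bias CARD('n) \<theta> j \<le> 0"
    and "\<And>j. j < hd ws \<Longrightarrow> row_weight \<theta> j \<bullet> y + row_bias CARD('n) \<theta> j \<le> 0"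
  shows "relu_net ws \<theta> x = relu_net ws \<theta> y"
proof -
  define d where "d = net_dims CARD('n) ws"
  have d1: "d ! 1 = hd ws" using assms(1) unfolding d_def net_dims_def by (cases ws) auto
  have h1: "hidden_out d \<theta> 1 (\<lambda>k. x $ coord_enum k) j = hidden_out d \<theta> 1 (\<lambda>k. y $ coord_enum k) j" if "j < d ! 1" for j
    using assms(2,3)[of j] that unfolding d1 by (simp add: affine_layer_0 d_def relu_def)
  have "hidden_out d \<theta> (length ws) (\<lambda>k. x $ coord_enum k) j = hidden_out d \<theta> (length ws) (\<lambda>k. y $ coord_enum k) j"
    if "j < d ! length ws" for j
    by (rule hidden_out_cong[OF h1]) (use that assms(1) in \<open>auto simp: Suc_le_eq\<close>)
  then show ?thesis unfolding relu_net_def Let_def d_def[symmetric] affine_layer_def by simp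
qed

lemma pl_morse_iff: "pl_morse F \<longleftrightarrow> (\<forall>p. pl_good F p)"
  unfolding pl_morse_def pl_good_def ..

lemma pl_morse_imp_no_dead_region:
  assumes "ws \<noteq> []" "pl_morse (relu_net ws \<theta> :: real^'n::finite \<Rightarrow> real)"
  shows "sign_region (row_weight \<theta> :: nat \<Rightarrow> real^'n) (row_bias CARD('n) \<theta>) {} {} {..<hd ws} = {}"
proof (rule ccontr)
  assume "\<not> ?thesis"
  then obtain p :: "real^'n" where p: "p \<in> sign_region (row_weight \<theta>) (row_bias CARD('n) \<theta>) {} {} {..<hd ws}" by blast
  obtain e where e: "e > 0" "ball p e \<subseteq> sign_region (row_weight \<theta>) (row_bias CARD('n) \<theta>) {} {} {..<hd ws}"
    using open_contains_ball p open_sign_region[of "{}" "{..<hd ws}"] by blast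
  have "relu_net ws \<theta> (p + y) = relu_net ws \<theta> p" if "norm y < e" for y
  proof -
    have "p + y \<in> ball p e" using that by (simp add: dist_norm)
    then have "p + y \<in> sign_region (row_weight \<theta>) (row_bias CARD('n) \<theta>) {} {} {..<hd ws}" using e by blast
    then show ?thesis using p unfolding sign_region_def
      by (intro relu_net_eq_if_all_off assms(1)) (auto intro: less_imp_le)
  qed
  then have "\<not> pl_good (relu_net ws \<theta>) p" using not_pl_good_locally_constant e(1) by blast
  then show False using assms(2) unfolding pl_morse_iff by blast
qed

text \<open>Near \<open>p\<close> the neurons in \<open>T\<close> stay on and those outside
  \<open>S\<close> and \<open>T\<close> stay off, while those in \<open>S\<close> have
  pre-activation exactly \<open>w j \<bullet> y\<close>. The increment thus depends on
  \<open>p\<close> only through its pattern, and the biases cancel.\<close>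

lemma relu_net_germ:
  fixes p :: "real^'n::finite"
  assumes S: "S \<subseteq> {..<m}" and T: "T \<subseteq> {..<m}" and disj: "S \<inter> T = {}"
    and p: "p \<in> sign_region (row_weight \<theta>) (row_bias CARD('n) \<theta>) S T ({..<m} - S - T)"
  shows "pl_good (relu_net [m] \<theta>) p \<longleftrightarrow> pl_good (local_net (row_weight \<theta> :: nat \<Rightarrow> real^'n) (\<lambda>j. \<theta> (1,0,j)) S T) 0"
proof -
  define w where "w = (row_weight \<theta> :: nat \<Rightarrow> real^'n)"
  define b where "b = row_bias CARD('n) \<theta>"
  define v where "v = (\<lambda>j. \<theta> (1,0,j))"
  define N where "N = {..<m} - S - T"
  have fin: "finite S" "finite T" "finite N" using S T finite_subset unfolding N_def by auto
  have "p \<in> sign_region w b {} T N" using p unfolding sign_region_def w_def b_def N_def by auto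
  then obtain e where e: "e > 0" "ball p e \<subseteq> sign_region w b {} T N"
    using open_contains_ball open_sign_region[OF fin(2,3)] by blast
  show ?thesis
  proof (rule pl_good_cong_germ[OF e(1)])
    fix y :: "real^'n" assume "norm y < e"
    then have "p + y \<in> ball p e" by (simp add: dist_norm)
    then have y: "p + y \<in> sign_region w b {} T N" using e by blast
    have pp: "p \<in> sign_region w b S T N" using p unfolding w_def b_def N_def .
    have "relu_net [m] \<theta> (p + y) - relu_net [m] \<theta> p
       = (\<Sum>j<m. v j * (relu (w j \<bullet> (p + y) + b j) - relu (w j \<bullet> p + b j)))"
      unfolding relu_net_single w_def b_def v_def by (simp add: sum_subtractf right_diff_distrib)
    also have "\<dots> = (\<Sum>j<m. (if j \<in> S then v j * relu (w j \<bullet> y) else 0) + (if j \<in> T then v j * (w j \<bullet> y) else 0))"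
    proof (intro sum.cong refl)
      fix j assume j: "j \<in> {..<m}"
      consider "j \<in> S" "j \<notin> T" | "j \<in> T" "j \<notin> S" | "j \<in> N" "j \<notin> S" "j \<notin> T" using j disj unfolding N_def by auto
      then show "v j * (relu (w j \<bullet> (p + y) + b j) - relu (w j \<bullet> p + b j)) =
         (if j \<in> S then v j * relu (w j \<bullet> y) else 0) + (if j \<in> T then v j * (w j \<bullet> y) else 0)"
      proof cases
        case 1
        then have "w j \<bullet> p + b j = 0" using pp unfolding sign_region_def by blast
        moreover from this have "w j \<bullet> (p + y) + b j = w j \<bullet> y" by (simp add: inner_add_right)
        ultimately show ?thesis using 1 by (simp add: relu_def)
      next
        case 2
        then have "w j \<bullet> p + b j > 0" "w j \<bullet> (p + y) + b j > 0" using pp y unfolding sign_region_def by blast+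
        then show ?thesis using 2 by (simp add: relu_def inner_add_right)
      next
        case 3
        then have "w j \<bullet> p + b j < 0" "w j \<bullet> (p + y) + b j < 0" using pp y unfolding sign_region_def by blast+
        then show ?thesis using 3 by (simp add: relu_def)
      qed
    qed
    also have "\<dots> = (\<Sum>j\<in>S. v j * relu (w j \<bullet> y)) + (\<Sum>j\<in>T. v j * (w j \<bullet> y))"
      using S T by (simp add: sum.distrib sum.inter_restrict[symmetric] Int_absorb1)
    also have "\<dots> = local_net w v S T y"
      unfolding local_net_def by (simp add: inner_sum_left)
    finally show "relu_net [m] \<theta> (p + y) - relu_net [m] \<theta> p =
         local_net (row_weight \<theta>) (\<lambda>j. \<theta> (1,0,j)) S T (0 + y) - local_net (row_weight \<theta>) (\<lambda>j. \<theta> (1,0,j)) S T 0"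
      by (simp add: local_net_0 w_def v_def)
  qed
qed

lemma sign_region_cover:
  fixes w :: "nat \<Rightarrow> 'a::euclidean_space"
  obtains S T where "S \<subseteq> {..<m}" "T \<subseteq> {..<m}" "S \<inter> T = {}" "p \<in> sign_region w b S T ({..<m} - S - T)"
proof
  show "p \<in> sign_region w b {j\<in>{..<m}. w j \<bullet> p + b j = 0} {j\<in>{..<m}. w j \<bullet> p + b j > 0}
      ({..<m} - {j\<in>{..<m}. w j \<bullet> p + b j = 0} - {j\<in>{..<m}. w j \<bullet> p + b j > 0})"
    unfolding sign_region_def by auto
qed auto

text \<open>Replaces the quantifier over all points by one over finitely many patterns, for each of
  which being realised and having a good germ are separate Borel conditions.\<close>

lemma pl_morse_single_iff:
  "pl_morse (relu_net [m] \<theta> :: real^'n::finite \<Rightarrow> real) \<longleftrightarrow>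
    (\<forall>S T. S \<subseteq> {..<m} \<longrightarrow> T \<subseteq> {..<m} \<longrightarrow> S \<inter> T = {} \<longrightarrow>
       sign_region (row_weight \<theta> :: nat \<Rightarrow> real^'n) (row_bias CARD('n) \<theta>) S T ({..<m} - S - T) \<noteq> {} \<longrightarrow>
       pl_good (local_net (row_weight \<theta> :: nat \<Rightarrow> real^'n) (\<lambda>j. \<theta> (1,0,j)) S T) 0)" (is "?L \<longleftrightarrow> ?R")
proof
  assume L: ?L
  show ?R
  proof (intro allI impI)
    fix S T assume ST: "S \<subseteq> {..<m}" "T \<subseteq> {..<m}" "S \<inter> T = {}"
      and "sign_region (row_weight \<theta> :: nat \<Rightarrow> real^'n) (row_bias CARD('n) \<theta>) S T ({..<m} - S - T) \<noteq> {}"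
    then obtain p :: "real^'n" where "p \<in> sign_region (row_weight \<theta>) (row_bias CARD('n) \<theta>) S T ({..<m} - S - T)" by blast
    then show "pl_good (local_net (row_weight \<theta> :: nat \<Rightarrow> real^'n) (\<lambda>j. \<theta> (1,0,j)) S T) 0"
      using relu_net_germ[OF ST] L unfolding pl_morse_iff by blast
  qed
next
  assume R: ?R
  show ?L
    unfolding pl_morse_iff
  proof
    fix p :: "real^'n"
    obtain S T where ST: "S \<subseteq> {..<m}" "T \<subseteq> {..<m}" "S \<inter> T = {}"
       "p \<in> sign_region (row_weight \<theta>) (row_bias CARD('n) \<theta>) S T ({..<m} - S - T)"
      by (rule sign_region_cover)
    have "pl_good (local_net (row_weight \<theta> :: nat \<Rightarrow> real^'n) (\<lambda>j. \<theta> (1,0,j)) S T) 0"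
      by (rule R[rule_format, OF ST(1-3)]) (use ST(4) in auto)
    then show "pl_good (relu_net [m] \<theta>) p" by (simp add: relu_net_germ[OF ST])
  qed
qed

section \<open>Generic parameters without dead regions\<close>

text \<open>The type argument carries the input dimension. One-element sets \<open>T\<close> give
  independence of the normals; larger ones concern the linear parts of germs, from which the slopes
  in \<open>pl_good_local_net\<close> arise.\<close>

definition generic_net :: "'n::finite itself \<Rightarrow> nat \<Rightarrow> (nat \<times> nat \<times> nat \<Rightarrow> real) \<Rightarrow> bool" where
  "generic_net _ m \<theta> \<longleftrightarrow>
    (\<forall>S T. S \<subseteq> {..<m} \<longrightarrow> T \<subseteq> {..<m} \<longrightarrow> S \<inter> T = {} \<longrightarrow> T \<noteq> {} \<longrightarrow> card S < CARD('n) \<longrightarrow>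
       separated (row_weight \<theta> :: nat \<Rightarrow> real^'n) S (\<Sum>j\<in>T. \<theta> (1,0,j) *\<^sub>R row_weight \<theta> j)) \<and>
    (\<forall>S. S \<subseteq> {..<m} \<longrightarrow> card S = Suc CARD('n) \<longrightarrow>
       sign_region (row_weight \<theta> :: nat \<Rightarrow> real^'n) (row_bias CARD('n) \<theta>) S {} {} = {})"

lemma generic_net_separated:
  assumes "generic_net TYPE('n::finite) m \<theta>"
    and "S \<subseteq> {..<m}" "T \<subseteq> {..<m}" "S \<inter> T = {}" "T \<noteq> {}" "card S < CARD('n)"
  shows "separated (row_weight \<theta> :: nat \<Rightarrow> real^'n) S (\<Sum>j\<in>T. \<theta> (1,0,j) *\<^sub>R row_weight \<theta> j)"
  by (rule assms(1)[unfolded generic_net_def, THEN conjunct1, rule_format]) fact+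

lemma generic_net_imp_general_position:
  assumes "generic_net TYPE('n::finite) m \<theta>"
  shows "general_position (row_weight \<theta> :: nat \<Rightarrow> real^'n) (row_bias CARD('n) \<theta>) {..<m} CARD('n)"
  unfolding general_position_def
proof (intro conjI allI impI)
  fix S t assume S: "S \<subseteq> {..<m}" "t \<in> {..<m} - S" "card S < CARD('n)"
  then have "separated (row_weight \<theta> :: nat \<Rightarrow> real^'n) S (\<Sum>j\<in>{t}. \<theta> (1,0,j) *\<^sub>R row_weight \<theta> j)"
    by (intro generic_net_separated[OF assms]) auto
  then obtain \<nu> where "\<forall>s\<in>S. (row_weight \<theta> s :: real^'n) \<bullet> \<nu> = 0" "(\<theta> (1,0,t) *\<^sub>R row_weight \<theta> t) \<bullet> \<nu> = 1"
    unfolding separated_def by auto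
  then show "separated (row_weight \<theta> :: nat \<Rightarrow> real^'n) S (row_weight \<theta> t)"
    unfolding separated_def by (intro exI[of _ "\<theta> (1,0,t) *\<^sub>R \<nu>"]) auto
qed (use assms in \<open>auto simp: generic_net_def\<close>)

text \<open>At a point where no neuron is on, the hyperplanes through it are independent, so moving
  off all of them to their negative sides leads into a dead region.\<close>

lemma dead_region_from_point:
  fixes w :: "nat \<Rightarrow> 'a::euclidean_space"
  assumes gp: "general_position w b {..<m} n" and S: "S \<subseteq> {..<m}" "card S \<le> n"
    and x: "x \<in> sign_region w b S {} ({..<m} - S)"
  shows "sign_region w b {} {} {..<m} \<noteq> {}"
proof -
  have finS: "finite S" using S finite_subset by auto
  have "\<exists>\<nu>. (\<forall>s'\<in>S - {s}. w s' \<bullet> \<nu> = 0) \<and> w s \<bullet> \<nu> = 1" if s: "s \<in> S" for s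
  proof -
    have "card (S - {s}) < n" using finS s S(2) by (metis card_Diff1_less order_less_le_trans)
    then have "separated w (S - {s}) (w s)"
      using gp[unfolded general_position_def, THEN conjunct1, rule_format, of "S - {s}" s] s S(1) by blast
    then show ?thesis unfolding separated_def by blast
  qed
  then obtain \<nu> where \<nu>: "\<And>s s'. s \<in> S \<Longrightarrow> s' \<in> S - {s} \<Longrightarrow> w s' \<bullet> \<nu> s = 0" "\<And>s. s \<in> S \<Longrightarrow> w s \<bullet> \<nu> s = 1" by metis
  \<comment> \<open>By duality this direction lowers all pre-activations in \<open>S\<close> at unit
    rate simultaneously.\<close>
  define d where "d = - (\<Sum>s\<in>S. \<nu> s)"
  have d: "w s \<bullet> d = -1" if "s \<in> S" for s
  proof -
    have "w s \<bullet> d = - (\<Sum>s'\<in>S. w s \<bullet> \<nu> s')" unfolding d_def by (simp add: inner_sum_right)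
    also have "(\<Sum>s'\<in>S. w s \<bullet> \<nu> s') = (\<Sum>s'\<in>S. if s' = s then 1 else 0)"
      using \<nu> that by (intro sum.cong refl) auto
    finally show ?thesis using finS that by simp
  qed
  have "x \<in> sign_region w b {} {} ({..<m} - S)" using x unfolding sign_region_def by auto
  then obtain e where e: "e > 0" "\<And>s. \<bar>s\<bar> \<le> e \<Longrightarrow> x + s *\<^sub>R d \<in> sign_region w b {} {} ({..<m} - S)"
    using sign_region_perturb[of "{}" "{..<m} - S"] by (metis finite.emptyI finite_Diff finite_lessThan)
  have "w j \<bullet> (x + e *\<^sub>R d) + b j < 0" if j: "j < m" for j
  proof (cases "j \<in> S")
    case True
    then have "w j \<bullet> x + b j = 0" using x unfolding sign_region_def by blast
    then show ?thesis using d[OF True] e(1) by (simp add: inner_add_right)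
  next
    case False
    then show ?thesis using e(2)[of e] e(1) j unfolding sign_region_def by auto
  qed
  then have "x + e *\<^sub>R d \<in> sign_region w b {} {} {..<m}" unfolding sign_region_def by auto
  then show ?thesis by blast
qed

text \<open>The absence of dead regions enters only through \<open>T \<noteq> {}\<close>: a realised
  pattern without an on neuron could be pushed into a dead region.\<close>

lemma generic_net_pl_morse:
  assumes gen: "generic_net TYPE('n::finite) m \<theta>"
    and nodead: "sign_region (row_weight \<theta> :: nat \<Rightarrow> real^'n) (row_bias CARD('n) \<theta>) {} {} {..<m} = {}"
  shows "pl_morse (relu_net [m] \<theta> :: real^'n \<Rightarrow> real)"
  unfolding pl_morse_single_iff
proof (intro allI impI)
  fix S T assume ST: "S \<subseteq> {..<m}" "T \<subseteq> {..<m}" "S \<inter> T = {}"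
    and ne: "sign_region (row_weight \<theta> :: nat \<Rightarrow> real^'n) (row_bias CARD('n) \<theta>) S T ({..<m} - S - T) \<noteq> {}"
  have fin: "finite S" "finite T" using finite_subset[OF ST(1)] finite_subset[OF ST(2)] by auto
  note gp = generic_net_imp_general_position[OF gen]
  have cardS: "card S \<le> CARD('n)"
    using sign_region_empty_if_card_gt[OF gp ST(1) fin(1), of T "{..<m} - S - T"] ne by force
  have "T \<noteq> {}"
  proof
    assume "T = {}"
    then obtain x :: "real^'n" where "x \<in> sign_region (row_weight \<theta>) (row_bias CARD('n) \<theta>) S {} ({..<m} - S)" using ne by auto
    then show False using dead_region_from_point[OF gp ST(1) cardS] nodead by blast
  qed
  show "pl_good (local_net (row_weight \<theta> :: nat \<Rightarrow> real^'n) (\<lambda>j. \<theta> (1,0,j)) S T) 0"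
  proof (rule pl_good_local_net[OF fin(1) ST(3) fin(2) \<open>T \<noteq> {}\<close> cardS])
    fix S' T' assume A: "S' \<subseteq> S" "T' \<subseteq> S \<union> T" "S' \<inter> T' = {}" "T' \<noteq> {}" "card S' < CARD('n)"
    have "S' \<subseteq> {..<m}" "T' \<subseteq> {..<m}" using A(1,2) ST(1,2) by auto
    then show "separated (row_weight \<theta> :: nat \<Rightarrow> real^'n) S' (\<Sum>j\<in>T'. \<theta> (1,0,j) *\<^sub>R row_weight \<theta> j)"
      using A(3-5) by (rule generic_net_separated[OF gen])
  qed
qed

section \<open>Borel measurability of conditions on the parameters\<close>

text \<open>Projection along a compact factor preserves closedness. The sequential form suits the
  product topology on parameter functions, which is first countable because their index set is
  countable.\<close>

lemma closed_Bex_compact: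
  fixes P :: "'a::first_countable_topology \<Rightarrow> 'b::metric_space \<Rightarrow> bool"
  assumes K: "compact K"
    and P: "\<And>\<theta> xs \<theta>' x. \<theta> \<longlonglongrightarrow> \<theta>' \<Longrightarrow> xs \<longlonglongrightarrow> x \<Longrightarrow> (\<And>k. P (\<theta> k) (xs k)) \<Longrightarrow> P \<theta>' x"
  shows "closed {\<theta>. \<exists>x\<in>K. P \<theta> x}"
  unfolding closed_sequential_limits
proof (intro allI impI)
  fix \<theta> \<theta>' assume "(\<forall>k. \<theta> k \<in> {\<theta>. \<exists>x\<in>K. P \<theta> x}) \<and> \<theta> \<longlonglongrightarrow> \<theta>'"
  then have lim: "\<theta> \<longlonglongrightarrow> \<theta>'" and "\<forall>k. \<exists>x. x \<in> K \<and> P (\<theta> k) x" by auto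
  then obtain xs where xs: "\<And>k. xs k \<in> K" "\<And>k. P (\<theta> k) (xs k)" by metis
  obtain x \<rho> where x: "x \<in> K" "strict_mono (\<rho> :: nat \<Rightarrow> nat)" "(xs \<circ> \<rho>) \<longlonglongrightarrow> x"
    using K xs(1) unfolding compact_def by metis
  have "P \<theta>' x"
    by (rule P[OF LIMSEQ_subseq_LIMSEQ[OF lim x(2)] x(3)]) (auto simp: xs)
  then show "\<theta>' \<in> {\<theta>. \<exists>x\<in>K. P \<theta> x}" using x(1) by blast
qed

lemma tendsto_apply:
  fixes \<theta> :: "nat \<Rightarrow> 'i \<Rightarrow> 'b::topological_space"
  assumes "\<theta> \<longlonglongrightarrow> \<theta>'"
  shows "(\<lambda>k. \<theta> k i) \<longlonglongrightarrow> \<theta>' i"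
  using continuous_on_tendsto_compose[OF continuous_on_product_coordinates assms] by auto

lemma tendsto_row_weight: "\<theta> \<longlonglongrightarrow> \<theta>' \<Longrightarrow> (\<lambda>k. row_weight (\<theta> k) j) \<longlonglongrightarrow> row_weight \<theta>' j"
  unfolding row_weight_def by (intro tendsto_vec_lambda tendsto_apply[of \<theta> \<theta>'])

lemma tendsto_row_bias: "\<theta> \<longlonglongrightarrow> \<theta>' \<Longrightarrow> (\<lambda>k. row_bias n (\<theta> k) j) \<longlonglongrightarrow> row_bias n \<theta>' j"
  unfolding row_bias_def by (rule tendsto_apply)

text \<open>Strict inequalities become bounds by 1/(i+1) and points are confined to the ball of
  radius i. Each such condition is closed in the parameters, and their union over i is the
  event.\<close>

lemma borel_sign_region:
  assumes fin: "finite S" "finite T" "finite N"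
  shows "{\<theta>. sign_region (row_weight \<theta> :: nat \<Rightarrow> real^'n::finite) (row_bias CARD('n) \<theta>) S T N \<noteq> {}} \<in> sets borel"
proof -
  define l where "l \<theta> j x = row_weight \<theta> j \<bullet> x + row_bias CARD('n) \<theta> j" for \<theta> j and x :: "real^'n"
  define P where "P i \<theta> x \<longleftrightarrow> (\<forall>j\<in>S. l \<theta> j x = 0) \<and> (\<forall>j\<in>T. inverse (real (Suc i)) \<le> l \<theta> j x) \<and>
     (\<forall>j\<in>N. l \<theta> j x \<le> - inverse (real (Suc i)))" for i \<theta> x
  have "closed {\<theta>. \<exists>x\<in>cball 0 (real i). P i \<theta> x}" for i
  proof (rule closed_Bex_compact)
    fix \<theta> xs \<theta>' x assume lim: "\<theta> \<longlonglongrightarrow> \<theta>'" "xs \<longlonglongrightarrow> x" and P: "\<And>k. P i (\<theta> k) (xs k)"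
    have l: "(\<lambda>k. l (\<theta> k) j (xs k)) \<longlonglongrightarrow> l \<theta>' j x" for j
      unfolding l_def by (intro tendsto_intros tendsto_row_weight tendsto_row_bias lim)
    show "P i \<theta>' x"
      unfolding P_def
    proof (intro conjI ballI)
      show "l \<theta>' j x = 0" if "j \<in> S" for j
        using l[of j] P that unfolding P_def by (simp add: LIMSEQ_const_iff)
      show "inverse (real (Suc i)) \<le> l \<theta>' j x" if "j \<in> T" for j
        using P that unfolding P_def by (intro LIMSEQ_le_const[OF l]) auto
      show "l \<theta>' j x \<le> - inverse (real (Suc i))" if "j \<in> N" for j
        using P that unfolding P_def by (intro LIMSEQ_le_const2[OF l]) auto
    qed
  qed simp
  then have "(\<Union>i. {\<theta>. \<exists>x\<in>cball 0 (real i). P i \<theta> x}) \<in> sets borel"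
    by (intro sets.countable_UN) (auto intro: borel_closed)
  also have "(\<Union>i. {\<theta>. \<exists>x\<in>cball 0 (real i). P i \<theta> x}) =
      {\<theta>. sign_region (row_weight \<theta> :: nat \<Rightarrow> real^'n::finite) (row_bias CARD('n) \<theta>) S T N \<noteq> {}}"
  proof (intro equalityI subsetI)
    fix \<theta> assume "\<theta> \<in> (\<Union>i. {\<theta>. \<exists>x\<in>cball 0 (real i). P i \<theta> x})"
    then obtain i x where x: "P i \<theta> x" by blast
    have "0 < inverse (real (Suc i))" by simp
    then have "x \<in> sign_region (row_weight \<theta>) (row_bias CARD('n) \<theta>) S T N"
      using x unfolding P_def l_def sign_region_def
      by (smt (verit, best) mem_Collect_eq)
    then show "\<theta> \<in> {\<theta>. sign_region (row_weight \<theta> :: nat \<Rightarrow> real^'n::finite) (row_bias CARD('n) \<theta>) S T N \<noteq> {}}" by blast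
  next
    fix \<theta> assume "\<theta> \<in> {\<theta>. sign_region (row_weight \<theta> :: nat \<Rightarrow> real^'n::finite) (row_bias CARD('n) \<theta>) S T N \<noteq> {}}"
    then obtain x :: "real^'n" where x0: "x \<in> sign_region (row_weight \<theta>) (row_bias CARD('n) \<theta>) S T N" by blast
    have x: "\<And>j. j \<in> S \<Longrightarrow> l \<theta> j x = 0" "\<And>j. j \<in> T \<Longrightarrow> l \<theta> j x > 0" "\<And>j. j \<in> N \<Longrightarrow> - l \<theta> j x > 0"
      using x0 unfolding sign_region_def l_def neg_0_less_iff_less by blast+
    have small: "eventually (\<lambda>i. inverse (real (Suc i)) < c) sequentially" if "c > 0" for c
      using order_tendstoD(2)[OF LIMSEQ_inverse_real_of_nat that] .
    have "eventually (\<lambda>i. \<forall>j\<in>T. inverse (real (Suc i)) < l \<theta> j x) sequentially"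
      "eventually (\<lambda>i. \<forall>j\<in>N. inverse (real (Suc i)) < - l \<theta> j x) sequentially"
      by (intro eventually_ball_finite fin ballI small x; assumption)+
    moreover have "eventually (\<lambda>i. norm x \<le> real i) sequentially"
      using eventually_ge_at_top[of "nat \<lceil>norm x\<rceil>"] by eventually_elim linarith
    ultimately have "eventually (\<lambda>i. (\<forall>j\<in>T. inverse (real (Suc i)) < l \<theta> j x) \<and> (\<forall>j\<in>N. inverse (real (Suc i)) < - l \<theta> j x)
       \<and> norm x \<le> real i) sequentially" by eventually_elim auto
    then obtain i where i: "\<forall>j\<in>T. inverse (real (Suc i)) < l \<theta> j x" "\<forall>j\<in>N. inverse (real (Suc i)) < - l \<theta> j x" "norm x \<le> real i"
      using eventually_happens'[OF sequentially_bot] by blast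
    have "P i \<theta> x" unfolding P_def using i x(1) by (auto intro: less_imp_le simp: less_minus_iff)
    moreover have "x \<in> cball 0 (real i)" using i(3) by simp
    ultimately show "\<theta> \<in> (\<Union>i. {\<theta>. \<exists>x\<in>cball 0 (real i). P i \<theta> x})" by blast
  qed
  finally show ?thesis .
qed

text \<open>Limits of witnesses keep the normalisation to 1, which mere nonvanishing would not
  guarantee; the union over balls supplies compactness. The vector \<open>u\<close> may vary with
  the parameters, which covers rows, weighted sums of rows and fixed axes.\<close>

lemma borel_separated:
  fixes u :: "(nat \<times> nat \<times> nat \<Rightarrow> real) \<Rightarrow> real^'n::finite"
  assumes u: "\<And>\<theta> \<theta>'. \<theta> \<longlonglongrightarrow> \<theta>' \<Longrightarrow> (\<lambda>k. u (\<theta> k)) \<longlonglongrightarrow> u \<theta>'"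
  shows "{\<theta>. separated (row_weight \<theta>) S (u \<theta>)} \<in> sets borel"
proof -
  define P where "P \<theta> \<nu> \<longleftrightarrow> (\<forall>s\<in>S. row_weight \<theta> s \<bullet> \<nu> = 0) \<and> u \<theta> \<bullet> \<nu> = 1" for \<theta> \<nu>
  have "closed {\<theta>. \<exists>x\<in>cball 0 (real i). P \<theta> x}" for i
  proof (rule closed_Bex_compact)
    fix \<theta> xs \<theta>' x assume lim: "\<theta> \<longlonglongrightarrow> \<theta>'" "xs \<longlonglongrightarrow> x" and P: "\<And>k. P (\<theta> k) (xs k)"
    have w: "(\<lambda>k. row_weight (\<theta> k) s \<bullet> xs k) \<longlonglongrightarrow> row_weight \<theta>' s \<bullet> x" for s
      by (intro tendsto_intros tendsto_row_weight lim)
    have "row_weight \<theta>' s \<bullet> x = 0" if "s \<in> S" for s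
      using w[of s] P that unfolding P_def by (simp add: LIMSEQ_const_iff)
    moreover have "(\<lambda>k. u (\<theta> k) \<bullet> xs k) \<longlonglongrightarrow> u \<theta>' \<bullet> x" by (intro tendsto_intros u lim)
    then have "u \<theta>' \<bullet> x = 1" using P unfolding P_def by (simp add: LIMSEQ_const_iff)
    ultimately show "P \<theta>' x" unfolding P_def by blast
  qed simp
  then have "(\<Union>i. {\<theta>. \<exists>x\<in>cball 0 (real i). P \<theta> x}) \<in> sets borel"
    by (intro sets.countable_UN) (auto intro: borel_closed)
  also have "(\<Union>i. {\<theta>. \<exists>x\<in>cball 0 (real i). P \<theta> x}) = {\<theta>. separated (row_weight \<theta>) S (u \<theta>)}"
  proof (intro equalityI subsetI)
    fix \<theta> assume "\<theta> \<in> {\<theta>. separated (row_weight \<theta>) S (u \<theta>)}"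
    then obtain \<nu> where "P \<theta> \<nu>" unfolding separated_def P_def by blast
    moreover obtain i :: nat where "norm \<nu> \<le> real i" using real_arch_simple by blast
    then have "\<nu> \<in> cball 0 (real i)" by simp
    ultimately show "\<theta> \<in> (\<Union>i. {\<theta>. \<exists>x\<in>cball 0 (real i). P \<theta> x})" by blast
  qed (auto simp: separated_def P_def)
  finally show ?thesis .
qed

text \<open>The germ is jointly continuous in parameters and point, which is the continuous
  convergence that \<open>bounded_chart_limit\<close> asks for.\<close>

lemma borel_pl_good_local_net:
  "{\<theta>. pl_good (local_net (row_weight \<theta> :: nat \<Rightarrow> real^'n::finite) (\<lambda>j. \<theta> (1,0,j)) S T) 0} \<in> sets borel"
proof -
  define L where "L \<theta> = local_net (row_weight \<theta> :: nat \<Rightarrow> real^'n) (\<lambda>j. \<theta> (1,0,j)) S T" for \<theta>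
  have L_lim: "(\<lambda>k. L (\<theta> k) (ys k)) \<longlonglongrightarrow> L \<theta>' y" if "\<theta> \<longlonglongrightarrow> \<theta>'" "ys \<longlonglongrightarrow> y" for \<theta> \<theta>' ys y
    unfolding L_def local_net_def relu_def
    by (intro tendsto_intros tendsto_row_weight tendsto_max tendsto_apply[OF that(1)] that)
  have cl: "closed {\<theta>. bounded_chart N (real (Suc k)) (inverse (real (Suc j))) (L \<theta>) M}" for N k j M
    unfolding closed_sequential_limits
  proof (intro allI impI)
    fix \<theta> \<theta>' assume A: "(\<forall>i. \<theta> i \<in> {\<theta>. bounded_chart N (real (Suc k)) (inverse (real (Suc j))) (L \<theta>) M}) \<and> \<theta> \<longlonglongrightarrow> \<theta>'"
    have "bounded_chart N (real (Suc k)) (inverse (real (Suc j))) (L \<theta>') M"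
    proof (rule bounded_chart_limit[of _ _ N "\<lambda>i. L (\<theta> i)"])
      show "(\<lambda>i. L (\<theta> (\<rho> i)) (ys i)) \<longlonglongrightarrow> L \<theta>' y" if "strict_mono \<rho>" "ys \<longlonglongrightarrow> y" for \<rho> ys y
        using L_lim[OF LIMSEQ_subseq_LIMSEQ[OF conjunct2[OF A] that(1)] that(2)] by (simp add: comp_def)
    qed (use A in auto)
    then show "\<theta>' \<in> {\<theta>. bounded_chart N (real (Suc k)) (inverse (real (Suc j))) (L \<theta>) M}" by simp
  qed
  have "{\<theta>. has_chart (L \<theta>) 0 M} \<in> sets borel" for M
  proof -
    have "{\<theta>. has_chart (L \<theta>) 0 M} = (\<Union>k N j. {\<theta>. bounded_chart N (real (Suc k)) (inverse (real (Suc j))) (L \<theta>) M})"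
      unfolding has_chart_iff_bounded_chart by (auto simp: L_def local_net_0)
    then show ?thesis by (simp only:) (intro sets.countable_UN image_subsetI borel_closed cl)
  qed
  moreover have "{\<theta>. pl_good (L \<theta>) 0} =
      (\<Union>M\<in>insert (\<lambda>x. x $ coord_enum (CARD('n) - 1)) (morse_model ` {..CARD('n)}). {\<theta>. has_chart (L \<theta>) 0 M})"
    unfolding pl_good_iff by blast
  ultimately show ?thesis unfolding L_def[symmetric] by (auto intro!: sets.finite_UN)
qed

lemma borel_pl_morse_single:
  "{\<theta>. pl_morse (relu_net [m] \<theta> :: real^'n::finite \<Rightarrow> real)} \<in> sets borel"
proof -
  define R where "R S T = {\<theta>. sign_region (row_weight \<theta> :: nat \<Rightarrow> real^'n) (row_bias CARD('n) \<theta>) S T ({..<m} - S - T) \<noteq> {}}" for S T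
  define Gd where "Gd S T = {\<theta>. pl_good (local_net (row_weight \<theta> :: nat \<Rightarrow> real^'n) (\<lambda>j. \<theta> (1,0,j)) S T) 0}" for S T
  define I where "I = {(S,T). S \<subseteq> {..<m} \<and> T \<subseteq> {..<m} \<and> S \<inter> T = {}}"
  have "finite I" by (rule finite_subset[of _ "Pow {..<m} \<times> Pow {..<m}"]) (auto simp: I_def)
  have meas: "R S T - Gd S T \<in> sets borel" if "(S,T) \<in> I" for S T
  proof -
    have "finite S" "finite T" using that unfolding I_def by (auto intro: finite_subset)
    then show ?thesis unfolding R_def Gd_def by (intro sets.Diff borel_sign_region borel_pl_good_local_net) auto
  qed
  have "(\<Union>q\<in>I. R (fst q) (snd q) - Gd (fst q) (snd q)) \<in> sets borel"
    using \<open>finite I\<close> meas by (intro sets.finite_UN) auto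
  then have "space borel - (\<Union>q\<in>I. R (fst q) (snd q) - Gd (fst q) (snd q)) \<in> sets borel" by (rule sets.compl_sets)
  also have "space borel - (\<Union>q\<in>I. R (fst q) (snd q) - Gd (fst q) (snd q)) = {\<theta>. pl_morse (relu_net [m] \<theta> :: real^'n \<Rightarrow> real)}"
  proof -
    have "pl_morse (relu_net [m] \<theta> :: real^'n \<Rightarrow> real) \<longleftrightarrow> (\<forall>S T. (S,T) \<in> I \<longrightarrow> \<theta> \<in> R S T \<longrightarrow> \<theta> \<in> Gd S T)" for \<theta>
      unfolding pl_morse_single_iff R_def Gd_def I_def by (simp only: mem_Collect_eq case_prod_conv imp_conjL)
    then show ?thesis by auto
  qed
  finally show ?thesis .
qed

section \<open>Random parameters\<close>

lemma finite_net_params: "finite (net_params n ws)"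
proof (rule finite_subset)
  show "net_params n ws \<subseteq> (\<Union>i\<le>length ws. {i} \<times> {..<net_dims n ws ! (i + 1)} \<times> {..net_dims n ws ! i})"
    unfolding net_params_def by auto
qed auto

text \<open>Points of the product space equal \<open>undefined\<close> off \<open>I\<close>, whereas
  the Borel events live on all functions. The extra coordinates are constant, hence
  measurable.\<close>

lemma measurable_PiM_borel:
  fixes I :: "'i::countable set" and \<mu> :: "real measure"
  assumes "sets \<mu> = sets borel"
  shows "(\<lambda>\<theta>. \<theta>) \<in> PiM I (\<lambda>_. \<mu>) \<rightarrow>\<^sub>M borel"
proof -
  have "(\<lambda>\<theta> i. \<theta> i) \<in> PiM I (\<lambda>_. \<mu>) \<rightarrow>\<^sub>M PiM UNIV (\<lambda>_. borel)"
  proof (rule measurable_PiM_single')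
    fix i :: 'i
    show "(\<lambda>\<theta>. \<theta> i) \<in> PiM I (\<lambda>_. \<mu>) \<rightarrow>\<^sub>M borel"
    proof (cases "i \<in> I")
      case True
      have "(\<lambda>\<theta>. \<theta> i) \<in> PiM I (\<lambda>_. \<mu>) \<rightarrow>\<^sub>M \<mu>" using True by (rule measurable_component_singleton)
      then show ?thesis using measurable_cong_sets[OF refl assms] by blast
    next
      case False
      have "\<theta> i = undefined" if "\<theta> \<in> space (PiM I (\<lambda>_. \<mu>))" for \<theta>
        using that False unfolding space_PiM by (rule PiE_arb)
      then have "(\<lambda>\<theta>. \<theta> i) \<in> PiM I (\<lambda>_. \<mu>) \<rightarrow>\<^sub>M borel \<longleftrightarrow> (\<lambda>\<theta>. undefined) \<in> PiM I (\<lambda>_. \<mu>) \<rightarrow>\<^sub>M (borel :: real measure)"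
        by (rule measurable_cong)
      then show ?thesis by simp
    qed
  qed auto
  then show ?thesis using measurable_cong_sets[OF refl sets_PiM_equal_borel] by blast
qed

lemma sets_PiM_Collect_borel:
  fixes I :: "'i::countable set" and \<mu> :: "real measure"
  assumes "sets \<mu> = sets borel" "Collect P \<in> sets borel"
  shows "{\<theta> \<in> space (PiM I (\<lambda>_. \<mu>)). P \<theta>} \<in> sets (PiM I (\<lambda>_. \<mu>))"
proof -
  have "(\<lambda>\<theta>. \<theta>) -` Collect P \<inter> space (PiM I (\<lambda>_. \<mu>)) \<in> sets (PiM I (\<lambda>_. \<mu>))"
    by (rule measurable_sets[OF measurable_PiM_borel[OF assms(1)] assms(2)])
  also have "(\<lambda>\<theta>. \<theta>) -` Collect P \<inter> space (PiM I (\<lambda>_. \<mu>)) = {\<theta> \<in> space (PiM I (\<lambda>_. \<mu>)). P \<theta>}" by auto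
  finally show ?thesis .
qed

text \<open>Fubini in the coordinate \<open>i\<close>: every line in that direction meets the event
  in at most one point, and \<open>\<mu>\<close> has no atoms. This is how absolute continuity
  enters the genericity arguments.\<close>

lemma AE_PiM_singleton_sections:
  fixes \<mu> :: "'b measure"
  assumes \<mu>: "prob_space \<mu>" "\<And>x. emeasure \<mu> {x} = 0" "\<And>x. {x} \<in> sets \<mu>" and I: "finite I" "i \<in> I"
    and B: "{\<theta> \<in> space (PiM I (\<lambda>_. \<mu>)). P \<theta>} \<in> sets (PiM I (\<lambda>_. \<mu>))"
    and sec: "\<And>\<theta> x. P \<theta> \<Longrightarrow> P (\<theta>(i := x)) \<Longrightarrow> x = \<theta> i"
  shows "AE \<theta> in PiM I (\<lambda>_. \<mu>). \<not> P \<theta>"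
proof -
  define J where "J = I - {i}"
  have J: "finite J" "i \<notin> J" "I = insert i J" using I unfolding J_def by auto
  interpret prob_space \<mu> by fact
  interpret product_sigma_finite "\<lambda>_. \<mu>" by standard
  define B where "B = {\<theta> \<in> space (PiM I (\<lambda>_. \<mu>)). P \<theta>}"
  have Bm: "B \<in> sets (PiM (insert i J) (\<lambda>_. \<mu>))" using B unfolding B_def J(3) .
  have "emeasure (PiM (insert i J) (\<lambda>_. \<mu>)) B = (\<integral>\<^sup>+ \<theta>. indicator B \<theta> \<partial>PiM (insert i J) (\<lambda>_. \<mu>))"
    using Bm by simp
  also have "\<dots> = (\<integral>\<^sup>+ \<theta>. (\<integral>\<^sup>+ x. indicator B (\<theta>(i := x)) \<partial>\<mu>) \<partial>PiM J (\<lambda>_. \<mu>))"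
    by (rule product_nn_integral_insert[OF J(1,2)]) (use Bm in simp)
  also have "\<dots> = (\<integral>\<^sup>+ \<theta>. 0 \<partial>PiM J (\<lambda>_. \<mu>))"
  proof (intro nn_integral_cong)
    fix \<theta>
    have "AE x in \<mu>. indicator B (\<theta>(i := x)) = (0::ennreal)"
    proof (cases "\<exists>y. \<theta>(i := y) \<in> B")
      case True
      then obtain y where y: "\<theta>(i := y) \<in> B" by blast
      have "x = y" if "\<theta>(i := x) \<in> B" for x
        using sec[of "\<theta>(i := y)" x] y that unfolding B_def by simp
      then show ?thesis
        using \<mu>(2,3) by (intro AE_I'[of "{y}"]) (auto simp: null_sets_def indicator_def)
    next
      case False
      then show ?thesis by (simp add: indicator_def)
    qed
    then have "(\<integral>\<^sup>+ x. indicator B (\<theta>(i := x)) \<partial>\<mu>) = (\<integral>\<^sup>+ x. 0 \<partial>\<mu>)" by (rule nn_integral_cong_AE)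
    then show "(\<integral>\<^sup>+ x. indicator B (\<theta>(i := x)) \<partial>\<mu>) = 0" by simp
  qed
  finally have "B \<in> null_sets (PiM I (\<lambda>_. \<mu>))" using Bm unfolding J(3) by (simp add: null_sets_def)
  then show ?thesis by (rule AE_I') (auto simp: B_def)
qed

lemma distr_PiM_componentwise:
  assumes \<mu>: "prob_space \<mu>" and I: "finite I"
    and f: "\<And>i. i \<in> I \<Longrightarrow> f i \<in> \<mu> \<rightarrow>\<^sub>M \<mu>" "\<And>i. i \<in> I \<Longrightarrow> distr \<mu> \<mu> (f i) = \<mu>"
  shows "(\<lambda>\<theta>. \<lambda>i\<in>I. f i (\<theta> i)) \<in> PiM I (\<lambda>_. \<mu>) \<rightarrow>\<^sub>M PiM I (\<lambda>_. \<mu>)"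
    and "distr (PiM I (\<lambda>_. \<mu>)) (PiM I (\<lambda>_. \<mu>)) (\<lambda>\<theta>. \<lambda>i\<in>I. f i (\<theta> i)) = PiM I (\<lambda>_. \<mu>)"
proof -
  interpret prob_space \<mu> by fact
  interpret product_sigma_finite "\<lambda>_. \<mu>" by standard
  show meas: "(\<lambda>\<theta>. \<lambda>i\<in>I. f i (\<theta> i)) \<in> PiM I (\<lambda>_. \<mu>) \<rightarrow>\<^sub>M PiM I (\<lambda>_. \<mu>)"
  proof (rule measurable_restrict)
    fix i assume i: "i \<in> I"
    have "(\<lambda>\<theta>. \<theta> i) \<in> PiM I (\<lambda>_. \<mu>) \<rightarrow>\<^sub>M \<mu>" using i by (rule measurable_component_singleton)
    then show "(\<lambda>\<theta>. f i (\<theta> i)) \<in> PiM I (\<lambda>_. \<mu>) \<rightarrow>\<^sub>M \<mu>" using f(1)[OF i] by (rule measurable_compose)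
  qed
  show "distr (PiM I (\<lambda>_. \<mu>)) (PiM I (\<lambda>_. \<mu>)) (\<lambda>\<theta>. \<lambda>i\<in>I. f i (\<theta> i)) = PiM I (\<lambda>_. \<mu>)"
  proof (rule PiM_eqI[OF I])
    fix A assume A: "\<And>i. i \<in> I \<Longrightarrow> A i \<in> sets \<mu>"
    have "emeasure (distr (PiM I (\<lambda>_. \<mu>)) (PiM I (\<lambda>_. \<mu>)) (\<lambda>\<theta>. \<lambda>i\<in>I. f i (\<theta> i))) (PiE I A)
       = emeasure (PiM I (\<lambda>_. \<mu>)) ((\<lambda>\<theta>. \<lambda>i\<in>I. f i (\<theta> i)) -` PiE I A \<inter> space (PiM I (\<lambda>_. \<mu>)))"
      using A I by (intro emeasure_distr meas sets_PiM_I_finite) auto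
    also have "(\<lambda>\<theta>. \<lambda>i\<in>I. f i (\<theta> i)) -` PiE I A \<inter> space (PiM I (\<lambda>_. \<mu>)) = PiE I (\<lambda>i. f i -` A i \<inter> space \<mu>)"
      by (auto simp: space_PiM PiE_iff extensional_def)
    also have "emeasure (PiM I (\<lambda>_. \<mu>)) \<dots> = (\<Prod>i\<in>I. emeasure \<mu> (f i -` A i \<inter> space \<mu>))"
      using A f(1) I by (intro emeasure_PiM measurable_sets) auto
    also have "\<dots> = (\<Prod>i\<in>I. emeasure \<mu> (A i))"
    proof (intro prod.cong refl)
      fix i assume i: "i \<in> I"
      have "emeasure \<mu> (f i -` A i \<inter> space \<mu>) = emeasure (distr \<mu> \<mu> (f i)) (A i)"
        using emeasure_distr[OF f(1)[OF i] A[OF i]] by simp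
      then show "emeasure \<mu> (f i -` A i \<inter> space \<mu>) = emeasure \<mu> (A i)" using f(2)[OF i] by simp
    qed
    finally show "emeasure (distr (PiM I (\<lambda>_. \<mu>)) (PiM I (\<lambda>_. \<mu>)) (\<lambda>\<theta>. \<lambda>i\<in>I. f i (\<theta> i))) (PiE I A) = (\<Prod>i\<in>I. emeasure \<mu> (A i))" .
  qed simp
qed

lemma admissible_distributionD:
  assumes "admissible_distribution \<mu>"
  shows "prob_space \<mu>" "sets \<mu> = sets borel" "emeasure \<mu> {x} = 0" "uminus \<in> \<mu> \<rightarrow>\<^sub>M \<mu>" "distr \<mu> \<mu> uminus = \<mu>"
proof -
  show "prob_space \<mu>" and s: "sets \<mu> = sets borel" using assms unfolding admissible_distribution_def by auto
  have ac: "absolutely_continuous lborel \<mu>" using assms unfolding admissible_distribution_def by blast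
  have "{x} \<in> null_sets lborel" by (simp add: null_sets_def)
  then have "{x} \<in> null_sets \<mu>" using ac unfolding absolutely_continuous_def by blast
  then show "emeasure \<mu> {x} = 0" by auto
  show "uminus \<in> \<mu> \<rightarrow>\<^sub>M \<mu>" using measurable_cong_sets[OF s s] borel_measurable_uminus[of "\<lambda>x. x" borel] by simp
  have "distr \<mu> \<mu> uminus = distr \<mu> borel uminus" using s by (intro distr_cong) auto
  then show "distr \<mu> \<mu> uminus = \<mu>" using assms unfolding admissible_distribution_def by simp
qed

section \<open>Almost sure genericity\<close>

text \<open>Provides the matrix entry to vary in \<open>AE_separated\<close>. A nonzero vector
  orthogonal to the proper subspace spanned by the rows has some nonzero component, and the axis of
  that component is outside the span.\<close>

lemma exists_separated_axis:
  fixes w :: "nat \<Rightarrow> real^'n::finite"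
  assumes "finite S" "card S < CARD('n)"
  obtains i where "separated w S (axis i 1)"
proof -
  have "dim (span (w ` S)) \<le> card (w ` S)" using assms(1) by (simp add: dim_le_card')
  also have "\<dots> < DIM(real^'n)" using card_image_le[OF assms(1), of w] assms(2) by simp
  finally obtain x where x: "x \<noteq> 0" "\<And>y. y \<in> span (w ` S) \<Longrightarrow> orthogonal x y"
    using orthogonal_to_subspace_exists by (metis dim_span)
  obtain i where i: "x $ i \<noteq> 0" using x(1) by (auto simp: vec_eq_iff)
  have "w s \<bullet> ((1 / x $ i) *\<^sub>R x) = 0" if "s \<in> S" for s
    using x(2)[of "w s"] that by (auto simp: orthogonal_def inner_commute span_base)
  moreover have "axis i 1 \<bullet> ((1 / x $ i) *\<^sub>R x) = 1" using i by (simp add: inner_axis')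
  ultimately show thesis using that unfolding separated_def by blast
qed

lemma row_weight_upd:
  assumes "k < CARD('n::finite)"
  shows "row_weight (\<theta>((0,t,k) := x)) j =
    (row_weight \<theta> j + (if j = t then (x - \<theta> (0,t,k)) *\<^sub>R axis (coord_enum k) 1 else 0) :: real^'n)"
proof -
  have inv: "inv_into {..<CARD('n)} coord_enum i = k \<longleftrightarrow> i = coord_enum k" for i :: 'n
    using bij_betw_inv_into_left[OF bij_coord_enum[where 'n='n], of k]
      bij_betw_inv_into_right[OF bij_coord_enum[where 'n='n], of i] assms by auto
  have inv_k: "inv_into {..<CARD('n)} coord_enum (coord_enum k :: 'n) = k" using inv by blast
  show ?thesis
    by (auto simp: vec_eq_iff row_weight_def axis_def inv inv_k)
qed

lemma row_weight_upd_bias: "row_weight (\<theta>((0,t,CARD('n)) := x)) = (row_weight \<theta> :: nat \<Rightarrow> real^'n::finite)"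
proof -
  have "inv_into {..<CARD('n)} coord_enum i < CARD('n)" for i :: 'n
    using bij_betw_inv_into[OF bij_coord_enum[where 'n='n]] unfolding bij_betw_def by auto
  then show ?thesis by (auto simp: vec_eq_iff row_weight_def fun_eq_iff order_less_irrefl) (metis order_less_irrefl)+
qed

lemma separated_iff_not_orthogonal:
  "separated w S u \<longleftrightarrow> (\<exists>\<nu>. (\<forall>s\<in>S. w s \<bullet> \<nu> = 0) \<and> u \<bullet> \<nu> \<noteq> 0)"
proof
  assume "\<exists>\<nu>. (\<forall>s\<in>S. w s \<bullet> \<nu> = 0) \<and> u \<bullet> \<nu> \<noteq> 0"
  then obtain \<nu> where "\<forall>s\<in>S. w s \<bullet> \<nu> = 0" "u \<bullet> \<nu> \<noteq> 0" by blast
  then show "separated w S u" unfolding separated_def by (intro exI[of _ "(1 / (u \<bullet> \<nu>)) *\<^sub>R \<nu>"]) auto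
qed (auto simp: separated_def)

lemma net_params_first:
  "ws \<noteq> [] \<Longrightarrow> (0,j,k) \<in> net_params n ws \<longleftrightarrow> j < hd ws \<and> k \<le> n"
  unfolding net_params_def net_dims_def by (cases ws) auto

lemma net_params_second:
  assumes "ws \<noteq> []" "\<forall>w\<in>set ws. w > 0" "j < hd ws"
  shows "(1,0,j) \<in> net_params n ws"
proof -
  obtain m us where ws: "ws = m # us" using assms(1) by (cases ws) auto
  have "(us @ [1]) ! 0 > 0" using assms(2) ws by (cases us) auto
  then show ?thesis using assms(3) unfolding net_params_def net_dims_def ws by auto
qed

context
  fixes ws :: "nat list" and \<mu> :: "real measure"
  assumes ws: "ws \<noteq> []" "\<forall>w\<in>set ws. w > 0" and adm: "admissible_distribution \<mu>"
begin

lemma prob_space_param: "prob_space (param_measure n ws \<mu>)"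
  unfolding param_measure_def using admissible_distributionD(1)[OF adm] by (intro prob_space_PiM)

lemma AE_param_singleton_sections:
  assumes "i \<in> net_params n ws" "Collect P \<in> sets borel" "\<And>\<theta> x. P \<theta> \<Longrightarrow> P (\<theta>(i := x)) \<Longrightarrow> x = \<theta> i"
  shows "AE \<theta> in param_measure n ws \<mu>. \<not> P \<theta>"
  unfolding param_measure_def
proof (rule AE_PiM_singleton_sections[OF _ _ _ finite_net_params assms(1)])
  show "prob_space \<mu>" "\<And>x. emeasure \<mu> {x} = 0" using admissible_distributionD[OF adm] by auto
  show "\<And>x. {x} \<in> sets \<mu>" using admissible_distributionD(2)[OF adm] by simp
  show "{\<theta> \<in> space (PiM (net_params n ws) (\<lambda>_. \<mu>)). P \<theta>} \<in> sets (PiM (net_params n ws) (\<lambda>_. \<mu>))"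
    by (rule sets_PiM_Collect_borel[OF admissible_distributionD(2)[OF adm] assms(2)])
qed fact

text \<open>For \<open>t\<close> in \<open>T\<close>, the rows of \<open>S\<close> do not depend on
  row \<open>t\<close>, while changing one entry of that row moves the weighted sum along an axis at
  speed \<open>\<theta> (1,0,t)\<close>. If the axis is outside the span of the rows in
  \<open>S\<close> and the speed is nonzero, at most one value of the entry puts the sum into the
  span.\<close>

lemma AE_separated:
  fixes S T :: "nat set"
  assumes S: "S \<subseteq> {..<hd ws}" "card S < CARD('n::finite)" and T: "T \<subseteq> {..<hd ws}" "T \<noteq> {}" "S \<inter> T = {}"
  shows "AE \<theta> in param_measure CARD('n) ws \<mu>.
     separated (row_weight \<theta> :: nat \<Rightarrow> real^'n) S (\<Sum>j\<in>T. \<theta> (1,0,j) *\<^sub>R row_weight \<theta> j)"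
proof -
  obtain t where t: "t \<in> T" "t \<notin> S" "t < hd ws" using T by blast
  have fin: "finite S" "finite T" using finite_subset[OF S(1)] finite_subset[OF T(1)] by auto
  define u where "u \<theta> = (\<Sum>j\<in>T. \<theta> (1,0,j) *\<^sub>R row_weight \<theta> j :: real^'n)" for \<theta>
  have u_borel: "{\<theta>. separated (row_weight \<theta>) S (u \<theta>)} \<in> sets borel"
  proof (rule borel_separated)
    fix \<theta>' :: "nat \<times> nat \<times> nat \<Rightarrow> real" and \<theta>s assume lim: "\<theta>s \<longlonglongrightarrow> \<theta>'"
    show "(\<lambda>k. u (\<theta>s k)) \<longlonglongrightarrow> u \<theta>'"
      unfolding u_def by (intro tendsto_intros tendsto_row_weight tendsto_apply[OF lim] lim)
  qed
  have ax_borel: "{\<theta>. separated (row_weight \<theta>) S (axis i 1 :: real^'n)} \<in> sets borel" for i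
    by (rule borel_separated) (rule tendsto_const)
  have zero_borel: "{\<theta> :: nat \<times> nat \<times> nat \<Rightarrow> real. \<theta> (1,0,t) = 0} \<in> sets borel"
    by (intro borel_closed closed_Collect_eq continuous_on_product_coordinates continuous_on_const)
  have nz: "AE \<theta> in param_measure CARD('n) ws \<mu>. \<not> \<theta> (1,0,t) = 0"
    by (rule AE_param_singleton_sections[OF net_params_second[OF ws t(3)] zero_borel]) simp
  \<comment> \<open>Which axis is usable depends on the parameters, so the bad event is split by
    \<open>k\<close>; the conditions on axis and speed are part of each piece, so that its sections
    have at most one point.\<close>
  define B where "B k \<theta> \<longleftrightarrow> \<theta> (1,0,t) \<noteq> 0 \<and> \<not> separated (row_weight \<theta>) S (u \<theta>) \<and>
     separated (row_weight \<theta>) S (axis (coord_enum k) 1 :: real^'n)" for k \<theta>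
  have "AE \<theta> in param_measure CARD('n) ws \<mu>. \<not> B k \<theta>" if k: "k < CARD('n)" for k
  proof (rule AE_param_singleton_sections)
    show "(0,t,k) \<in> net_params CARD('n) ws" using net_params_first[OF ws(1)] t(3) k by simp
    have "Collect (B k) = (- {\<theta>. \<theta> (1,0,t) = 0} - {\<theta>. separated (row_weight \<theta>) S (u \<theta>)})
        \<inter> {\<theta>. separated (row_weight \<theta>) S (axis (coord_enum k) 1 :: real^'n)}"
      unfolding B_def by auto
    also have "\<dots> \<in> sets borel"
      using zero_borel u_borel ax_borel by (intro sets.Int sets.Diff) (auto simp: borel_comp)
    finally show "Collect (B k) \<in> sets borel" .
    fix \<theta> x assume 1: "B k \<theta>" and 2: "B k (\<theta>((0,t,k) := x))"
    define \<theta>' where "\<theta>' = \<theta>((0,t,k) := x)"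
    have w': "row_weight \<theta>' j = row_weight \<theta> j + (if j = t then (x - \<theta> (0,t,k)) *\<^sub>R axis (coord_enum k) 1 else 0 :: real^'n)" for j
      unfolding \<theta>'_def by (rule row_weight_upd[OF k])
    have v': "\<theta>' (1,0,j) = \<theta> (1,0,j)" for j unfolding \<theta>'_def by simp
    have u': "u \<theta>' = u \<theta> + (\<theta> (1,0,t) * (x - \<theta> (0,t,k))) *\<^sub>R axis (coord_enum k) 1"
    proof -
      have "u \<theta>' = u \<theta> + (\<Sum>j\<in>T. if j = t then (\<theta> (1,0,t) * (x - \<theta> (0,t,k))) *\<^sub>R axis (coord_enum k) 1 else 0)"
        unfolding u_def sum.distrib[symmetric] w' v'
        by (intro sum.cong refl) (auto simp: scaleR_add_right)
      then show ?thesis using fin t by simp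
    qed
    \<comment> \<open>The same functional serves both parameter values because the rows of
      \<open>S\<close> agree. Failure of separation makes it vanish on both sums, whose difference
      is a multiple of the axis.\<close>
    obtain \<nu> where \<nu>: "\<And>s. s \<in> S \<Longrightarrow> row_weight \<theta> s \<bullet> \<nu> = 0" "(axis (coord_enum k) 1 :: real^'n) \<bullet> \<nu> = 1"
      using 1 unfolding B_def separated_def by blast
    have "\<And>s. s \<in> S \<Longrightarrow> row_weight \<theta>' s \<bullet> \<nu> = 0" using \<nu>(1) t(2) w' by auto
    then have "u \<theta>' \<bullet> \<nu> = 0" using 2 unfolding B_def \<theta>'_def[symmetric] separated_iff_not_orthogonal by blast
    moreover have "u \<theta> \<bullet> \<nu> = 0" using 1 \<nu>(1) unfolding B_def separated_iff_not_orthogonal by blast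
    ultimately have "\<theta> (1,0,t) * (x - \<theta> (0,t,k)) = 0" unfolding u' using \<nu>(2) by (simp add: inner_add_left)
    then show "x = \<theta> (0,t,k)" using 1 unfolding B_def by simp
  qed
  then have "AE \<theta> in param_measure CARD('n) ws \<mu>. \<forall>k\<in>{..<CARD('n)}. \<not> B k \<theta>"
    by (intro AE_finite_allI) auto
  then show ?thesis
    using nz
  proof eventually_elim
    case (elim \<theta>)
    obtain i :: 'n where i: "separated (row_weight \<theta>) S (axis i 1)" using exists_separated_axis[OF fin(1) S(2)] by blast
    obtain k where "k < CARD('n)" "i = coord_enum k" using bij_coord_enum[where 'n='n] unfolding bij_betw_def
      by (metis UNIV_I imageE lessThan_iff)
    then show ?case using elim i unfolding B_def u_def by blast
  qed
qed

text \<open>All but one of the hyperplanes have independent normals and meet in at most one point.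
  Fixing that point determines the remaining bias, which is the coordinate to vary.\<close>

lemma AE_no_common_zero:
  assumes S: "S \<subseteq> {..<hd ws}" "card S = Suc CARD('n::finite)"
  shows "AE \<theta> in param_measure CARD('n) ws \<mu>.
     sign_region (row_weight \<theta> :: nat \<Rightarrow> real^'n) (row_bias CARD('n) \<theta>) S {} {} = {}"
proof -
  have finS: "finite S" using finite_subset[OF S(1)] by auto
  obtain t where t: "t \<in> S" using S(2) by fastforce
  define S' where "S' = S - {t}"
  have S': "finite S'" "card S' = CARD('n)" "t \<notin> S'" "S = insert t S'" "S' \<subseteq> {..<hd ws}"
    using finS S t unfolding S'_def by auto
  have "AE \<theta> in param_measure CARD('n) ws \<mu>. \<forall>s\<in>S'. separated (row_weight \<theta> :: nat \<Rightarrow> real^'n) (S' - {s}) (\<Sum>j\<in>{s}. \<theta> (1,0,j) *\<^sub>R row_weight \<theta> j)"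
  proof (intro AE_finite_allI S'(1) AE_separated)
    show "card (S' - {s}) < CARD('n)" if "s \<in> S'" for s using S' that by (metis card_Diff1_less)
  qed (use S'(5) in auto)
  then have sep: "AE \<theta> in param_measure CARD('n) ws \<mu>. \<forall>s\<in>S'. separated (row_weight \<theta> :: nat \<Rightarrow> real^'n) (S' - {s}) (row_weight \<theta> s)"
  proof eventually_elim
    case (elim \<theta>)
    then show ?case unfolding separated_iff_not_orthogonal by fastforce
  qed
  define B where "B \<theta> \<longleftrightarrow> (\<forall>s\<in>S'. separated (row_weight \<theta> :: nat \<Rightarrow> real^'n) (S' - {s}) (row_weight \<theta> s)) \<and>
     sign_region (row_weight \<theta> :: nat \<Rightarrow> real^'n) (row_bias CARD('n) \<theta>) S {} {} \<noteq> {}" for \<theta>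
  have "AE \<theta> in param_measure CARD('n) ws \<mu>. \<not> B \<theta>"
  proof (rule AE_param_singleton_sections)
    show "(0,t,CARD('n)) \<in> net_params CARD('n) ws" using net_params_first[OF ws(1)] t S by auto
    have "Collect B = UNIV \<inter> (\<Inter>s\<in>S'. {\<theta>. separated (row_weight \<theta> :: nat \<Rightarrow> real^'n) (S' - {s}) (row_weight \<theta> s)})
        \<inter> {\<theta>. sign_region (row_weight \<theta> :: nat \<Rightarrow> real^'n) (row_bias CARD('n) \<theta>) S {} {} \<noteq> {}}"
      unfolding B_def by auto
    also have "\<dots> \<in> sets borel"
    proof -
      have "S' \<noteq> {}" using S'(2) by auto
      then have "(\<Inter>s\<in>S'. {\<theta>. separated (row_weight \<theta> :: nat \<Rightarrow> real^'n) (S' - {s}) (row_weight \<theta> s)}) \<in> sets borel"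
        using S'(1) by (intro sets.finite_INT borel_separated tendsto_row_weight) auto
      then show ?thesis using borel_sign_region[OF finS, of "{}" "{}"] by auto
    qed
    finally show "Collect B \<in> sets borel" .
    fix \<theta> x assume 1: "B \<theta>" and 2: "B (\<theta>((0,t,CARD('n)) := x))"
    define w where "w = (row_weight \<theta> :: nat \<Rightarrow> real^'n)"
    obtain p where p: "\<And>s. s \<in> S \<Longrightarrow> w s \<bullet> p + row_bias CARD('n) \<theta> s = 0"
      using 1 unfolding B_def sign_region_def w_def by auto
    obtain q where q: "\<And>s. s \<in> S \<Longrightarrow> w s \<bullet> q + row_bias CARD('n) (\<theta>((0,t,CARD('n)) := x)) s = 0"
      using 2 unfolding B_def sign_region_def w_def row_weight_upd_bias by auto
    have "w s \<bullet> (p - q) = 0" if "s \<in> S'" for s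
    proof -
      have "row_bias CARD('n) (\<theta>((0,t,CARD('n)) := x)) s = row_bias CARD('n) \<theta> s"
        using that S'(3) unfolding row_bias_def by auto
      then show ?thesis using p[of s] q[of s] that S'(4) by (simp add: inner_diff_right)
    qed
    then have "(\<Sum>s\<in>S'. (w s \<bullet> (p - q)) *\<^sub>R \<nu> s) = 0" for \<nu> :: "nat \<Rightarrow> real^'n" by simp
    moreover have "separated w (S' - {s}) (w s)" if "s \<in> S'" for s using 1 that unfolding B_def w_def by blast
    then obtain \<nu> where "\<And>y. (\<Sum>s\<in>S'. (w s \<bullet> y) *\<^sub>R \<nu> s) = y"
      using dual_family[OF S'(1,2), of w] by metis
    ultimately have "p - q = 0" by metis
    then show "x = \<theta> (0,t,CARD('n))" using p[OF t] q[OF t] unfolding row_bias_def by simp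
  qed
  then show ?thesis using sep by eventually_elim (auto simp: B_def)
qed

lemma AE_generic_net: "AE \<theta> in param_measure CARD('n::finite) ws \<mu>. generic_net TYPE('n) (hd ws) \<theta>"
proof -
  define I where "I = {(S,T). S \<subseteq> {..<hd ws} \<and> T \<subseteq> {..<hd ws} \<and> S \<inter> T = {} \<and> T \<noteq> {} \<and> card S < CARD('n)}"
  have "finite I" by (rule finite_subset[of _ "Pow {..<hd ws} \<times> Pow {..<hd ws}"]) (auto simp: I_def)
  then have "AE \<theta> in param_measure CARD('n) ws \<mu>. \<forall>q\<in>I. separated (row_weight \<theta> :: nat \<Rightarrow> real^'n) (fst q)
     (\<Sum>j\<in>snd q. \<theta> (1,0,j) *\<^sub>R row_weight \<theta> j)"
    by (intro AE_finite_allI AE_separated) (auto simp: I_def)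
  moreover have "AE \<theta> in param_measure CARD('n) ws \<mu>. \<forall>S\<in>{S. S \<subseteq> {..<hd ws} \<and> card S = Suc CARD('n)}.
     sign_region (row_weight \<theta> :: nat \<Rightarrow> real^'n) (row_bias CARD('n) \<theta>) S {} {} = {}"
    by (intro AE_finite_allI AE_no_common_zero) auto
  ultimately show ?thesis
    by eventually_elim (auto simp: generic_net_def I_def)
qed

section \<open>The probability of a dead region\<close>

lemma sets_sign_region:
  assumes "finite S" "finite T" "finite N"
  shows "{\<theta> \<in> space (param_measure CARD('n) ws \<mu>).
     sign_region (row_weight \<theta> :: nat \<Rightarrow> real^'n::finite) (row_bias CARD('n) \<theta>) S T N \<noteq> {}} \<in> sets (param_measure CARD('n) ws \<mu>)"
  unfolding param_measure_def
  by (rule sets_PiM_Collect_borel[OF admissible_distributionD(2)[OF adm] borel_sign_region[OF assms]])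

text \<open>Negating the incoming weights and the bias of the neurons in \<open>T\<close> exchanges
  their two sides. It acts coordinatewise by maps preserving \<open>\<mu>\<close>, hence preserves
  the product measure.\<close>

lemma measure_sign_region_flip:
  assumes T: "T \<subseteq> {..<hd ws}"
  shows "measure (param_measure CARD('n) ws \<mu>) {\<theta> \<in> space (param_measure CARD('n) ws \<mu>).
     sign_region (row_weight \<theta> :: nat \<Rightarrow> real^'n::finite) (row_bias CARD('n) \<theta>) {} T ({..<hd ws} - T) \<noteq> {}}
   = measure (param_measure CARD('n) ws \<mu>) {\<theta> \<in> space (param_measure CARD('n) ws \<mu>).
     sign_region (row_weight \<theta> :: nat \<Rightarrow> real^'n::finite) (row_bias CARD('n) \<theta>) {} {} {..<hd ws} \<noteq> {}}"
proof -
  define I where "I = net_params CARD('n) ws"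
  define M where "M = param_measure CARD('n) ws \<mu>"
  define f :: "nat \<times> nat \<times> nat \<Rightarrow> real \<Rightarrow> real"
    where "f i = (if fst i = 0 \<and> fst (snd i) \<in> T then uminus else (\<lambda>x. x))" for i
  define \<phi> where "\<phi> = (\<lambda>\<theta>. \<lambda>i\<in>I. f i (\<theta> i))"
  note D = admissible_distributionD[OF adm]
  have f: "f i \<in> \<mu> \<rightarrow>\<^sub>M \<mu>" "distr \<mu> \<mu> (f i) = \<mu>" for i unfolding f_def using D(4,5) by auto
  have \<phi>: "\<phi> \<in> M \<rightarrow>\<^sub>M M" "distr M M \<phi> = M"
    unfolding \<phi>_def M_def param_measure_def I_def using distr_PiM_componentwise[OF D(1) finite_net_params f] by auto
  define R where "R \<theta> = sign_region (row_weight \<theta> :: nat \<Rightarrow> real^'n) (row_bias CARD('n) \<theta>)" for \<theta>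
  have Rm: "{\<theta> \<in> space M. R \<theta> {} {} {..<hd ws} \<noteq> {}} \<in> sets M"
    unfolding M_def R_def by (rule sets_sign_region) auto
  have "R (\<phi> \<theta>) {} {} {..<hd ws} = R \<theta> {} T ({..<hd ws} - T)" for \<theta>
  proof -
    have \<phi>v: "\<phi> \<theta> (0,j,k) = (if j \<in> T then - \<theta> (0,j,k) else \<theta> (0,j,k))" if "j < hd ws" "k \<le> CARD('n)" for j k
      unfolding \<phi>_def I_def f_def using net_params_first[OF ws(1)] that by auto
    have inv: "inv_into {..<CARD('n)} coord_enum i \<le> CARD('n)" for i :: 'n
      using bij_betw_inv_into[OF bij_coord_enum[where 'n='n]] unfolding bij_betw_def by (auto intro: less_imp_le)
    have w: "row_weight (\<phi> \<theta>) j = (if j \<in> T then - row_weight \<theta> j else row_weight \<theta> j :: real^'n)" if "j < hd ws" for j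
      using \<phi>v[OF that inv] by (auto simp: row_weight_def vec_eq_iff)
    have b: "row_bias CARD('n) (\<phi> \<theta>) j = (if j \<in> T then - row_bias CARD('n) \<theta> j else row_bias CARD('n) \<theta> j)" if "j < hd ws" for j
      using \<phi>v[OF that order_refl] by (auto simp: row_bias_def)
    have l: "(row_weight (\<phi> \<theta>) j :: real^'n) \<bullet> x + row_bias CARD('n) (\<phi> \<theta>) j =
       (if j \<in> T then - (row_weight \<theta> j \<bullet> x + row_bias CARD('n) \<theta> j) else row_weight \<theta> j \<bullet> x + row_bias CARD('n) \<theta> j)"
      if "j < hd ws" for j x
      using w[OF that] b[OF that] by simp
    have "(\<forall>j\<in>{..<hd ws}. (row_weight (\<phi> \<theta>) j :: real^'n) \<bullet> x + row_bias CARD('n) (\<phi> \<theta>) j < 0) \<longleftrightarrow>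
       (\<forall>j\<in>T. row_weight \<theta> j \<bullet> x + row_bias CARD('n) \<theta> j > 0) \<and>
       (\<forall>j\<in>{..<hd ws} - T. row_weight \<theta> j \<bullet> x + row_bias CARD('n) \<theta> j < 0)" for x
    proof -
      have "(\<forall>j\<in>{..<hd ws}. (row_weight (\<phi> \<theta>) j :: real^'n) \<bullet> x + row_bias CARD('n) (\<phi> \<theta>) j < 0) \<longleftrightarrow>
        (\<forall>j\<in>{..<hd ws}. (if j \<in> T then row_weight \<theta> j \<bullet> x + row_bias CARD('n) \<theta> j > 0 else row_weight \<theta> j \<bullet> x + row_bias CARD('n) \<theta> j < 0))"
        by (intro ball_cong refl) (simp only: l lessThan_iff neg_less_0_iff_less split: if_split, blast)
      then show ?thesis using T by (auto split: if_splits)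
    qed
    then show ?thesis unfolding R_def sign_region_def by simp
  qed
  then have eq: "\<phi> -` {\<theta> \<in> space M. R \<theta> {} {} {..<hd ws} \<noteq> {}} \<inter> space M = {\<theta> \<in> space M. R \<theta> {} T ({..<hd ws} - T) \<noteq> {}}"
    using measurable_space[OF \<phi>(1)] by auto
  have "measure M {\<theta> \<in> space M. R \<theta> {} {} {..<hd ws} \<noteq> {}} = measure (distr M M \<phi>) {\<theta> \<in> space M. R \<theta> {} {} {..<hd ws} \<noteq> {}}"
    using \<phi>(2) by simp
  also have "\<dots> = measure M {\<theta> \<in> space M. R \<theta> {} T ({..<hd ws} - T) \<noteq> {}}"
    unfolding measure_distr[OF \<phi>(1) Rm] eq ..
  finally show ?thesis unfolding M_def R_def by simp
qed

text \<open>Integrating the number of realised patterns in two ways: it is almost surely the region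
  count, and its expectation is the sum of the pattern probabilities, all equal to that of the empty
  on-set.\<close>

lemma measure_dead_region:
  "measure (param_measure CARD('n) ws \<mu>) {\<theta> \<in> space (param_measure CARD('n) ws \<mu>).
     sign_region (row_weight \<theta> :: nat \<Rightarrow> real^'n::finite) (row_bias CARD('n) \<theta>) {} {} {..<hd ws} \<noteq> {}}
   = real (\<Sum>k\<le>CARD('n). hd ws choose k) / 2 ^ hd ws"
proof -
  define M where "M = param_measure CARD('n) ws \<mu>"
  define m where "m = hd ws"
  define A where "A T = {\<theta> \<in> space M. sign_region (row_weight \<theta> :: nat \<Rightarrow> real^'n) (row_bias CARD('n) \<theta>) {} T ({..<m} - T) \<noteq> {}}" for T
  define C where "C = (\<Sum>k\<le>CARD('n). m choose k)"
  interpret M: prob_space M unfolding M_def by (rule prob_space_param)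
  have Am: "A T \<in> sets M" if "T \<subseteq> {..<m}" for T
    unfolding A_def M_def using finite_subset[OF that] by (intro sets_sign_region) auto
  have flip: "M.prob (A T) = M.prob (A {})" if "T \<subseteq> {..<m}" for T
    using measure_sign_region_flip[OF that[unfolded m_def], where 'n='n] unfolding A_def M_def m_def by simp
  have "AE \<theta> in M. (\<Sum>T\<in>Pow {..<m}. indicator (A T) \<theta>) = real C"
    using AE_generic_net[where 'n='n] AE_space unfolding M_def[symmetric]
  proof eventually_elim
    case (elim \<theta>)
    have "card (regions (row_weight \<theta> :: nat \<Rightarrow> real^'n) (row_bias CARD('n) \<theta>) {} {..<m}) = C"
      using card_regions[of "{..<m}" "{}" "row_weight \<theta> :: nat \<Rightarrow> real^'n" "row_bias CARD('n) \<theta>" "CARD('n)"]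
        generic_net_imp_general_position[OF elim(1)] unfolding C_def m_def by simp
    moreover have "(\<Sum>T\<in>Pow {..<m}. indicator (A T) \<theta>) = real (card {T \<in> Pow {..<m}. \<theta> \<in> A T})"
      by (simp add: indicator_def sum.If_cases Int_def)
    moreover have "{T \<in> Pow {..<m}. \<theta> \<in> A T} = regions (row_weight \<theta> :: nat \<Rightarrow> real^'n) (row_bias CARD('n) \<theta>) {} {..<m}"
      unfolding A_def regions_def using elim(2) by auto
    ultimately show ?case by simp
  qed
  then have "(\<integral>\<theta>. (\<Sum>T\<in>Pow {..<m}. indicator (A T) \<theta>) \<partial>M) = (\<integral>\<theta>. real C \<partial>M)"
    using Am by (intro integral_cong_AE) auto
  also have "\<dots> = real C" using M.prob_space by simp
  also have "(\<integral>\<theta>. (\<Sum>T\<in>Pow {..<m}. indicator (A T) \<theta>) \<partial>M) = (\<Sum>T\<in>Pow {..<m}. M.prob (A T))"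
    using Am by (subst Bochner_Integration.integral_sum) (auto simp: M.emeasure_eq_measure)
  also have "\<dots> = (\<Sum>T\<in>Pow {..<m}. M.prob (A {}))" by (intro sum.cong refl flip) auto
  also have "\<dots> = 2 ^ m * M.prob (A {})" by (simp add: card_Pow)
  finally have "M.prob (A {}) = real C / 2 ^ m" by (simp add: field_simps)
  then show ?thesis unfolding A_def C_def M_def m_def by simp
qed

lemma measure_no_dead_region:
  "measure (param_measure CARD('n) ws \<mu>) {\<theta> \<in> space (param_measure CARD('n) ws \<mu>).
     sign_region (row_weight \<theta> :: nat \<Rightarrow> real^'n::finite) (row_bias CARD('n) \<theta>) {} {} {..<hd ws} = {}}
   = (\<Sum>k\<in>{CARD('n)+1..hd ws}. real (hd ws choose k)) / 2 ^ hd ws" (is "measure ?M ?E = _")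
  and sets_no_dead_region: "{\<theta> \<in> space (param_measure CARD('n) ws \<mu>).
     sign_region (row_weight \<theta> :: nat \<Rightarrow> real^'n::finite) (row_bias CARD('n) \<theta>) {} {} {..<hd ws} = {}}
      \<in> sets (param_measure CARD('n) ws \<mu>)"
proof -
  interpret M: prob_space ?M by (rule prob_space_param)
  define D where "D = {\<theta> \<in> space ?M. sign_region (row_weight \<theta> :: nat \<Rightarrow> real^'n) (row_bias CARD('n) \<theta>) {} {} {..<hd ws} \<noteq> {}}"
  have D: "D \<in> sets ?M" unfolding D_def by (rule sets_sign_region) auto
  have E: "?E = space ?M - D" unfolding D_def by auto
  show "?E \<in> sets ?M" unfolding E using D by blast
  have "measure ?M ?E = 1 - measure ?M D" unfolding E by (rule M.prob_compl[OF D])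
  also have "measure ?M D = real (\<Sum>k\<le>CARD('n). hd ws choose k) / 2 ^ hd ws"
    unfolding D_def by (rule measure_dead_region)
  also have "1 - \<dots> = (2 ^ hd ws - real (\<Sum>k\<le>CARD('n). hd ws choose k)) / 2 ^ hd ws" by (simp add: diff_divide_distrib)
  also have "2 ^ hd ws - real (\<Sum>k\<le>CARD('n). hd ws choose k) = (\<Sum>k\<in>{CARD('n)+1..hd ws}. real (hd ws choose k))"
    using arg_cong[OF sum_choose_complement[where n="CARD('n)" and m="hd ws"], of real] by simp
  finally show "measure ?M ?E = (\<Sum>k\<in>{CARD('n)+1..hd ws}. real (hd ws choose k)) / 2 ^ hd ws" .
qed

end

theorem theorem1p2:
  fixes ws :: "nat list" and \<mu> :: "real measure"
  assumes "ws \<noteq> []" and "\<forall>w\<in>set ws. w > 0"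
    and "admissible_distribution \<mu>"
  shows "(length ws = 1 \<longrightarrow>
            {\<theta> \<in> space (param_measure CARD('n::finite) ws \<mu>). pl_morse (relu_net ws \<theta> :: real^'n \<Rightarrow> real)}
              \<in> sets (param_measure CARD('n) ws \<mu>)
          \<and> measure (param_measure CARD('n) ws \<mu>)
              {\<theta> \<in> space (param_measure CARD('n) ws \<mu>). pl_morse (relu_net ws \<theta> :: real^'n \<Rightarrow> real)}
            = (\<Sum>k\<in>{CARD('n)+1..hd ws}. real (hd ws choose k)) / 2 ^ hd ws)
       \<and> (length ws > 1 \<longrightarrow>
          (\<exists>E\<in>sets (param_measure CARD('n) ws \<mu>).
             {\<theta> \<in> space (param_measure CARD('n) ws \<mu>). pl_morse (relu_net ws \<theta> :: real^'n \<Rightarrow> real)} \<subseteq> E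
           \<and> measure (param_measure CARD('n) ws \<mu>) E
               \<le> (\<Sum>k\<in>{CARD('n)+1..hd ws}. real (hd ws choose k)) / 2 ^ hd ws))"
proof -
  define M where "M = param_measure CARD('n) ws \<mu>"
  define E where "E = {\<theta> \<in> space M. sign_region (row_weight \<theta> :: nat \<Rightarrow> real^'n) (row_bias CARD('n) \<theta>) {} {} {..<hd ws} = {}}"
  define X where "X = {\<theta> \<in> space M. pl_morse (relu_net ws \<theta> :: real^'n \<Rightarrow> real)}"
  have Em: "E \<in> sets M" unfolding E_def M_def by (rule sets_no_dead_region[OF assms])
  have Ep: "measure M E = (\<Sum>k\<in>{CARD('n)+1..hd ws}. real (hd ws choose k)) / 2 ^ hd ws"
    unfolding E_def M_def by (rule measure_no_dead_region[OF assms])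
  have sub: "X \<subseteq> E" unfolding X_def E_def using pl_morse_imp_no_dead_region[OF assms(1), where 'n='n] by blast
  interpret M: prob_space M unfolding M_def by (rule prob_space_param[OF assms])
  have "X \<in> sets M \<and> measure M X = measure M E" if len: "length ws = 1"
  proof
    obtain m where m: "ws = [m]" using len by (auto simp: length_Suc_conv)
    show Xm: "X \<in> sets M"
      unfolding X_def M_def param_measure_def m
      by (rule sets_PiM_Collect_borel[OF admissible_distributionD(2)[OF assms(3)] borel_pl_morse_single])
    have "AE \<theta> in M. \<theta> \<in> X \<longleftrightarrow> \<theta> \<in> E"
      using AE_generic_net[OF assms, where 'n='n] AE_space unfolding M_def[symmetric]
    proof eventually_elim
      case (elim \<theta>)
      have "\<theta> \<in> X" if "\<theta> \<in> E"
        using generic_net_pl_morse[OF elim(1)] that unfolding E_def X_def m by simp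
      then show ?case using sub by blast
    qed
    then show "measure M X = measure M E" by (rule M.finite_measure_eq_AE[OF _ Xm Em])
  qed
  \<comment> \<open>For deeper networks \<open>E\<close> itself is the measurable cover of
    \<open>X\<close>.\<close>
  then show ?thesis
    unfolding Ep[symmetric] M_def[symmetric] X_def[symmetric] using Em sub by blast
qed

end
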